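(* The substitude for triples $(A,B,C)$, where $A$ and $B$ are non-symmetric operads and $C$ is an $A$-$B$-bimodule, is quasi-tame.
   Context: A substitude $(P,\mathbf{A})$ is a $\mathrm{Set}$-valued coloured symmetric operad $P$ whose colours are the objects of a small category $\mathbf{A}$, together with an identity-on-objects functor $\eta$ from $\mathbf{A}$ to the category of unary operations of $P$. A coloured operad, in particular a polynomial monad (equivalently a coloured operad with free symmetric group actions), is regarded as a substitude with $\mathbf{A}$ the discrete category on the set of colours. A categorical $P$-algebra is a $P$-algebra $\mathcal{C}$ in $\mathrm{Cat}$. An internal $(\mathcal{P}+\mathcal{A})$-algebra in $\mathcal{C}$ consists of objects $X(a),K(a)\in\mathcal{C}(a)$ for each $a\in\mathbf{A}$, morphisms $p(X(a_1),\dots,X(a_n))\to X(a)$ for all $p\in P(a_1,\dots,a_n;a)$, and morphisms $\eta(u)(K(a))\to K(b)$ for all $u:a\to b$ in $\mathbf{A}$ (no extra data when $\mathbf{A}$ is discrete), subject to associativity, unit and equivariance conditions. The classifier $\mathcal{P}^{\mathcal{P}+\mathcal{A}}$ is the categorical $P$-algebra representing the 2-functor which sends $\mathcal{C}$ to the category of internal $(\mathcal{P}+\mathcal{A})$-algebras in $\mathcal{C}$; it is regarded as a category (coproduct over colours of its components). $(P,\mathbf{A})$ is quasi-tame if the fundamental groupoid $\Pi_1(\mathcal{P}^{\mathcal{P}+\mathcal{A}})$ (localization at all morphisms) is equivalent to a discrete groupoid, i.e. has only trivial automorphism groups. The substitude in question is the $\Sigma$-free coloured operad with discrete category of colours $\mathbb{N}\sqcup\mathbb{N}\sqcup\mathbb{N}$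 whose algebras are exactly the triples of non-symmetric operads $A=\{A(n)\}$, $B=\{B(n)\}$ and an $A$-$B$-bimodule $C=\{C(n)\}$: $C$ has a left action $A(k)\otimes C(n_1)\otimes\cdots\otimes C(n_k)\to C(n_1+\cdots+n_k)$ and a right action $C(k)\otimes B(n_1)\otimes\cdots\otimes B(n_k)\to C(n_1+\cdots+n_k)$, associative, unital and commuting with each other. *)

theory Defs
  imports "HOL-Combinatorics.Permutations"
begin

section \<open>Categories\<close>

record ('o, 'm) cat =
  Obj :: "'o set"
  Arr :: "'m set"
  Dom :: "'m \<Rightarrow> 'o"
  Cod :: "'m \<Rightarrow> 'o"
  Id :: "'o \<Rightarrow> 'm"
  Comp :: "'m \<Rightarrow> 'm \<Rightarrow> 'm"  \<comment> \<open>\<open>Comp C g f\<close> is \<open>g\<close> after \<open>f\<close>\<close>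

locale category =
  fixes C :: "('o, 'm) cat"
  assumes Dom_closed: "f \<in> Arr C \<Longrightarrow> Dom C f \<in> Obj C"
    and Cod_closed: "f \<in> Arr C \<Longrightarrow> Cod C f \<in> Obj C"
    and Id_closed: "x \<in> Obj C \<Longrightarrow> Id C x \<in> Arr C"
    and Dom_Id: "x \<in> Obj C \<Longrightarrow> Dom C (Id C x) = x"
    and Cod_Id: "x \<in> Obj C \<Longrightarrow> Cod C (Id C x) = x"
    and Comp_closed: "f \<in> Arr C \<Longrightarrow> g \<in> Arr C \<Longrightarrow> Cod C f = Dom C g \<Longrightarrow> Comp C g f \<in> Arr C"
    and Dom_Comp: "f \<in> Arr C \<Longrightarrow> g \<in> Arr C \<Longrightarrow> Cod C f = Dom C g \<Longrightarrow> Dom C (Comp C g f) = Dom C f"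
    and Cod_Comp: "f \<in> Arr C \<Longrightarrow> g \<in> Arr C \<Longrightarrow> Cod C f = Dom C g \<Longrightarrow> Cod C (Comp C g f) = Cod C g"
    and Comp_Id_right: "f \<in> Arr C \<Longrightarrow> Comp C f (Id C (Dom C f)) = f"
    and Comp_Id_left: "f \<in> Arr C \<Longrightarrow> Comp C (Id C (Cod C f)) f = f"
    and Comp_assoc: "f \<in> Arr C \<Longrightarrow> g \<in> Arr C \<Longrightarrow> h \<in> Arr C \<Longrightarrow> Cod C f = Dom C g \<Longrightarrow>
      Cod C g = Dom C h \<Longrightarrow> Comp C h (Comp C g f) = Comp C (Comp C h g) f"

definition arrow :: "('o, 'm) cat \<Rightarrow> 'm \<Rightarrow> 'o \<Rightarrow> 'o \<Rightarrow> bool" where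
  "arrow C f x y \<longleftrightarrow> f \<in> Arr C \<and> Dom C f = x \<and> Cod C f = y"

definition is_functor ::
  "('o, 'm) cat \<Rightarrow> ('p, 'n) cat \<Rightarrow> ('o \<Rightarrow> 'p) \<Rightarrow> ('m \<Rightarrow> 'n) \<Rightarrow> bool" where
  "is_functor C D FO FM \<longleftrightarrow>
    (\<forall>x \<in> Obj C. FO x \<in> Obj D \<and> FM (Id C x) = Id D (FO x)) \<and>
    (\<forall>f \<in> Arr C. arrow D (FM f) (FO (Dom C f)) (FO (Cod C f))) \<and>
    (\<forall>f \<in> Arr C. \<forall>g \<in> Arr C. Cod C f = Dom C g \<longrightarrow>
      FM (Comp C g f) = Comp D (FM g) (FM f))"

definition is_nat_trans ::
  "('o, 'm) cat \<Rightarrow> ('p, 'n) cat \<Rightarrow> ('o \<Rightarrow> 'p) \<Rightarrow> ('m \<Rightarrow> 'n) \<Rightarrow> ('o \<Rightarrow> 'p) \<Rightarrow> ('m \<Rightarrow> 'n) \<Rightarrow>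
   ('o \<Rightarrow> 'n) \<Rightarrow> bool" where
  "is_nat_trans C D FO FM GO GM t \<longleftrightarrow>
    (\<forall>x \<in> Obj C. arrow D (t x) (FO x) (GO x)) \<and>
    (\<forall>f \<in> Arr C. Comp D (t (Cod C f)) (FM f) = Comp D (GM f) (t (Dom C f)))"

definition is_iso :: "('o, 'm) cat \<Rightarrow> 'm \<Rightarrow> bool" where
  "is_iso C f \<longleftrightarrow> f \<in> Arr C \<and> (\<exists>g. arrow C g (Cod C f) (Dom C f) \<and>
    Comp C g f = Id C (Dom C f) \<and> Comp C f g = Id C (Cod C f))"

definition equivalent_categories :: "('o, 'm) cat \<Rightarrow> ('p, 'n) cat \<Rightarrow> bool" where
  "equivalent_categories C D \<longleftrightarrow>
    (\<exists>FO FM GO GM t s.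
      is_functor C D FO FM \<and> is_functor D C GO GM \<and>
      is_nat_trans C C (\<lambda>x. x) (\<lambda>f. f) (GO \<circ> FO) (GM \<circ> FM) t \<and> (\<forall>x \<in> Obj C. is_iso C (t x)) \<and>
      is_nat_trans D D (FO \<circ> GO) (FM \<circ> GM) (\<lambda>y. y) (\<lambda>g. g) s \<and> (\<forall>y \<in> Obj D. is_iso D (s y)))"

definition discrete_cat :: "'o set \<Rightarrow> ('o, 'o) cat" where
  "discrete_cat S = \<lparr>Obj = S, Arr = S, Dom = (\<lambda>x. x), Cod = (\<lambda>x. x), Id = (\<lambda>x. x),
     Comp = (\<lambda>g f. f)\<rparr>"


section \<open>The fundamental groupoid: localization at all morphisms\<close>

datatype 'm step = Fwd 'm | Bwd 'm

inductive zigzag :: "('o, 'm) cat \<Rightarrow> 'o \<Rightarrow> 'm step list \<Rightarrow> 'o \<Rightarrow> bool" for C where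
  zz_nil: "x \<in> Obj C \<Longrightarrow> zigzag C x [] x"
| zz_fwd: "f \<in> Arr C \<Longrightarrow> zigzag C (Cod C f) w y \<Longrightarrow> zigzag C (Dom C f) (Fwd f # w) y"
| zz_bwd: "f \<in> Arr C \<Longrightarrow> zigzag C (Dom C f) w y \<Longrightarrow> zigzag C (Cod C f) (Bwd f # w) y"

inductive zigzag_eq :: "('o, 'm) cat \<Rightarrow> 'o \<Rightarrow> 'm step list \<Rightarrow> 'm step list \<Rightarrow> 'o \<Rightarrow> bool" for C where
  ze_refl: "zigzag C x w y \<Longrightarrow> zigzag_eq C x w w y"
| ze_sym: "zigzag_eq C x v w y \<Longrightarrow> zigzag_eq C x w v y"
| ze_trans: "zigzag_eq C x u v y \<Longrightarrow> zigzag_eq C x v w y \<Longrightarrow> zigzag_eq C x u w y"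
| ze_append: "zigzag_eq C x v v' y \<Longrightarrow> zigzag_eq C y w w' z \<Longrightarrow> zigzag_eq C x (v @ w) (v' @ w') z"
| ze_id: "x \<in> Obj C \<Longrightarrow> zigzag_eq C x [Fwd (Id C x)] [] x"
| ze_comp: "f \<in> Arr C \<Longrightarrow> g \<in> Arr C \<Longrightarrow> Cod C f = Dom C g \<Longrightarrow>
    zigzag_eq C (Dom C f) [Fwd f, Fwd g] [Fwd (Comp C g f)] (Cod C g)"
| ze_inv1: "f \<in> Arr C \<Longrightarrow> zigzag_eq C (Dom C f) [Fwd f, Bwd f] [] (Dom C f)"
| ze_inv2: "f \<in> Arr C \<Longrightarrow> zigzag_eq C (Cod C f) [Bwd f, Fwd f] [] (Cod C f)"

definition fundamental_groupoid ::
  "('o, 'm) cat \<Rightarrow> ('o, 'o \<times> 'm step list set \<times> 'o) cat" where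
  "fundamental_groupoid C =
    \<lparr>Obj = Obj C,
     Arr = {(x, {v. zigzag_eq C x w v y}, y) | x w y. zigzag C x w y},
     Dom = (\<lambda>(x, _, _). x),
     Cod = (\<lambda>(_, _, y). y),
     Id = (\<lambda>x. (x, {v. zigzag_eq C x [] v x}, x)),
     Comp = (\<lambda>(_, W, z) (x, V, _). (x, {u. \<exists>v \<in> V. \<exists>w \<in> W. zigzag_eq C x (v @ w) u z}, z))\<rparr>"


section \<open>Coloured symmetric operads and substitudes\<close>

text \<open>
  \<open>P(a\<^sub>1, \<dots>, a\<^sub>n; a)\<close> is the set of all \<open>p \<in> Ops P\<close> with \<open>In P p = [a\<^sub>1, \<dots>, a\<^sub>n]\<close> and \<open>Out P p = a\<close>.
  \<open>Cmp P p [q\<^sub>1, \<dots>, q\<^sub>n]\<close> is \<open>p(q\<^sub>1, \<dots>, q\<^sub>n)\<close>. \<open>Act P p s\<close> is the right action of the permutation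
  \<open>s\<close> of \<open>{..<n}\<close>, so that \<open>(p s)(x\<^bsub>s 0\<^esub>, \<dots>, x\<^bsub>s (n-1)\<^esub>) = p(x\<^sub>0, \<dots>, x\<^bsub>n-1\<^esub>)\<close> in any algebra.
\<close>

record ('c, 'p) operad =
  Col :: "'c set"
  Ops :: "'p set"
  In :: "'p \<Rightarrow> 'c list"
  Out :: "'p \<Rightarrow> 'c"
  One :: "'c \<Rightarrow> 'p"
  Cmp :: "'p \<Rightarrow> 'p list \<Rightarrow> 'p"
  Act :: "'p \<Rightarrow> (nat \<Rightarrow> nat) \<Rightarrow> 'p"

definition perm_of_word :: "nat list \<Rightarrow> nat \<Rightarrow> nat" where
  "perm_of_word w = (\<lambda>i. if i < length w then w ! i else i)"

text \<open>The consecutive intervals of lengths \<open>k\<^sub>0, k\<^sub>1, \<dots>\<close> into which \<open>{..<k\<^sub>0 + k\<^sub>1 + \<dots>}\<close> splits.\<close>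

definition offset :: "nat list \<Rightarrow> nat \<Rightarrow> nat" where
  "offset ks i = sum_list (take i ks)"

definition blocks :: "nat list \<Rightarrow> nat list list" where
  "blocks ks = map (\<lambda>i. [offset ks i..<offset ks i + ks ! i]) [0..<length ks]"

text \<open>\<open>block_perm s ks\<close> permutes these intervals by \<open>s\<close>; \<open>sum_perm ss ks\<close> acts on the \<open>i\<close>-th
  interval by the \<open>i\<close>-th permutation of \<open>ss\<close>.\<close>

definition block_perm :: "(nat \<Rightarrow> nat) \<Rightarrow> nat list \<Rightarrow> nat \<Rightarrow> nat" where
  "block_perm s ks = perm_of_word (concat (permute_list s (blocks ks)))"

definition sum_perm :: "(nat \<Rightarrow> nat) list \<Rightarrow> nat list \<Rightarrow> nat \<Rightarrow> nat" where
  "sum_perm ss ks = perm_of_word (concat (map2 permute_list ss (blocks ks)))"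

definition arity :: "('c, 'p) operad \<Rightarrow> 'p \<Rightarrow> nat" where
  "arity P p = length (In P p)"

definition composable :: "('c, 'p) operad \<Rightarrow> 'p \<Rightarrow> 'p list \<Rightarrow> bool" where
  "composable P p qs \<longleftrightarrow> p \<in> Ops P \<and> set qs \<subseteq> Ops P \<and> map (Out P) qs = In P p"

locale symmetric_operad =
  fixes P :: "('c, 'p) operad"
  assumes In_closed: "p \<in> Ops P \<Longrightarrow> set (In P p) \<subseteq> Col P"
    and Out_closed: "p \<in> Ops P \<Longrightarrow> Out P p \<in> Col P"
    and One_closed: "a \<in> Col P \<Longrightarrow> One P a \<in> Ops P"
    and In_One: "a \<in> Col P \<Longrightarrow> In P (One P a) = [a]"
    and Out_One: "a \<in> Col P \<Longrightarrow> Out P (One P a) = a"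
    and Cmp_closed: "composable P p qs \<Longrightarrow> Cmp P p qs \<in> Ops P"
    and In_Cmp: "composable P p qs \<Longrightarrow> In P (Cmp P p qs) = concat (map (In P) qs)"
    and Out_Cmp: "composable P p qs \<Longrightarrow> Out P (Cmp P p qs) = Out P p"
    and Act_closed: "p \<in> Ops P \<Longrightarrow> s permutes {..<arity P p} \<Longrightarrow> Act P p s \<in> Ops P"
    and In_Act: "p \<in> Ops P \<Longrightarrow> s permutes {..<arity P p} \<Longrightarrow> In P (Act P p s) = permute_list s (In P p)"
    and Out_Act: "p \<in> Ops P \<Longrightarrow> s permutes {..<arity P p} \<Longrightarrow> Out P (Act P p s) = Out P p"
    and Cmp_One_left: "p \<in> Ops P \<Longrightarrow> Cmp P (One P (Out P p)) [p] = p"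
    and Cmp_One_right: "p \<in> Ops P \<Longrightarrow> Cmp P p (map (One P) (In P p)) = p"
    and Cmp_assoc: "composable P p qs \<Longrightarrow> list_all2 (composable P) qs rss \<Longrightarrow>
      Cmp P p (map2 (Cmp P) qs rss) = Cmp P (Cmp P p qs) (concat rss)"
    and Act_id: "p \<in> Ops P \<Longrightarrow> Act P p id = p"
    and Act_comp: "p \<in> Ops P \<Longrightarrow> s permutes {..<arity P p} \<Longrightarrow> t permutes {..<arity P p} \<Longrightarrow>
      Act P (Act P p s) t = Act P p (s \<circ> t)"
    and Cmp_Act_left: "composable P p qs \<Longrightarrow> s permutes {..<arity P p} \<Longrightarrow>
      Cmp P (Act P p s) (permute_list s qs) = Act P (Cmp P p qs) (block_perm s (map (arity P) qs))"
    and Cmp_Act_right: "composable P p qs \<Longrightarrow>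
      list_all2 (\<lambda>s q. s permutes {..<arity P q}) ss qs \<Longrightarrow>
      Cmp P p (map2 (Act P) qs ss) = Act P (Cmp P p qs) (sum_perm ss (map (arity P) qs))"

record ('c, 'p, 'u) substitude =
  Opd :: "('c, 'p) operad"
  Base :: "('c, 'u) cat"
  Eta :: "'u \<Rightarrow> 'p"

locale substitude =
  fixes S :: "('c, 'p, 'u) substitude"
  assumes operad: "symmetric_operad (Opd S)"
    and base: "category (Base S)"
    and Obj_Base: "Obj (Base S) = Col (Opd S)"
    and Eta_closed: "u \<in> Arr (Base S) \<Longrightarrow> Eta S u \<in> Ops (Opd S)"
    and In_Eta: "u \<in> Arr (Base S) \<Longrightarrow> In (Opd S) (Eta S u) = [Dom (Base S) u]"
    and Out_Eta: "u \<in> Arr (Base S) \<Longrightarrow> Out (Opd S) (Eta S u) = Cod (Base S) u"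
    and Eta_Id: "a \<in> Obj (Base S) \<Longrightarrow> Eta S (Id (Base S) a) = One (Opd S) a"
    and Eta_Comp: "u \<in> Arr (Base S) \<Longrightarrow> v \<in> Arr (Base S) \<Longrightarrow> Cod (Base S) u = Dom (Base S) v \<Longrightarrow>
      Eta S (Comp (Base S) v u) = Cmp (Opd S) (Eta S v) [Eta S u]"

definition discrete_substitude :: "('c, 'p) operad \<Rightarrow> ('c, 'p, 'c) substitude" where
  "discrete_substitude P = \<lparr>Opd = P, Base = discrete_cat (Col P), Eta = One P\<rparr>"


section \<open>Categorical algebras\<close>

record ('c, 'p, 'o, 'm) cat_alg =
  Cat :: "'c \<Rightarrow> ('o, 'm) cat"
  OpO :: "'p \<Rightarrow> 'o list \<Rightarrow> 'o"
  OpM :: "'p \<Rightarrow> 'm list \<Rightarrow> 'm"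

text \<open>Objects and arrows of the product category \<open>C(a\<^sub>1) \<times> \<dots> \<times> C(a\<^sub>n)\<close>.\<close>

definition objs :: "('c, 'p, 'o, 'm) cat_alg \<Rightarrow> 'c list \<Rightarrow> 'o list set" where
  "objs C as = {xs. list_all2 (\<lambda>a x. x \<in> Obj (Cat C a)) as xs}"

definition arrs :: "('c, 'p, 'o, 'm) cat_alg \<Rightarrow> 'c list \<Rightarrow> 'm list set" where
  "arrs C as = {fs. list_all2 (\<lambda>a f. f \<in> Arr (Cat C a)) as fs}"

definition doms :: "('c, 'p, 'o, 'm) cat_alg \<Rightarrow> 'c list \<Rightarrow> 'm list \<Rightarrow> 'o list" where
  "doms C as fs = map2 (\<lambda>a. Dom (Cat C a)) as fs"

definition cods :: "('c, 'p, 'o, 'm) cat_alg \<Rightarrow> 'c list \<Rightarrow> 'm list \<Rightarrow> 'o list" where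
  "cods C as fs = map2 (\<lambda>a. Cod (Cat C a)) as fs"

definition ids :: "('c, 'p, 'o, 'm) cat_alg \<Rightarrow> 'c list \<Rightarrow> 'o list \<Rightarrow> 'm list" where
  "ids C as xs = map2 (\<lambda>a. Id (Cat C a)) as xs"

definition comps :: "('c, 'p, 'o, 'm) cat_alg \<Rightarrow> 'c list \<Rightarrow> 'm list \<Rightarrow> 'm list \<Rightarrow> 'm list" where
  "comps C as gs fs = map2 (\<lambda>a (g, f). Comp (Cat C a) g f) as (zip gs fs)"

locale categorical_algebra =
  fixes P :: "('c, 'p) operad" and C :: "('c, 'p, 'o, 'm) cat_alg"
  assumes category: "a \<in> Col P \<Longrightarrow> category (Cat C a)"
    and OpO_closed: "p \<in> Ops P \<Longrightarrow> xs \<in> objs C (In P p) \<Longrightarrow> OpO C p xs \<in> Obj (Cat C (Out P p))"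
    and OpM_arrow: "p \<in> Ops P \<Longrightarrow> fs \<in> arrs C (In P p) \<Longrightarrow>
      arrow (Cat C (Out P p)) (OpM C p fs)
        (OpO C p (doms C (In P p) fs)) (OpO C p (cods C (In P p) fs))"
    and OpM_ids: "p \<in> Ops P \<Longrightarrow> xs \<in> objs C (In P p) \<Longrightarrow>
      OpM C p (ids C (In P p) xs) = Id (Cat C (Out P p)) (OpO C p xs)"
    and OpM_comps: "p \<in> Ops P \<Longrightarrow> fs \<in> arrs C (In P p) \<Longrightarrow> gs \<in> arrs C (In P p) \<Longrightarrow>
      cods C (In P p) fs = doms C (In P p) gs \<Longrightarrow>
      OpM C p (comps C (In P p) gs fs) = Comp (Cat C (Out P p)) (OpM C p gs) (OpM C p fs)"
    and OpO_One: "a \<in> Col P \<Longrightarrow> x \<in> Obj (Cat C a) \<Longrightarrow> OpO C (One P a) [x] = x"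
    and OpM_One: "a \<in> Col P \<Longrightarrow> f \<in> Arr (Cat C a) \<Longrightarrow> OpM C (One P a) [f] = f"
    and OpO_Cmp: "composable P p qs \<Longrightarrow> list_all2 (\<lambda>q xs. xs \<in> objs C (In P q)) qs xss \<Longrightarrow>
      OpO C (Cmp P p qs) (concat xss) = OpO C p (map2 (OpO C) qs xss)"
    and OpM_Cmp: "composable P p qs \<Longrightarrow> list_all2 (\<lambda>q fs. fs \<in> arrs C (In P q)) qs fss \<Longrightarrow>
      OpM C (Cmp P p qs) (concat fss) = OpM C p (map2 (OpM C) qs fss)"
    and OpO_Act: "p \<in> Ops P \<Longrightarrow> s permutes {..<arity P p} \<Longrightarrow> xs \<in> objs C (In P p) \<Longrightarrow>
      OpO C (Act P p s) (permute_list s xs) = OpO C p xs"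
    and OpM_Act: "p \<in> Ops P \<Longrightarrow> s permutes {..<arity P p} \<Longrightarrow> fs \<in> arrs C (In P p) \<Longrightarrow>
      OpM C (Act P p s) (permute_list s fs) = OpM C p fs"

definition total_cat :: "('c, 'p) operad \<Rightarrow> ('c, 'p, 'o, 'm) cat_alg \<Rightarrow> ('c \<times> 'o, 'c \<times> 'm) cat" where
  "total_cat P C =
    \<lparr>Obj = (SIGMA a:Col P. Obj (Cat C a)),
     Arr = (SIGMA a:Col P. Arr (Cat C a)),
     Dom = (\<lambda>(a, f). (a, Dom (Cat C a) f)),
     Cod = (\<lambda>(a, f). (a, Cod (Cat C a) f)),
     Id = (\<lambda>(a, x). (a, Id (Cat C a) x)),
     Comp = (\<lambda>(_, g) (a, f). (a, Comp (Cat C a) g f))\<rparr>"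

record ('c, 'o1, 'm1, 'o2, 'm2) alg_map =
  MapO :: "'c \<Rightarrow> 'o1 \<Rightarrow> 'o2"
  MapM :: "'c \<Rightarrow> 'm1 \<Rightarrow> 'm2"

definition is_alg_map :: "('c, 'p) operad \<Rightarrow> ('c, 'p, 'o1, 'm1) cat_alg \<Rightarrow> ('c, 'p, 'o2, 'm2) cat_alg \<Rightarrow>
  ('c, 'o1, 'm1, 'o2, 'm2) alg_map \<Rightarrow> bool" where
  "is_alg_map P C D F \<longleftrightarrow>
    (\<forall>a \<in> Col P. is_functor (Cat C a) (Cat D a) (MapO F a) (MapM F a)) \<and>
    (\<forall>p \<in> Ops P. \<forall>xs \<in> objs C (In P p).
      MapO F (Out P p) (OpO C p xs) = OpO D p (map2 (MapO F) (In P p) xs)) \<and>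
    (\<forall>p \<in> Ops P. \<forall>fs \<in> arrs C (In P p).
      MapM F (Out P p) (OpM C p fs) = OpM D p (map2 (MapM F) (In P p) fs))"

definition alg_map_eq :: "('c, 'p) operad \<Rightarrow> ('c, 'p, 'o1, 'm1) cat_alg \<Rightarrow>
  ('c, 'o1, 'm1, 'o2, 'm2) alg_map \<Rightarrow> ('c, 'o1, 'm1, 'o2, 'm2) alg_map \<Rightarrow> bool" where
  "alg_map_eq P C F G \<longleftrightarrow>
    (\<forall>a \<in> Col P. (\<forall>x \<in> Obj (Cat C a). MapO F a x = MapO G a x) \<and>
      (\<forall>f \<in> Arr (Cat C a). MapM F a f = MapM G a f))"

definition is_alg_2cell :: "('c, 'p) operad \<Rightarrow> ('c, 'p, 'o1, 'm1) cat_alg \<Rightarrow> ('c, 'p, 'o2, 'm2) cat_alg \<Rightarrow>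
  ('c, 'o1, 'm1, 'o2, 'm2) alg_map \<Rightarrow> ('c, 'o1, 'm1, 'o2, 'm2) alg_map \<Rightarrow>
  ('c \<Rightarrow> 'o1 \<Rightarrow> 'm2) \<Rightarrow> bool" where
  "is_alg_2cell P C D F G t \<longleftrightarrow>
    (\<forall>a \<in> Col P. is_nat_trans (Cat C a) (Cat D a) (MapO F a) (MapM F a) (MapO G a) (MapM G a) (t a)) \<and>
    (\<forall>p \<in> Ops P. \<forall>xs \<in> objs C (In P p).
      t (Out P p) (OpO C p xs) = OpM D p (map2 t (In P p) xs))"


section \<open>Internal algebras and the classifier\<close>

record ('c, 'p, 'u, 'o, 'm) int_alg =
  X_of :: "'c \<Rightarrow> 'o"
  K_of :: "'c \<Rightarrow> 'o"
  mu :: "'p \<Rightarrow> 'm"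
  kappa :: "'u \<Rightarrow> 'm"

locale internal_algebra =
  fixes S :: "('c, 'p, 'u) substitude" and C :: "('c, 'p, 'o, 'm) cat_alg"
    and I :: "('c, 'p, 'u, 'o, 'm) int_alg"
  assumes X_closed: "a \<in> Col (Opd S) \<Longrightarrow> X_of I a \<in> Obj (Cat C a)"
    and K_closed: "a \<in> Col (Opd S) \<Longrightarrow> K_of I a \<in> Obj (Cat C a)"
    and mu_arrow: "p \<in> Ops (Opd S) \<Longrightarrow> arrow (Cat C (Out (Opd S) p)) (mu I p)
      (OpO C p (map (X_of I) (In (Opd S) p))) (X_of I (Out (Opd S) p))"
    and mu_One: "a \<in> Col (Opd S) \<Longrightarrow> mu I (One (Opd S) a) = Id (Cat C a) (X_of I a)"
    and mu_Cmp: "composable (Opd S) p qs \<Longrightarrow>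
      mu I (Cmp (Opd S) p qs) = Comp (Cat C (Out (Opd S) p)) (mu I p) (OpM C p (map (mu I) qs))"
    and mu_Act: "p \<in> Ops (Opd S) \<Longrightarrow> s permutes {..<arity (Opd S) p} \<Longrightarrow>
      mu I (Act (Opd S) p s) = mu I p"
    and kappa_arrow: "u \<in> Arr (Base S) \<Longrightarrow> arrow (Cat C (Cod (Base S) u)) (kappa I u)
      (OpO C (Eta S u) [K_of I (Dom (Base S) u)]) (K_of I (Cod (Base S) u))"
    and kappa_Id: "a \<in> Obj (Base S) \<Longrightarrow> kappa I (Id (Base S) a) = Id (Cat C a) (K_of I a)"
    and kappa_Comp: "u \<in> Arr (Base S) \<Longrightarrow> v \<in> Arr (Base S) \<Longrightarrow> Cod (Base S) u = Dom (Base S) v \<Longrightarrow>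
      kappa I (Comp (Base S) v u) =
        Comp (Cat C (Cod (Base S) v)) (kappa I v) (OpM C (Eta S v) [kappa I u])"

definition is_int_alg_mor :: "('c, 'p, 'u) substitude \<Rightarrow> ('c, 'p, 'o, 'm) cat_alg \<Rightarrow>
  ('c, 'p, 'u, 'o, 'm) int_alg \<Rightarrow> ('c, 'p, 'u, 'o, 'm) int_alg \<Rightarrow> ('c \<Rightarrow> 'm) \<Rightarrow> ('c \<Rightarrow> 'm) \<Rightarrow> bool" where
  "is_int_alg_mor S C I J h k \<longleftrightarrow>
    (\<forall>a \<in> Col (Opd S). arrow (Cat C a) (h a) (X_of I a) (X_of J a) \<and> arrow (Cat C a) (k a) (K_of I a) (K_of J a)) \<and>
    (\<forall>p \<in> Ops (Opd S).
      Comp (Cat C (Out (Opd S) p)) (h (Out (Opd S) p)) (mu I p) =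
      Comp (Cat C (Out (Opd S) p)) (mu J p) (OpM C p (map h (In (Opd S) p)))) \<and>
    (\<forall>u \<in> Arr (Base S).
      Comp (Cat C (Cod (Base S) u)) (k (Cod (Base S) u)) (kappa I u) =
      Comp (Cat C (Cod (Base S) u)) (kappa J u) (OpM C (Eta S u) [k (Dom (Base S) u)]))"

definition int_alg_eq :: "('c, 'p, 'u) substitude \<Rightarrow>
  ('c, 'p, 'u, 'o, 'm) int_alg \<Rightarrow> ('c, 'p, 'u, 'o, 'm) int_alg \<Rightarrow> bool" where
  "int_alg_eq S I J \<longleftrightarrow>
    (\<forall>a \<in> Col (Opd S). X_of I a = X_of J a \<and> K_of I a = K_of J a) \<and>
    (\<forall>p \<in> Ops (Opd S). mu I p = mu J p) \<and>
    (\<forall>u \<in> Arr (Base S). kappa I u = kappa J u)"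

text \<open>The internal algebra in \<open>D\<close> obtained from one in \<open>C\<close> along a strict morphism \<open>C \<rightarrow> D\<close>.\<close>

definition push :: "('c, 'p, 'u) substitude \<Rightarrow> ('c, 'o1, 'm1, 'o2, 'm2) alg_map \<Rightarrow>
  ('c, 'p, 'u, 'o1, 'm1) int_alg \<Rightarrow> ('c, 'p, 'u, 'o2, 'm2) int_alg" where
  "push S F I =
    \<lparr>X_of = (\<lambda>a. MapO F a (X_of I a)), K_of = (\<lambda>a. MapO F a (K_of I a)),
     mu = (\<lambda>p. MapM F (Out (Opd S) p) (mu I p)),
     kappa = (\<lambda>u. MapM F (Cod (Base S) u) (kappa I u))\<rparr>"

text \<open>
  \<open>W\<close> represents the 2-functor of internal algebras, with universal internal algebra \<open>U\<close>: for every
  categorical algebra \<open>C\<close> the functor \<open>F \<mapsto> push S F U\<close>, from strict morphisms \<open>W \<rightarrow> C\<close> and their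
  2-cells to internal algebras in \<open>C\<close> and their morphisms, is an isomorphism of categories, that is,
  bijective on objects and on each set of morphisms. By the Yoneda lemma every representation
  has this form. Smallness of \<open>W\<close> and \<open>C\<close> means that all objects and arrows are
  elements of one type \<open>'v\<close>, which plays the role of the universe of small sets.
\<close>

definition is_classifier :: "('c, 'p, 'u) substitude \<Rightarrow> ('c, 'p, 'v, 'v) cat_alg \<Rightarrow>
  ('c, 'p, 'u, 'v, 'v) int_alg \<Rightarrow> bool" where
  "is_classifier S W U \<longleftrightarrow>
    categorical_algebra (Opd S) W \<and> internal_algebra S W U \<and>
    (\<forall>(C :: ('c, 'p, 'v, 'v) cat_alg) I.
      categorical_algebra (Opd S) C \<and> internal_algebra S C I \<longrightarrow>
      (\<exists>F. is_alg_map (Opd S) W C F \<and> int_alg_eq S (push S F U) I \<and>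
        (\<forall>G. is_alg_map (Opd S) W C G \<and> int_alg_eq S (push S G U) I \<longrightarrow> alg_map_eq (Opd S) W F G))) \<and>
    (\<forall>(C :: ('c, 'p, 'v, 'v) cat_alg) F G h k.
      categorical_algebra (Opd S) C \<and> is_alg_map (Opd S) W C F \<and> is_alg_map (Opd S) W C G \<and>
      is_int_alg_mor S C (push S F U) (push S G U) h k \<longrightarrow>
      (\<exists>t. is_alg_2cell (Opd S) W C F G t \<and>
        (\<forall>a \<in> Col (Opd S). t a (X_of U a) = h a \<and> t a (K_of U a) = k a) \<and>
        (\<forall>t'. is_alg_2cell (Opd S) W C F G t' \<and>
            (\<forall>a \<in> Col (Opd S). t' a (X_of U a) = h a \<and> t' a (K_of U a) = k a) \<longrightarrow>
          (\<forall>a \<in> Col (Opd S). \<forall>x \<in> Obj (Cat W a). t' a x = t a x))))"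

text \<open>The classifier is unique up to isomorphism, so the choice of \<open>W\<close> does not matter. It exists
  if \<open>'v\<close> is infinite and not smaller than the types of colours, operations and base arrows.\<close>

definition quasi_tame :: "'v itself \<Rightarrow> ('c, 'p, 'u) substitude \<Rightarrow> bool" where
  "quasi_tame _ S \<longleftrightarrow>
    (\<exists>(W :: ('c, 'p, 'v, 'v) cat_alg) U. is_classifier S W U \<and>
      (\<exists>D :: ('c \<times> 'v) set.
        equivalent_categories (fundamental_groupoid (total_cat (Opd S) W)) (discrete_cat D)))"


section \<open>The operad for two non-symmetric operads and a bimodule\<close>

datatype colour = ColA nat | ColB nat | ColC nat

text \<open>
  The operations are planar trees. \<open>Leaf\<close> is the tree without vertices. A vertex \<open>Node i ts\<close> stands
  for the \<open>i\<close>-th argument of the operation, which must have as many inputs as \<open>ts\<close> has entries;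
  each argument labels exactly one vertex.
\<close>

datatype tree = Leaf | Node nat "tree list"

fun leaves :: "tree \<Rightarrow> nat" where
  "leaves Leaf = 1"
| "leaves (Node i ts) = sum_list (map leaves ts)"

fun labels :: "tree \<Rightarrow> nat list" where
  "labels Leaf = []"
| "labels (Node i ts) = i # concat (map labels ts)"

text \<open>
  The elements of the free triple \<open>(A, B, C)\<close> on given generators are exactly the following trees.
  In \<open>A\<close> and in \<open>B\<close> they are arbitrary planar trees with vertices of that colour, the tree \<open>Leaf\<close>
  being the operad unit. In \<open>C\<close>, along every branch to a leaf come first vertices from \<open>A\<close>, then
  exactly one from \<open>C\<close>, then vertices from \<open>B\<close>: associativity, unitality and compatibility of the
  two actions bring every composite uniquely into this form. A vertex of colour \<open>A(0)\<close> has no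
  branches; in \<open>C\<close> it is the left action of \<open>A(0)\<close> on no arguments, with value in \<open>C(0)\<close>.
\<close>

fun treeA :: "colour list \<Rightarrow> tree \<Rightarrow> bool" where
  "treeA as Leaf \<longleftrightarrow> True"
| "treeA as (Node i ts) \<longleftrightarrow> i < length as \<and> as ! i = ColA (length ts) \<and> (\<forall>t \<in> set ts. treeA as t)"

fun treeB :: "colour list \<Rightarrow> tree \<Rightarrow> bool" where
  "treeB as Leaf \<longleftrightarrow> True"
| "treeB as (Node i ts) \<longleftrightarrow> i < length as \<and> as ! i = ColB (length ts) \<and> (\<forall>t \<in> set ts. treeB as t)"

fun treeC :: "colour list \<Rightarrow> tree \<Rightarrow> bool" where
  "treeC as Leaf \<longleftrightarrow> False"
| "treeC as (Node i ts) \<longleftrightarrow> i < length as \<and>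
    (as ! i = ColA (length ts) \<and> (\<forall>t \<in> set ts. treeC as t) \<or>
     as ! i = ColC (length ts) \<and> (\<forall>t \<in> set ts. treeB as t))"

fun tree_of_colour :: "colour \<Rightarrow> colour list \<Rightarrow> tree \<Rightarrow> bool" where
  "tree_of_colour (ColA n) as t \<longleftrightarrow> treeA as t \<and> leaves t = n"
| "tree_of_colour (ColB n) as t \<longleftrightarrow> treeB as t \<and> leaves t = n"
| "tree_of_colour (ColC n) as t \<longleftrightarrow> treeC as t \<and> leaves t = n"

fun relabel :: "(nat \<Rightarrow> nat) \<Rightarrow> tree \<Rightarrow> tree" where
  "relabel f Leaf = Leaf"
| "relabel f (Node i ts) = Node (f i) (map (relabel f) ts)"

text \<open>\<open>graft t us\<close> puts the trees \<open>us\<close> on the leaves of \<open>t\<close>, from left to right.\<close>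

fun graft :: "tree \<Rightarrow> tree list \<Rightarrow> tree" and graft_list :: "tree list \<Rightarrow> tree list \<Rightarrow> tree list" where
  "graft Leaf us = hd us"
| "graft (Node i ts) us = Node i (graft_list ts us)"
| "graft_list [] us = []"
| "graft_list (t # ts) us = graft t (take (leaves t) us) # graft_list ts (drop (leaves t) us)"

text \<open>\<open>subst s t\<close> replaces each vertex \<open>i\<close> of \<open>t\<close> by the tree \<open>s i\<close>.\<close>

fun subst :: "(nat \<Rightarrow> tree) \<Rightarrow> tree \<Rightarrow> tree" where
  "subst s Leaf = Leaf"
| "subst s (Node i ts) = graft (s i) (map (subst s) ts)"

type_synonym tree_op = "colour list \<times> colour \<times> tree"

fun corolla :: "colour \<Rightarrow> tree" where
  "corolla (ColA n) = Node 0 (replicate n Leaf)"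
| "corolla (ColB n) = Node 0 (replicate n Leaf)"
| "corolla (ColC n) = Node 0 (replicate n Leaf)"

definition triple_operad :: "(colour, tree_op) operad" where
  "triple_operad =
    \<lparr>Col = UNIV,
     Ops = {(as, a, t). tree_of_colour a as t \<and> distinct (labels t) \<and> set (labels t) = {..<length as}},
     In = (\<lambda>(as, a, t). as),
     Out = (\<lambda>(as, a, t). a),
     One = (\<lambda>a. ([a], a, corolla a)),
     Cmp = (\<lambda>(as, a, t) qs.
       (concat (map fst qs), a,
        subst (\<lambda>i. relabel (\<lambda>j. offset (map (length \<circ> fst) qs) i + j) (snd (snd (qs ! i)))) t)),
     Act = (\<lambda>(as, a, t) s. (permute_list s as, a, relabel (inv s) t))\<rparr>"

definition triple_substitude :: "(colour, tree_op, colour) substitude" where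
  "triple_substitude = discrete_substitude triple_operad"


section \<open>The operad and substitude axioms\<close>

lemma length_graft_list [simp]: "length (graft_list ts us) = length ts"
  by (induction ts arbitrary: us) auto

lemma leaves_graft:
  "length us = leaves t \<Longrightarrow> leaves (graft t us) = sum_list (map leaves us)"
  "length us = sum_list (map leaves ts) \<Longrightarrow> sum_list (map leaves (graft_list ts us)) = sum_list (map leaves us)"
proof (induction t us and ts us rule: graft_graft_list.induct)
  case (1 us) then show ?case by (cases us) auto
next
  case (4 t ts us)
  then show ?case 
    by (simp flip: sum_list_append map_append)
qed auto

lemma mset_labels_graft:
  "length us = leaves t \<Longrightarrow> mset (labels (graft t us)) = mset (labels t) + mset (concat (map labels us))"
  "length us = sum_list (map leaves ts) \<Longrightarrow> mset (concat (map labels (graft_list ts us))) =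
    mset (concat (map labels ts)) + mset (concat (map labels us))"
proof (induction t us and ts us rule: graft_graft_list.induct)
  case (1 us) then show ?case by (cases us) auto
next
  case (4 t ts us)
  have "mset (concat (map labels us)) = mset (concat (map labels (take (leaves t) us @ drop (leaves t) us)))"
    by simp
  then have "mset (concat (map labels us)) = mset (concat (map labels (take (leaves t) us)))
      + mset (concat (map labels (drop (leaves t) us)))"
    by (simp only: map_append concat_append mset_append)
  with 4 show ?case by simp
qed auto

lemma leaves_relabel [simp]: "leaves (relabel f t) = leaves t"
  by (induction t) (auto simp: comp_def intro!: arg_cong[where f = sum_list])

lemma labels_relabel [simp]: "labels (relabel f t) = map f (labels t)"
  by (induction t) (auto simp: comp_def map_concat intro!: arg_cong[where f = concat])

lemma relabel_relabel [simp]: "relabel f (relabel g t) = relabel (\<lambda>i. f (g i)) t"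
  by (induction t) auto

lemma relabel_cong: "(\<And>i. i \<in> set (labels t) \<Longrightarrow> f i = g i) \<Longrightarrow> relabel f t = relabel g t"
  by (induction t) fastforce+

lemma relabel_ident: "(\<And>i. i \<in> set (labels t) \<Longrightarrow> f i = i) \<Longrightarrow> relabel f t = t"
  by (induction t) (auto intro!: map_idI)

lemma relabel_graft:
  "length us = leaves t \<Longrightarrow> relabel f (graft t us) = graft (relabel f t) (map (relabel f) us)"
  "length us = sum_list (map leaves ts) \<Longrightarrow>
    map (relabel f) (graft_list ts us) = graft_list (map (relabel f) ts) (map (relabel f) us)"
proof (induction t us and ts us rule: graft_graft_list.induct)
  case (1 us) then show ?case by (cases us) auto
qed (auto simp: take_map drop_map)

lemma graft_Leaves:
  "length us = leaves t \<Longrightarrow> set us \<subseteq> {Leaf} \<Longrightarrow> graft t us = t"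
  "length us = sum_list (map leaves ts) \<Longrightarrow> set us \<subseteq> {Leaf} \<Longrightarrow> graft_list ts us = ts"
proof (induction t us and ts us rule: graft_graft_list.induct)
  case (1 us) then show ?case by (cases us) auto
next
  case (4 t ts us)
  have "set (take (leaves t) us) \<subseteq> {Leaf}" "set (drop (leaves t) us) \<subseteq> {Leaf}"
    using 4 set_take_subset[of _ us] set_drop_subset[of _ us] by blast+
  with 4 show ?case by simp
qed simp_all

lemma graft_list_append:
  "graft_list (ts @ ts') us = graft_list ts (take (sum_list (map leaves ts)) us) @
     graft_list ts' (drop (sum_list (map leaves ts)) us)"
  by (induction ts arbitrary: us) (auto simp: drop_take min_def add.commute)

lemma graft_list_replicate_Leaf: "length us = n \<Longrightarrow> graft_list (replicate n Leaf) us = us"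
proof (induction n arbitrary: us)
  case (Suc n) then show ?case by (cases us) auto
qed auto

lemma graft_graft:
  "length us = leaves t \<Longrightarrow> length vs = sum_list (map leaves us) \<Longrightarrow>
    graft (graft t us) vs = graft t (graft_list us vs)"
  "length us = sum_list (map leaves ts) \<Longrightarrow> length vs = sum_list (map leaves us) \<Longrightarrow>
    graft_list (graft_list ts us) vs = graft_list ts (graft_list us vs)"
proof (induction t us and ts us arbitrary: vs and vs rule: graft_graft_list.induct)
  case (1 us) then show ?case by (cases us) auto
next
  case (4 t ts us)
  let ?us1 = "take (leaves t) us" and ?us2 = "drop (leaves t) us"
  let ?k = "sum_list (map leaves ?us1)"
  have l: "length ?us1 = leaves t" using 4 by simp
  have us: "sum_list (map leaves us) = ?k + sum_list (map leaves ?us2)"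
    by (simp flip: sum_list_append map_append)
  have g: "graft_list us vs = graft_list ?us1 (take ?k vs) @ graft_list ?us2 (drop ?k vs)"
    using graft_list_append[of ?us1 ?us2 vs] by simp
  have l1: "length (graft_list ?us1 (take ?k vs)) = leaves t" using l by simp
  have "leaves (graft t ?us1) = ?k" using leaves_graft(1)[OF l] .
  then show ?case
    using 4 us g l by simp
qed auto

fun fits :: "(nat \<Rightarrow> nat) \<Rightarrow> tree \<Rightarrow> bool" where
  "fits w Leaf \<longleftrightarrow> True"
| "fits w (Node i ts) \<longleftrightarrow> w i = length ts \<and> (\<forall>t \<in> set ts. fits w t)"

lemma leaves_subst:
  "fits w t \<Longrightarrow> (\<And>i. i \<in> set (labels t) \<Longrightarrow> leaves (s i) = w i) \<Longrightarrow> leaves (subst s t) = leaves t"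
proof (induction t)
  case (Node i ts)
  have "leaves (subst s (Node i ts)) = sum_list (map leaves (map (subst s) ts))"
    using Node.prems by (simp add: leaves_graft)
  also have "map leaves (map (subst s) ts) = map leaves ts"
    using Node by (auto)
  finally show ?case by simp
qed simp

lemma mset_labels_subst:
  "fits w t \<Longrightarrow> (\<And>i. i \<in> set (labels t) \<Longrightarrow> leaves (s i) = w i) \<Longrightarrow>
    mset (labels (subst s t)) = mset (concat (map (\<lambda>i. labels (s i)) (labels t)))"
proof (induction t)
  case (Node i ts)
  have "mset (concat (map labels (map (subst s) us))) =
      mset (concat (map (\<lambda>i. labels (s i)) (concat (map labels us))))" if "set us \<subseteq> set ts" for us
    using that Node by (induction us) (auto)
  then show ?case
    using Node.prems by (simp add: mset_labels_graft)
qed simp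

lemma relabel_subst:
  "fits w t \<Longrightarrow> (\<And>i. i \<in> set (labels t) \<Longrightarrow> leaves (s i) = w i) \<Longrightarrow>
    relabel f (subst s t) = subst (\<lambda>i. relabel f (s i)) t"
proof (induction t)
  case (Node i ts)
  have "map (relabel f) (map (subst s) ts) = map (subst (\<lambda>i. relabel f (s i))) ts"
    using Node by auto
  then show ?case using Node.prems by (simp add: relabel_graft cong: map_cong)
qed simp

lemma subst_relabel: "subst s (relabel f t) = subst (\<lambda>i. s (f i)) t"
  by (induction t) (auto intro!: arg_cong[where f = "graft _"])

lemma subst_cong: "(\<And>i. i \<in> set (labels t) \<Longrightarrow> s i = s' i) \<Longrightarrow> subst s t = subst s' t"
proof (induction t)
  case (Node i ts)
  then have "map (subst s) ts = map (subst s') ts" by (auto)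
  then show ?case using Node.prems by (simp cong: map_cong)
qed simp

lemma subst_graft:
  "length us = leaves t \<Longrightarrow> fits w t \<Longrightarrow> (\<And>i. i \<in> set (labels t) \<Longrightarrow> leaves (s i) = w i) \<Longrightarrow>
    subst s (graft t us) = graft (subst s t) (map (subst s) us)"
  "length us = sum_list (map leaves ts) \<Longrightarrow> (\<And>t. t \<in> set ts \<Longrightarrow> fits w t) \<Longrightarrow>
    (\<And>t i. t \<in> set ts \<Longrightarrow> i \<in> set (labels t) \<Longrightarrow> leaves (s i) = w i) \<Longrightarrow>
    map (subst s) (graft_list ts us) = graft_list (map (subst s) ts) (map (subst s) us)"
proof (induction t us and ts us rule: graft_graft_list.induct)
  case (1 us) then show ?case by (cases us) auto
next
  case (2 i ts us)
  have "map leaves (map (subst s) ts) = map leaves ts"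
    using 2 by (auto intro!: leaves_subst)
  then have "length us = sum_list (map leaves (map (subst s) ts))" using 2 by (simp only: leaves.simps)
  moreover have "map (subst s) (graft_list ts us) = graft_list (map (subst s) ts) (map (subst s) us)"
    using 2 by auto
  ultimately show ?case
    using 2 by (simp add: graft_graft)
next
  case (3 us) then show ?case by simp
next
  case (4 t ts us)
  have "leaves (subst s t) = leaves t" using 4 by (auto intro!: leaves_subst)
  moreover have "subst s (graft t (take (leaves t) us)) = graft (subst s t) (map (subst s) (take (leaves t) us))"
    using "4.prems" by (intro "4.IH") auto
  moreover have "map (subst s) (graft_list ts (drop (leaves t) us)) =
      graft_list (map (subst s) ts) (map (subst s) (drop (leaves t) us))"
    using "4.prems" by (intro "4.IH") auto
  ultimately show ?case by (simp add: take_map drop_map)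
qed

lemma subst_subst:
  "fits w t \<Longrightarrow> (\<And>i. i \<in> set (labels t) \<Longrightarrow> leaves (s i) = w i \<and> fits v (s i)) \<Longrightarrow>
    (\<And>i j. i \<in> set (labels t) \<Longrightarrow> j \<in> set (labels (s i)) \<Longrightarrow> leaves (r j) = v j) \<Longrightarrow>
    subst r (subst s t) = subst (\<lambda>i. subst r (s i)) t"
proof (induction t)
  case (Node i ts)
  have "map (subst r) (map (subst s) ts) = map (subst (\<lambda>i. subst r (s i))) ts"
    using Node by fastforce
  moreover have "subst r (graft (s i) (map (subst s) ts)) =
      graft (subst r (s i)) (map (subst r) (map (subst s) ts))"
    using Node.prems by (intro subst_graft(1)[where w = v]) auto
  ultimately show ?case by (simp cong: map_cong)
qed simp

lemma subst_corollas: "fits w t \<Longrightarrow>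
   (\<And>i. i \<in> set (labels t) \<Longrightarrow> s i = Node i (replicate (w i) Leaf)) \<Longrightarrow> subst s t = t"
proof (induction t)
  case (Node i ts)
  have "map (subst s) ts = ts" using Node by (auto intro!: map_idI)
  then show ?case using Node.prems by (simp add: graft_list_replicate_Leaf)
qed simp


lemma offset_Suc: "i < length ks \<Longrightarrow> offset ks (Suc i) = offset ks i + ks ! i"
  by (simp add: offset_def take_Suc_conv_app_nth)

lemma offset_length [simp]: "offset ks (length ks) = sum_list ks"
  by (simp add: offset_def)

lemma offset_0 [simp]: "offset ks 0 = 0"
  by (simp add: offset_def)

lemma offset_Cons_Suc [simp]: "offset (k # ks) (Suc i) = k + offset ks i"
  by (simp add: offset_def)

lemma offset_concat: "concat xss ! (offset (map length xss) i + j) = xss ! i ! j"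
  "offset (map length xss) i + j < length (concat xss)"
  if "i < length xss" "j < length (xss ! i)"
proof -
  have "concat xss ! (offset (map length xss) i + j) = xss ! i ! j \<and>
    offset (map length xss) i + j < length (concat xss)"
    using that
  proof (induction xss arbitrary: i)
    case (Cons xs xss)
    then show ?case by (cases i) (auto simp: nth_append)
  qed simp
  then show "concat xss ! (offset (map length xss) i + j) = xss ! i ! j"
    "offset (map length xss) i + j < length (concat xss)" by auto
qed

lemma index_split:
  assumes "m < sum_list ks"
  obtains i j where "i < length ks" "j < ks ! i" "m = offset ks i + j"
proof -
  have "\<exists>i j. i < length ks \<and> j < ks ! i \<and> m = offset ks i + j"
    using assms
  proof (induction ks arbitrary: m)
    case (Cons k ks)
    show ?case
    proof (cases "m < k")
      case True then show ?thesis by (intro exI[of _ 0] exI[of _ m]) auto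
    next
      case False
      then have "m - k < sum_list ks" using Cons.prems by simp
      then obtain i j where "i < length ks" "j < ks ! i" "m - k = offset ks i + j"
        using Cons.IH[of "m - k"] by blast
      then show ?thesis using False by (intro exI[of _ "Suc i"] exI[of _ j]) auto
    qed
  qed simp
  then show ?thesis using that by blast
qed

lemma length_blocks [simp]: "length (blocks ks) = length ks"
  by (simp add: blocks_def)

lemma blocks_nth [simp]: "i < length ks \<Longrightarrow> blocks ks ! i = [offset ks i..<offset ks i + ks ! i]"
  by (simp add: blocks_def)

lemma map_length_blocks [simp]: "map length (blocks ks) = ks"
  by (rule nth_equalityI) auto

lemma length_concat_blocks [simp]: "length (concat (blocks ks)) = sum_list ks"
  by (simp add: length_concat)

lemma concat_blocks: "concat (blocks ks) = [0..<sum_list ks]"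
proof (rule nth_equalityI)
  fix m assume "m < length (concat (blocks ks))"
  then obtain i j where ij: "i < length ks" "j < ks ! i" "m = offset ks i + j"
    using index_split[of m ks] by auto
  then have "concat (blocks ks) ! m = m"
    using offset_concat(1)[of i "blocks ks" j] by simp
  with \<open>m < _\<close> show "concat (blocks ks) ! m = [0..<sum_list ks] ! m" by simp
qed simp

lemma perm_of_word_permutes:
  assumes "mset w = mset [0..<n]" shows "perm_of_word w permutes {..<n}"
proof -
  have l: "length w = n" using mset_eq_length[OF assms] by simp
  have d: "distinct w" and s: "set w = {..<n}"
    using mset_eq_imp_distinct_iff[OF assms] mset_eq_setD[OF assms] by (simp_all add: atLeast0LessThan)
  have "bij_betw (\<lambda>i. w ! i) {..<n} {..<n}"
    by (rule bij_betw_nth) (simp_all add: d s l)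
  then have "bij_betw (perm_of_word w) {..<n} {..<n}"
    by (subst bij_betw_cong[of _ _ "\<lambda>i. w ! i"]) (auto simp: perm_of_word_def l)
  then show ?thesis
    by (rule bij_imp_permutes) (auto simp: perm_of_word_def l)
qed

lemma mset_concat_cong: "list_all2 (\<lambda>xs ys. mset xs = mset ys) xss yss \<Longrightarrow>
    mset (concat xss) = mset (concat yss)"
  by (induction rule: list_all2_induct) auto

lemma mset_concat_map_perm: "mset xs = mset ys \<Longrightarrow> mset (concat (map f xs)) = mset (concat (map f ys))"
  by (simp add: mset_concat) (metis mset_map sum_mset_sum_list)

lemma block_perm_permutes:
  assumes "s permutes {..<length ks}" shows "block_perm s ks permutes {..<sum_list ks}"
proof -
  have "mset (concat (permute_list s (blocks ks))) = mset (concat (blocks ks))"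
    using assms mset_concat_map_perm[of "permute_list s (blocks ks)" "blocks ks" id] by simp
  then show ?thesis
    unfolding block_perm_def by (intro perm_of_word_permutes) (simp add: concat_blocks)
qed

lemma block_perm_nth:
  assumes "s permutes {..<length ks}" "i < length ks" "j < ks ! s i"
  shows "block_perm s ks (offset (permute_list s ks) i + j) = offset ks (s i) + j"
    and "offset (permute_list s ks) i + j < sum_list ks"
proof -
  let ?b = "permute_list s (blocks ks)"
  have si: "s i < length ks" using assms permutes_in_image[OF assms(1)] by simp
  have m: "map length ?b = permute_list s ks"
    using assms(1) by (simp add: permute_list_map[symmetric])
  have b: "?b ! i = blocks ks ! s i" using assms by (simp add: permute_list_nth)
  have "concat ?b ! (offset (permute_list s ks) i + j) = offset ks (s i) + j"
    and *: "offset (permute_list s ks) i + j < length (concat ?b)"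
    using offset_concat[of i ?b j] assms(2,3) si b m by auto
  then show "block_perm s ks (offset (permute_list s ks) i + j) = offset ks (s i) + j"
    by (simp add: block_perm_def perm_of_word_def)
  have "length (concat ?b) = sum_list ks"
    using assms(1) by (simp add: length_concat m) (metis mset_permute_list sum_mset_sum_list)
  with * show "offset (permute_list s ks) i + j < sum_list ks" by simp
qed

lemma sum_perm:
  assumes "list_all2 (\<lambda>s k. s permutes {..<k}) ss ks"
  shows sum_perm_permutes: "sum_perm ss ks permutes {..<sum_list ks}"
    and sum_perm_nth: "i < length ks \<Longrightarrow> j < ks ! i \<Longrightarrow>
      sum_perm ss ks (offset ks i + j) = offset ks i + (ss ! i) j"
proof -
  let ?b = "map2 permute_list ss (blocks ks)"
  have l: "length ss = length ks" using assms by (rule list_all2_lengthD)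
  have p: "ss ! i permutes {..<ks ! i}" if "i < length ks" for i
    using assms that by (auto simp: list_all2_conv_all_nth)
  have "mset (concat ?b) = mset (concat (blocks ks))"
    by (rule mset_concat_cong) (auto simp: list_all2_conv_all_nth l p)
  then show "sum_perm ss ks permutes {..<sum_list ks}"
    unfolding sum_perm_def by (intro perm_of_word_permutes) (simp add: concat_blocks)
  have m: "map length ?b = ks"
    by (rule nth_equalityI) (auto simp: l)
  assume i: "i < length ks" "j < ks ! i"
  have "(ss ! i) j < ks ! i" using permutes_in_image[OF p[OF i(1)]] i by simp
  then show "sum_perm ss ks (offset ks i + j) = offset ks i + (ss ! i) j"
    using offset_concat[of i ?b j] i m l p[OF i(1)]
    by (simp add: sum_perm_def perm_of_word_def permute_list_nth)
qed

fun width :: "colour \<Rightarrow> nat" where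
  "width (ColA n) = n" | "width (ColB n) = n" | "width (ColC n) = n"

lemma treeA_fits: "treeA as t \<Longrightarrow> fits (\<lambda>i. width (as ! i)) t"
  by (induction t) auto

lemma treeB_fits: "treeB as t \<Longrightarrow> fits (\<lambda>i. width (as ! i)) t"
  by (induction t) auto

lemma treeC_fits: "treeC as t \<Longrightarrow> fits (\<lambda>i. width (as ! i)) t"
  by (induction t) (auto simp: treeB_fits)

lemma tree_of_colour_fits: "tree_of_colour a as t \<Longrightarrow> fits (\<lambda>i. width (as ! i)) t"
  by (cases a) (auto simp: treeA_fits treeB_fits treeC_fits)

lemma tree_of_colour_leaves: "tree_of_colour a as t \<Longrightarrow> leaves t = width a"
  by (cases a) auto

lemma treeA_relabel: "treeA as t \<Longrightarrow>
  (\<And>i. i < length as \<Longrightarrow> f i < length bs \<and> bs ! f i = as ! i) \<Longrightarrow> treeA bs (relabel f t)"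
  by (induction t) auto

lemma treeB_relabel: "treeB as t \<Longrightarrow>
  (\<And>i. i < length as \<Longrightarrow> f i < length bs \<and> bs ! f i = as ! i) \<Longrightarrow> treeB bs (relabel f t)"
  by (induction t) auto

lemma treeC_relabel: "treeC as t \<Longrightarrow>
  (\<And>i. i < length as \<Longrightarrow> f i < length bs \<and> bs ! f i = as ! i) \<Longrightarrow> treeC bs (relabel f t)"
  by (induction t) (auto simp: treeB_relabel)

lemma tree_of_colour_relabel: "tree_of_colour a as t \<Longrightarrow>
  (\<And>i. i < length as \<Longrightarrow> f i < length bs \<and> bs ! f i = as ! i) \<Longrightarrow> tree_of_colour a bs (relabel f t)"
  by (cases a) (auto simp: treeA_relabel treeB_relabel treeC_relabel)

lemma treeA_graft:
  "length us = leaves t \<Longrightarrow> treeA as t \<Longrightarrow> \<forall>u \<in> set us. treeA as u \<Longrightarrow> treeA as (graft t us)"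
  "length us = sum_list (map leaves ts) \<Longrightarrow> \<forall>t \<in> set ts. treeA as t \<Longrightarrow> \<forall>u \<in> set us. treeA as u \<Longrightarrow>
     \<forall>t \<in> set (graft_list ts us). treeA as t"
proof (induction t us and ts us rule: graft_graft_list.induct)
  case (1 us) then show ?case by (cases us) simp_all
next
  case (2 i ts us) then show ?case by (simp)
next
  case (3 us) then show ?case by simp
next
  case (4 t ts us)
  have "\<forall>u\<in>set (take (leaves t) us). treeA as u"
    using "4.prems"(3) in_set_takeD by fast
  then have 1: "treeA as (graft t (take (leaves t) us))"
    using "4.prems"(1,2) by (intro "4.IH"(1)) simp_all
  have "\<forall>u\<in>set (drop (leaves t) us). treeA as u"
    using "4.prems"(3) in_set_dropD by fast
  then have "\<forall>t\<in>set (graft_list ts (drop (leaves t) us)). treeA as t"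
    using "4.prems"(1,2) by (intro "4.IH"(2)) simp_all
  with 1 show ?case unfolding graft_list.simps list.set by blast
qed

lemma treeB_graft:
  "length us = leaves t \<Longrightarrow> treeB as t \<Longrightarrow> \<forall>u \<in> set us. treeB as u \<Longrightarrow> treeB as (graft t us)"
  "length us = sum_list (map leaves ts) \<Longrightarrow> \<forall>t \<in> set ts. treeB as t \<Longrightarrow> \<forall>u \<in> set us. treeB as u \<Longrightarrow>
     \<forall>t \<in> set (graft_list ts us). treeB as t"
proof (induction t us and ts us rule: graft_graft_list.induct)
  case (1 us) then show ?case by (cases us) simp_all
next
  case (2 i ts us) then show ?case by (simp)
next
  case (3 us) then show ?case by simp
next
  case (4 t ts us)
  have "\<forall>u\<in>set (take (leaves t) us). treeB as u"
    using "4.prems"(3) in_set_takeD by fast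
  then have 1: "treeB as (graft t (take (leaves t) us))"
    using "4.prems"(1,2) by (intro "4.IH"(1)) simp_all
  have "\<forall>u\<in>set (drop (leaves t) us). treeB as u"
    using "4.prems"(3) in_set_dropD by fast
  then have "\<forall>t\<in>set (graft_list ts (drop (leaves t) us)). treeB as t"
    using "4.prems"(1,2) by (intro "4.IH"(2)) simp_all
  with 1 show ?case unfolding graft_list.simps list.set by blast
qed

lemma treeC_graft_A:
  "length us = leaves t \<Longrightarrow> treeA as t \<Longrightarrow> \<forall>u \<in> set us. treeC as u \<Longrightarrow> treeC as (graft t us)"
  "length us = sum_list (map leaves ts) \<Longrightarrow> \<forall>t \<in> set ts. treeA as t \<Longrightarrow> \<forall>u \<in> set us. treeC as u \<Longrightarrow>
     \<forall>t \<in> set (graft_list ts us). treeC as t"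
proof (induction t us and ts us rule: graft_graft_list.induct)
  case (1 us) then show ?case by (cases us) simp_all
next
  case (2 i ts us) then show ?case by (simp)
next
  case (3 us) then show ?case by simp
next
  case (4 t ts us)
  have "\<forall>u\<in>set (take (leaves t) us). treeC as u"
    using "4.prems"(3) in_set_takeD by fast
  then have 1: "treeC as (graft t (take (leaves t) us))"
    using "4.prems"(1,2) by (intro "4.IH"(1)) simp_all
  have "\<forall>u\<in>set (drop (leaves t) us). treeC as u"
    using "4.prems"(3) in_set_dropD by fast
  then have "\<forall>t\<in>set (graft_list ts (drop (leaves t) us)). treeC as t"
    using "4.prems"(1,2) by (intro "4.IH"(2)) simp_all
  with 1 show ?case unfolding graft_list.simps list.set by blast
qed

lemma treeC_graft_B:
  "length us = leaves t \<Longrightarrow> treeC as t \<Longrightarrow> \<forall>u \<in> set us. treeB as u \<Longrightarrow> treeC as (graft t us)"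
  "length us = sum_list (map leaves ts) \<Longrightarrow> \<forall>t \<in> set ts. treeC as t \<Longrightarrow> \<forall>u \<in> set us. treeB as u \<Longrightarrow>
     \<forall>t \<in> set (graft_list ts us). treeC as t"
proof (induction t us and ts us rule: graft_graft_list.induct)
  case (1 us) then show ?case by (cases us) simp_all
next
  case (2 i ts us) then show ?case using treeB_graft(2)[of us ts as] by auto
next
  case (3 us) then show ?case by simp
next
  case (4 t ts us)
  have "\<forall>u\<in>set (take (leaves t) us). treeB as u"
    using "4.prems"(3) in_set_takeD by fast
  then have 1: "treeC as (graft t (take (leaves t) us))"
    using "4.prems"(1,2) by (intro "4.IH"(1)) simp_all
  have "\<forall>u\<in>set (drop (leaves t) us). treeB as u"
    using "4.prems"(3) in_set_dropD by fast
  then have "\<forall>t\<in>set (graft_list ts (drop (leaves t) us)). treeC as t"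
    using "4.prems"(1,2) by (intro "4.IH"(2)) simp_all
  with 1 show ?case unfolding graft_list.simps list.set by blast
qed

lemma treeA_subst: "treeA as t \<Longrightarrow> (\<And>i. i < length as \<Longrightarrow> tree_of_colour (as ! i) bs (s i)) \<Longrightarrow>
    treeA bs (subst s t)"
proof (induction t)
  case (Node i ts)
  then have "tree_of_colour (ColA (length ts)) bs (s i)" by fastforce
  then show ?case using Node by (auto intro!: treeA_graft)
qed simp

lemma treeB_subst: "treeB as t \<Longrightarrow> (\<And>i. i < length as \<Longrightarrow> tree_of_colour (as ! i) bs (s i)) \<Longrightarrow>
    treeB bs (subst s t)"
proof (induction t)
  case (Node i ts)
  then have "tree_of_colour (ColB (length ts)) bs (s i)" by fastforce
  then show ?case using Node by (auto intro!: treeB_graft)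
qed simp

lemma treeC_subst: "treeC as t \<Longrightarrow> (\<And>i. i < length as \<Longrightarrow> tree_of_colour (as ! i) bs (s i)) \<Longrightarrow>
    treeC bs (subst s t)"
proof (induction t)
  case (Node i ts)
  then consider "tree_of_colour (ColA (length ts)) bs (s i)" "\<forall>t \<in> set ts. treeC as t"
    | "tree_of_colour (ColC (length ts)) bs (s i)" "\<forall>t \<in> set ts. treeB as t"
    by fastforce
  then show ?case
  proof cases
    case 1 then show ?thesis using Node by (auto intro!: treeC_graft_A)
  next
    case 2 then show ?thesis using Node.prems(2) by (auto intro!: treeC_graft_B treeB_subst)
  qed
qed simp

lemma tree_of_colour_subst:
  assumes "tree_of_colour a as t" "\<And>i. i < length as \<Longrightarrow> tree_of_colour (as ! i) bs (s i)"
    "set (labels t) \<subseteq> {..<length as}"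
  shows "tree_of_colour a bs (subst s t)"
proof -
  have "leaves (subst s t) = leaves t"
    using assms by (intro leaves_subst[OF tree_of_colour_fits]) (auto dest: tree_of_colour_leaves)
  with assms(1,2) show ?thesis
    by (cases a) (auto simp: treeA_subst treeB_subst treeC_subst)
qed

definition is_op :: "tree_op \<Rightarrow> bool" where
  "is_op p \<longleftrightarrow> (case p of (as, a, t) \<Rightarrow> tree_of_colour a as t \<and> mset (labels t) = mset [0..<length as])"

lemma mset_labels_iff:
  "mset xs = mset [0..<n] \<longleftrightarrow> distinct xs \<and> set xs = {..<n}"
proof
  assume "mset xs = mset [0..<n]"
  from mset_eq_imp_distinct_iff[OF this] mset_eq_setD[OF this]
  show "distinct xs \<and> set xs = {..<n}" by (simp add: atLeast0LessThan)
next
  assume "distinct xs \<and> set xs = {..<n}"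
  then show "mset xs = mset [0..<n]"
    using set_eq_iff_mset_eq_distinct[of xs "[0..<n]"] by (simp add: atLeast0LessThan del: mset_upt)
qed

lemma triple_simps:
  "Col triple_operad = UNIV"
  "(p \<in> Ops triple_operad) = is_op p"
  "In triple_operad p = fst p"
  "Out triple_operad p = fst (snd p)"
  "One triple_operad a = ([a], a, corolla a)"
  "Cmp triple_operad (as, a, t) qs = (concat (map fst qs), a,
     subst (\<lambda>i. relabel (\<lambda>j. offset (map (length \<circ> fst) qs) i + j) (snd (snd (qs ! i)))) t)"
  "Act triple_operad (as, a, t) s = (permute_list s as, a, relabel (inv s) t)"
  by (simp_all add: triple_operad_def is_op_def mset_labels_iff case_prod_beta del: mset_upt)


lemma is_op_labels:
  "is_op (as, a, t) \<Longrightarrow> set (labels t) = {..<length as}"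
  by (auto simp: is_op_def mset_labels_iff simp del: mset_upt)

lemma is_op_tree: "is_op (as, a, t) \<Longrightarrow> tree_of_colour a as t"
  by (simp add: is_op_def)

definition shifted :: "tree_op list \<Rightarrow> nat \<Rightarrow> tree" where
  "shifted qs i = relabel (\<lambda>j. offset (map (length \<circ> fst) qs) i + j) (snd (snd (qs ! i)))"

lemma composable_triple:
  "composable triple_operad (as, a, t) qs \<longleftrightarrow>
    is_op (as, a, t) \<and> (\<forall>q \<in> set qs. is_op q) \<and> as = map (fst \<circ> snd) qs"
  by (auto simp: composable_def triple_simps(2-4) comp_def cong: map_cong)

lemma Cmp_triple: "Cmp triple_operad (as, a, t) qs = (concat (map fst qs), a, subst (shifted qs) t)"
  by (simp add: triple_simps shifted_def[abs_def])

lemma shifted_typed: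
  assumes "\<forall>q \<in> set qs. is_op q" "i < length qs"
  shows "tree_of_colour (map (fst \<circ> snd) qs ! i) (concat (map fst qs)) (shifted qs i)"
    and "leaves (shifted qs i) = width (map (fst \<circ> snd) qs ! i)"
    and "mset (labels (shifted qs i)) = mset (blocks (map (length \<circ> fst) qs) ! i)"
proof -
  obtain bs b u where q: "qs ! i = (bs, b, u)" by (cases "qs ! i") auto
  then have op: "is_op (bs, b, u)" using assms by (metis nth_mem)
  have 1: "offset (map (length \<circ> fst) qs) i + j < length (concat (map fst qs)) \<and>
      concat (map fst qs) ! (offset (map (length \<circ> fst) qs) i + j) = bs ! j" if "j < length bs" for j
    using offset_concat[of i "map fst qs" j] assms(2) q that by (simp add: comp_def)
  show *: "tree_of_colour (map (fst \<circ> snd) qs ! i) (concat (map fst qs)) (shifted qs i)"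
    using assms(2) q 1 tree_of_colour_relabel[OF is_op_tree[OF op]] by (simp add: shifted_def)
  show "leaves (shifted qs i) = width (map (fst \<circ> snd) qs ! i)"
    using tree_of_colour_leaves[OF *] .
  have "mset (labels u) = mset [0..<length bs]" using op by (simp add: is_op_def)
  then have "mset (labels (shifted qs i)) = mset (map ((+) (offset (map (length \<circ> fst) qs) i)) [0..<length bs])"
    using q by (simp add: shifted_def)
  also have "map ((+) k) [0..<n] = [k..<k + n]" for k n
    by (rule nth_equalityI) auto
  finally show "mset (labels (shifted qs i)) = mset (blocks (map (length \<circ> fst) qs) ! i)"
    using assms(2) q by (simp add: comp_def)
qed

lemma is_op_Cmp:
  assumes "is_op (as, a, t)" "\<forall>q \<in> set qs. is_op q" "as = map (fst \<circ> snd) qs"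
  shows "is_op (concat (map fst qs), a, subst (shifted qs) t)"
proof -
  let ?ks = "map (length \<circ> fst) qs"
  have l: "length as = length qs" using assms(3) by simp
  have lab: "set (labels t) = {..<length qs}" using is_op_labels[OF assms(1)] l by simp
  have "mset (labels (subst (shifted qs) t)) = mset (concat (map (\<lambda>i. labels (shifted qs i)) (labels t)))"
    using lab assms(3) shifted_typed(2)[OF assms(2)]
    by (intro mset_labels_subst[OF tree_of_colour_fits[OF is_op_tree[OF assms(1)]]]) auto
  also have "\<dots> = mset (concat (map (\<lambda>i. labels (shifted qs i)) [0..<length qs]))"
    using assms(1) l by (intro mset_concat_map_perm) (simp add: is_op_def)
  also have "\<dots> = mset (concat (blocks ?ks))"
    using shifted_typed(3)[OF assms(2)] 
    by (intro mset_concat_cong) (simp add: list_all2_conv_all_nth del: blocks_nth)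
  also have "\<dots> = mset [0..<length (concat (map fst qs))]"
    by (simp add: concat_blocks length_concat comp_def)
  finally show ?thesis
    using tree_of_colour_subst[OF is_op_tree[OF assms(1)]] shifted_typed(1)[OF assms(2)] lab assms(3)
    unfolding is_op_def by simp
qed

lemma is_op_Act:
  assumes "is_op (as, a, t)" "s permutes {..<length as}"
  shows "is_op (permute_list s as, a, relabel (inv s) t)"
proof -
  have i: "inv s permutes {..<length as}" using assms(2) by (rule permutes_inv)
  have "tree_of_colour a (permute_list s as) (relabel (inv s) t)"
    using permutes_in_image[OF i] permutes_inverses(1)[OF assms(2)]
    by (intro tree_of_colour_relabel[OF is_op_tree[OF assms(1)]])
      (auto simp: permute_list_nth[OF assms(2)])
  moreover have "distinct (map (inv s) (labels t))"
    using assms by (auto simp: is_op_def mset_labels_iff distinct_map permutes_inj_on[OF i] simp del: mset_upt)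
  moreover have "set (map (inv s) (labels t)) = {..<length as}"
    using is_op_labels[OF assms(1)] permutes_image[OF i] by simp
  ultimately show ?thesis by (simp add: is_op_def mset_labels_iff del: mset_upt)
qed

lemma is_op_corolla: "is_op ([a], a, corolla a)"
  by (cases a) (auto simp: is_op_def sum_list_replicate)

lemma corolla_eq: "corolla a = Node 0 (replicate (width a) Leaf)"
  by (cases a) auto

theorem triple_operad: "symmetric_operad triple_operad"
proof
  fix p and qs :: "tree_op list" assume c: "composable triple_operad p qs"
  obtain as a t where p: "p = (as, a, t)" by (cases p)
  note c = c[unfolded p composable_triple]
  show "Cmp triple_operad p qs \<in> Ops triple_operad"
    using c unfolding p Cmp_triple triple_simps(2) by (intro is_op_Cmp) auto
  show "In triple_operad (Cmp triple_operad p qs) = concat (map (In triple_operad) qs)"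
    by (simp add: p Cmp_triple triple_simps(3) cong: map_cong)
  show "Out triple_operad (Cmp triple_operad p qs) = Out triple_operad p"
    by (simp add: p Cmp_triple triple_simps(4))
next
  fix p s assume "p \<in> Ops triple_operad" "s permutes {..<arity triple_operad p}"
  moreover obtain as a t where p: "p = (as, a, t)" by (cases p)
  ultimately have *: "is_op (as, a, t)" "s permutes {..<length as}"
    by (simp_all add: triple_simps(2,3) arity_def)
  show "Act triple_operad p s \<in> Ops triple_operad"
    using is_op_Act[OF *] by (simp add: triple_simps p)
  show "In triple_operad (Act triple_operad p s) = permute_list s (In triple_operad p)"
    "Out triple_operad (Act triple_operad p s) = Out triple_operad p"
    by (simp_all add: triple_simps p)
  fix u assume "u permutes {..<arity triple_operad p}"
  then have u: "u permutes {..<length as}" by (simp add: triple_simps p arity_def)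
  show "Act triple_operad (Act triple_operad p s) u = Act triple_operad p (s \<circ> u)"
    using u by (simp add: triple_simps(7) p permute_list_compose
      o_inv_distrib[OF permutes_bij[OF *(2)] permutes_bij[OF u]]) (simp add: comp_def)
next
  fix p assume "p \<in> Ops triple_operad"
  moreover obtain as a t where p: "p = (as, a, t)" by (cases p)
  ultimately have op: "is_op (as, a, t)" by (simp add: triple_simps)
  have f: "fits (\<lambda>i. width (as ! i)) t" by (rule tree_of_colour_fits[OF is_op_tree[OF op]])
  show "Cmp triple_operad (One triple_operad (Out triple_operad p)) [p] = p"
    using tree_of_colour_leaves[OF is_op_tree[OF op]] graft_Leaves(1)[of "replicate (width a) Leaf" t]
    by (simp add: p set_replicate_conv_if triple_simps(4,5) Cmp_triple shifted_def corolla_eq graft_Leaves relabel_ident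
        map_replicate_const)
  have "subst (shifted (map (One triple_operad) as)) t = t"
    using is_op_labels[OF op]
    by (intro subst_corollas[OF f]) (auto simp: shifted_def triple_simps(5) corolla_eq offset_def comp_def
         map_replicate_const sum_list_replicate take_map)
  then show "Cmp triple_operad p (map (One triple_operad) (In triple_operad p)) = p"
    by (simp add: p triple_simps(3) Cmp_triple) (simp add: triple_simps(5) comp_def)
  show "Act triple_operad p id = p"
    by (simp add: p triple_simps relabel_ident)
next
  fix p qs s
  assume c: "composable triple_operad p qs" and s: "s permutes {..<arity triple_operad p}"
  obtain as a t where p: "p = (as, a, t)" by (cases p)
  note c = c[unfolded p composable_triple]
  let ?ks = "map (length \<circ> fst) qs"
  let ?b = "block_perm s ?ks"
  have l: "length as = length qs" using c by simp
  have s: "s permutes {..<length qs}" using s l by (simp add: p triple_simps arity_def)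
  have b: "?b permutes {..<sum_list ?ks}" using s by (intro block_perm_permutes) simp
  have opq: "\<forall>q \<in> set qs. is_op q" using c by blast
  have ks: "map (length \<circ> fst) (permute_list s qs) = permute_list s ?ks"
    using s by (simp add: permute_list_map)
  have "shifted (permute_list s qs) (inv s i) = relabel (inv ?b) (shifted qs i)" if i: "i < length qs" for i
  proof -
    obtain bs b u where q: "qs ! i = (bs, b, u)" by (cases "qs ! i") auto
    then have op: "is_op (bs, b, u)" using i opq by (metis nth_mem)
    have k: "inv s i < length qs" "s (inv s i) = i"
      using permutes_in_image[OF permutes_inv[OF s]] i permutes_inverses(1)[OF s] by auto
    have "relabel (\<lambda>j. offset (permute_list s ?ks) (inv s i) + j) u =
        relabel (\<lambda>j. inv ?b (offset ?ks i + j)) u"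
    proof (rule relabel_cong)
      fix j assume "j \<in> set (labels u)"
      then have "j < length bs" using is_op_labels[OF op] by simp
      then have "?b (offset (permute_list s ?ks) (inv s i) + j) = offset ?ks i + j"
        using block_perm_nth(1)[of s ?ks "inv s i" j] s k i q by simp
      then show "offset (permute_list s ?ks) (inv s i) + j = inv ?b (offset ?ks i + j)"
        by (metis b permutes_inverses(2))
    qed
    then show ?thesis
      using k q s by (simp add: shifted_def ks permute_list_nth)
  qed
  then have "subst (shifted (permute_list s qs)) (relabel (inv s) t) = subst (\<lambda>i. relabel (inv ?b) (shifted qs i)) t"
    using is_op_labels[of as a t] c l unfolding subst_relabel by (intro subst_cong) auto
  also have "\<dots> = relabel (inv ?b) (subst (shifted qs) t)"
    using is_op_labels[of as a t] c l shifted_typed(2)[OF opq]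
    by (intro relabel_subst[symmetric, OF tree_of_colour_fits[OF is_op_tree]]) auto
  finally have 1: "subst (shifted (permute_list s qs)) (relabel (inv s) t) = relabel (inv ?b) (subst (shifted qs) t)" .
  have 2: "concat (map fst (permute_list s qs)) = permute_list ?b (concat (map fst qs))"
  proof (rule nth_equalityI)
    have "sum_list (permute_list s ?ks) = sum_list ?ks"
      using s by (metis length_map mset_permute_list sum_mset_sum_list)
    then show len: "length (concat (map fst (permute_list s qs))) = length (permute_list ?b (concat (map fst qs)))"
      using ks by (simp add: length_concat comp_def)
    fix m assume "m < length (concat (map fst (permute_list s qs)))"
    then have "m < sum_list (permute_list s ?ks)" and m': "m < length (concat (map fst qs))"
      using ks len by (simp_all add: length_concat comp_def)
    then obtain i j where ij: "i < length qs" "j < permute_list s ?ks ! i" "m = offset (permute_list s ?ks) i + j"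
      using index_split[of m "permute_list s ?ks"] by auto
    have si: "s i < length qs" using permutes_in_image[OF s] ij by simp
    have j: "j < length (fst (qs ! s i))" using ij si s by (simp add: permute_list_nth)
    have "concat (map fst (permute_list s qs)) ! m = fst (qs ! s i) ! j"
      using offset_concat(1)[of i "map fst (permute_list s qs)" j] ij j ks s
      by (simp add: permute_list_nth comp_def)
    moreover have "?b m = offset ?ks (s i) + j"
      using block_perm_nth(1)[of s ?ks i j] ij s si j by simp
    moreover have "concat (map fst qs) ! (offset ?ks (s i) + j) = fst (qs ! s i) ! j"
      using offset_concat(1)[of "s i" "map fst qs" j] si j by (simp add: comp_def)
    moreover have "?b permutes {..<length (concat (map fst qs))}"
      using b by (simp add: length_concat comp_def)
    ultimately show "concat (map fst (permute_list s qs)) ! m = permute_list ?b (concat (map fst qs)) ! m"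
      using m' by (simp add: permute_list_nth)
  qed
  have ar: "map (arity triple_operad) qs = ?ks"
    by (simp add: arity_def triple_simps(3))
  show "Cmp triple_operad (Act triple_operad p s) (permute_list s qs) =
      Act triple_operad (Cmp triple_operad p qs) (block_perm s (map (arity triple_operad) qs))"
    unfolding ar using 1 2 by (simp add: p triple_simps(7) Cmp_triple)
next
  fix p qs and ss :: "(nat \<Rightarrow> nat) list"
  assume c: "composable triple_operad p qs"
    and ss: "list_all2 (\<lambda>s q. s permutes {..<arity triple_operad q}) ss qs"
  obtain as a t where p: "p = (as, a, t)" by (cases p)
  note c = c[unfolded p composable_triple]
  let ?ks = "map (length \<circ> fst) qs"
  let ?b = "sum_perm ss ?ks"
  let ?rs = "map2 (Act triple_operad) qs ss"
  have l: "length as = length qs" "length ss = length qs" using c ss by (auto dest: list_all2_lengthD)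
  have opq: "\<forall>q \<in> set qs. is_op q" using c by blast
  have ss': "list_all2 (\<lambda>s k. s permutes {..<k}) ss ?ks"
    using ss by (simp add: list_all2_conv_all_nth arity_def triple_simps(3))
  have b: "?b permutes {..<sum_list ?ks}" using ss' by (rule sum_perm_permutes)
  have r: "?rs ! i = (permute_list (ss ! i) (fst (qs ! i)), fst (snd (qs ! i)), relabel (inv (ss ! i)) (snd (snd (qs ! i))))"
    if "i < length qs" for i
    using that l by (cases "qs ! i") (simp add: triple_simps(7))
  have ks: "map (length \<circ> fst) ?rs = ?ks"
  proof (rule nth_equalityI)
    fix i assume "i < length (map (length \<circ> fst) ?rs)"
    then have i: "i < length qs" and i': "i < length ?rs" using l by simp_all
    show "map (length \<circ> fst) ?rs ! i = ?ks ! i"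
      unfolding nth_map[OF i'] nth_map[OF i] o_apply r[OF i] by simp
  qed (simp add: l)
  have "shifted ?rs i = relabel (inv ?b) (shifted qs i)" if i: "i < length qs" for i
  proof -
    obtain bs b u where q: "qs ! i = (bs, b, u)" by (cases "qs ! i") auto
    then have op: "is_op (bs, b, u)" using i opq by (metis nth_mem)
    have si: "ss ! i permutes {..<length bs}"
      using ss' i q by (auto simp: list_all2_conv_all_nth)
    have "relabel (\<lambda>j. offset ?ks i + inv (ss ! i) j) u = relabel (\<lambda>j. inv ?b (offset ?ks i + j)) u"
    proof (rule relabel_cong)
      fix j assume "j \<in> set (labels u)"
      then have "inv (ss ! i) j < length bs"
        using is_op_labels[OF op] permutes_in_image[OF permutes_inv[OF si]] by simp
      then have "?b (offset ?ks i + inv (ss ! i) j) = offset ?ks i + j"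
        using sum_perm_nth[OF ss', of i "inv (ss ! i) j"] i q permutes_inverses(1)[OF si] by simp
      then show "offset ?ks i + inv (ss ! i) j = inv ?b (offset ?ks i + j)"
        by (metis b permutes_inverses(2))
    qed
    then show ?thesis
      using i q r[OF i] unfolding shifted_def ks by simp
  qed
  then have "subst (shifted ?rs) t = subst (\<lambda>i. relabel (inv ?b) (shifted qs i)) t"
    using is_op_labels[of as a t] c l by (intro subst_cong) auto
  also have "\<dots> = relabel (inv ?b) (subst (shifted qs) t)"
    using is_op_labels[of as a t] c l shifted_typed(2)[OF opq]
    by (intro relabel_subst[symmetric, OF tree_of_colour_fits[OF is_op_tree]]) auto
  finally have 1: "subst (shifted ?rs) t = relabel (inv ?b) (subst (shifted qs) t)" .
  have 2: "concat (map fst ?rs) = permute_list ?b (concat (map fst qs))"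
  proof (rule nth_equalityI)
    show len: "length (concat (map fst ?rs)) = length (permute_list ?b (concat (map fst qs)))"
      using arg_cong[OF ks, of sum_list] by (simp add: length_concat comp_def)
    fix m assume "m < length (concat (map fst ?rs))"
    then have m: "m < sum_list ?ks" and m': "m < length (concat (map fst qs))"
      using len by (simp_all add: length_concat comp_def)
    then obtain i j where ij: "i < length qs" "j < ?ks ! i" "m = offset ?ks i + j"
      using index_split[of m ?ks] by auto
    have si: "ss ! i permutes {..<?ks ! i}"
      using ss' ij by (auto simp: list_all2_conv_all_nth)
    have j: "j < length (fst (qs ! i))" "(ss ! i) j < length (fst (qs ! i))"
      using ij permutes_in_image[OF si] by simp_all
    have "concat (map fst ?rs) ! m = fst (?rs ! i) ! j"
      using offset_concat(1)[of i "map fst ?rs" j] ij j ks l r by (simp add: comp_def)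
    then have "concat (map fst ?rs) ! m = fst (qs ! i) ! (ss ! i) j"
      using r ij j si by (simp add: permute_list_nth)
    moreover have "?b m = offset ?ks i + (ss ! i) j"
      using sum_perm_nth[OF ss', of i j] ij by simp
    moreover have "concat (map fst qs) ! (offset ?ks i + (ss ! i) j) = fst (qs ! i) ! (ss ! i) j"
      using offset_concat(1)[of i "map fst qs" "(ss ! i) j"] ij j by (simp add: comp_def)
    moreover have "?b permutes {..<length (concat (map fst qs))}"
      using b by (simp add: length_concat comp_def)
    ultimately show "concat (map fst ?rs) ! m = permute_list ?b (concat (map fst qs)) ! m"
      using m' by (simp add: permute_list_nth)
  qed
  have ar: "map (arity triple_operad) qs = ?ks"
    by (simp add: arity_def triple_simps(3))
  show "Cmp triple_operad p ?rs = Act triple_operad (Cmp triple_operad p qs) (sum_perm ss (map (arity triple_operad) qs))"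
    unfolding ar using 1 2 by (simp add: p triple_simps(7) Cmp_triple)
next
  fix p qs rss
  assume c: "composable triple_operad p qs" and r: "list_all2 (composable triple_operad) qs rss"
  obtain as a t where p: "p = (as, a, t)" by (cases p)
  note c = c[unfolded p composable_triple]
  have l: "length as = length qs" "length rss = length qs" using c r by (auto dest: list_all2_lengthD)
  have opq: "\<forall>q \<in> set qs. is_op q" using c by blast
  let ?ks = "map (length \<circ> fst) qs"
  let ?ms = "map2 (Cmp triple_operad) qs rss"
  let ?RS = "concat rss"
  have ri: "(\<forall>q \<in> set (rss ! i). is_op q) \<and> fst (qs ! i) = map (fst \<circ> snd) (rss ! i)"
    if "i < length qs" for i
    using r that unfolding list_all2_conv_all_nth
    by (cases "qs ! i") (metis composable_triple fst_conv)
  have m: "?ms ! i = (concat (map fst (rss ! i)), fst (snd (qs ! i)), subst (shifted (rss ! i)) (snd (snd (qs ! i))))"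
    if "i < length qs" for i
    using that l by (cases "qs ! i") (simp add: Cmp_triple)
  have fm: "map fst ?ms = map (\<lambda>rs. concat (map fst rs)) rss"
  proof (rule nth_equalityI)
    fix i assume "i < length (map fst ?ms)"
    then have i: "i < length qs" and i': "i < length ?ms" "i < length rss" using l by simp_all
    show "map fst ?ms ! i = map (\<lambda>rs. concat (map fst rs)) rss ! i"
      unfolding nth_map[OF i'(1)] nth_map[OF i'(2)] m[OF i] by simp
  qed (simp add: l)
  have opR: "\<forall>q \<in> set ?RS. is_op q"
    using ri l by (auto simp: in_set_conv_nth[of _ rss])
  have lr: "map length rss = ?ks"
    using ri l by (intro nth_equalityI) simp_all
  have off: "offset (map (length \<circ> fst) ?RS) (offset ?ks i + j) =
      offset (map (length \<circ> fst) ?ms) i + offset (map (length \<circ> fst) (rss ! i)) j"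
    if "i < length qs" "j \<le> length (rss ! i)" for i j
  proof -
    have tk: "take (offset (map length xss) i + j) (concat xss) = concat (take i xss) @ take j (xss ! i)"
      if "i < length xss" "j \<le> length (xss ! i)" for i j and xss :: "tree_op list list"
      using that
    proof (induction xss arbitrary: i)
      case (Cons xs xss) then show ?case by (cases i) auto
    qed simp
    have "map (length \<circ> fst) ?ms = map (length \<circ> concat) (map (map fst) rss)"
      using arg_cong[OF fm, of "map length"] by (simp only: map_map comp_assoc comp_def)
    then have "map (length \<circ> fst) (take i ?ms) = map (\<lambda>rs. sum_list (map (length \<circ> fst) rs)) (take i rss)"
      unfolding take_map[symmetric] by (simp add: take_map length_concat comp_def)
    moreover have sum_list_concat: "sum_list (concat xss) = sum_list (map sum_list xss)" for xss :: "nat list list"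
      by (induction xss) auto
    moreover have "offset (map (length \<circ> fst) ?RS) (offset ?ks i + j) =
        sum_list (map (length \<circ> fst) (concat (take i rss) @ take j (rss ! i)))"
      using tk[of i rss j] that l by (simp only: offset_def[of "map _ ?RS"] take_map lr)
    ultimately show ?thesis
      by (simp add: offset_def take_map map_concat comp_def)
  qed
  have sh: "subst (shifted ?RS) (shifted qs i) = shifted ?ms i" if i: "i < length qs" for i
  proof -
    obtain bs b u where q: "qs ! i = (bs, b, u)" by (cases "qs ! i") auto
    then have op: "is_op (bs, b, u)" using i opq by (metis nth_mem)
    have lb: "length bs = length (rss ! i)" using ri[OF i] q by simp
    have "subst (shifted ?RS) (shifted qs i) = subst (\<lambda>j. shifted ?RS (offset ?ks i + j)) u"
      by (simp add: shifted_def[of qs] subst_relabel q)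
    also have "\<dots> = subst (\<lambda>j. relabel ((+) (offset (map (length \<circ> fst) ?ms) i)) (shifted (rss ! i) j)) u"
    proof (rule subst_cong)
      fix j assume "j \<in> set (labels u)"
      then have j: "j < length (rss ! i)" using is_op_labels[OF op] lb by simp
      then show "shifted ?RS (offset ?ks i + j) =
          relabel ((+) (offset (map (length \<circ> fst) ?ms) i)) (shifted (rss ! i) j)"
        using off[OF i, of j] offset_concat(1)[of i rss j] i l lr
        by (simp add: shifted_def add.assoc)
    qed
    also have "\<dots> = relabel ((+) (offset (map (length \<circ> fst) ?ms) i)) (subst (shifted (rss ! i)) u)"
      using is_op_labels[OF op] lb ri[OF i] q
      by (intro relabel_subst[symmetric, OF tree_of_colour_fits[OF is_op_tree[OF op]]])
        (simp add: shifted_typed(2))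
    also have "\<dots> = shifted ?ms i"
      using m[OF i] q by (simp add: shifted_def[of ?ms])
    finally show ?thesis .
  qed
  have "subst (shifted ?RS) (subst (shifted qs) t) = subst (\<lambda>i. subst (shifted ?RS) (shifted qs i)) t"
  proof (rule subst_subst)
    show "fits (\<lambda>i. width (as ! i)) t" using c by (blast intro: tree_of_colour_fits is_op_tree)
    fix i assume "i \<in> set (labels t)"
    then have i: "i < length qs" using is_op_labels[of as a t] c l by auto
    show "leaves (shifted qs i) = width (as ! i) \<and>
        fits (\<lambda>j. width (concat (map fst qs) ! j)) (shifted qs i)"
      using shifted_typed(1,2)[OF opq i] c by (auto dest: tree_of_colour_fits)
    fix j assume "j \<in> set (labels (shifted qs i))"
    then have "j \<in> set (blocks ?ks ! i)" using mset_eq_setD[OF shifted_typed(3)[OF opq i]] by simp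
    then obtain k where k: "j = offset ?ks i + k" "k < length (fst (qs ! i))"
      using i by (auto simp: le_iff_add)
    have "length (fst (qs ! i)) = length (rss ! i)" using ri[OF i] by simp
    then have "j < length ?RS" "?RS ! j = rss ! i ! k"
        "concat (map fst qs) ! j = fst (qs ! i) ! k"
      using offset_concat[of i rss k] offset_concat(1)[of i "map fst qs" k] k i l lr by (simp_all add: comp_def)
    then show "leaves (shifted ?RS j) = width (concat (map fst qs) ! j)"
      using shifted_typed(2)[OF opR, of j] ri[OF i] k by simp
  qed
  also have "\<dots> = subst (shifted ?ms) t"
    using sh is_op_labels[of as a t] c l by (intro subst_cong) auto
  finally have 1: "subst (shifted ?RS) (subst (shifted qs) t) = subst (shifted ?ms) t" .
  have 2: "concat (map fst ?ms) = concat (map fst ?RS)"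
    unfolding fm by (induction rss) auto
  show "Cmp triple_operad p ?ms = Cmp triple_operad (Cmp triple_operad p qs) ?RS"
    using 1 2 by (simp add: p Cmp_triple)
qed (auto simp: triple_simps(1-6) is_op_corolla)

lemma category_discrete: "category (discrete_cat S)"
  by standard (auto simp: discrete_cat_def)

theorem substitude_discrete:
  assumes "symmetric_operad P" shows "substitude (discrete_substitude P)"
proof -
  interpret symmetric_operad P by fact
  have "One P a = Cmp P (One P a) [One P a]" if "a \<in> Col P" for a
    using Cmp_One_left[OF One_closed[OF that]] by (simp add: Out_One that)
  then show ?thesis
    using assms category_discrete[of "Col P"]
    by (intro substitude.intro)
      (simp_all add: discrete_substitude_def discrete_cat_def One_closed In_One Out_One)
qed

theorem triple_substitude: "substitude triple_substitude"
  unfolding triple_substitude_def by (rule substitude_discrete[OF triple_operad])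

end

theory Submission
  imports Defs "HOL-Library.Countable"
begin

text \<open>
  The operad has free symmetric group actions, so the classifier is explicit: its objects are the
  trees of the operad with every vertex marked \<open>X\<close> or \<open>K\<close>, and an arrow \<open>t \<rightarrow> t'\<close> exhibits \<open>t\<close> as
  obtained from \<open>t'\<close> by replacing each \<open>X\<close>-vertex by a tree of \<open>X\<close>-vertices.

  In colours \<open>A\<close> and \<open>B\<close> each component has a terminal object: contract all clusters of adjacent
  \<open>X\<close>-vertices, inserting unary ones where a cluster is empty. In colour \<open>C\<close> this fails, since
  neighbouring \<open>C\<close>-vertices marked \<open>X\<close> can be merged only if the \<open>A\<close>-vertex above them has no other
  inputs. Instead every object \<open>t\<close> is joined by \<open>t \<rightarrow> bar t \<leftarrow> u \<rightarrow> N\<close> to a normal form: \<open>bar t\<close> absorbs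
  the \<open>B\<close>-vertices marked \<open>X\<close> into the \<open>C\<close>-vertices above them, \<open>u\<close> has \<open>XA(n)(XC(1), \<dots>, XC(1))\<close> in place of
  each \<open>XC(n)\<close>, and \<open>N\<close> contracts the clusters of \<open>A\<close>-vertices. All three steps are natural and \<open>N\<close> is
  constant along arrows, so parallel zigzags become equal in the fundamental groupoid.
\<close>

section \<open>Labelled trees\<close>

text \<open>Contracting clusters of \<open>A\<close>-vertices is natural only for arrows that are
  identities from the first vertex of another colour on, whereas an arrow of colour \<open>C\<close>
  may also merge \<open>C\<close>-vertices. Such an arrow is therefore lifted through the zigzags of
  its ends, and only the lift between the spread trees has to keep away from the
  \<open>C\<close>-vertices. It does so because absorption leaves of an all-\<open>X\<close> tree of
  colour \<open>C\<close> only \<open>A\<close>-vertices above \<open>C\<close>-vertices with bare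
  inputs, and spreading then turns the whole of it into one \<open>A\<close>-cluster above copies of
  \<open>XC(1)\<close>, of which contraction remembers only the number of inputs. This includes n =
  0, where \<open>XC(0)\<close> comes from \<open>XA(0)\<close> by the left action on no arguments.
  Vertices marked \<open>K\<close> carry only identities and bound the pieces on which all this
  happens.

  For the universal property, preorder numbering of the vertices selects one operation from each
  orbit of the symmetric groups; by freeness any other presentation of the same labelled tree
  differs from it by a permutation, which equivariance absorbs.\<close>

instance colour :: countable by countable_datatype
instance tree :: countable by countable_datatype

text \<open>
  Objects and arrows of the classifier are trees with labels in \<open>gen\<close>, coded as natural numbers by
  \<open>to_nat\<close> so that the type \<open>tree\<close> can be reused. \<open>GX c\<close> and \<open>GK c\<close> stand for the generating objects
  \<open>X(c)\<close> and \<open>K(c)\<close>, \<open>GM c p\<close> for the generating arrow \<open>p(X, \<dots>, X) \<rightarrow> X(c)\<close>, where \<open>p\<close> is given by a tree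
  with labels \<open>GX _\<close>; in arrows \<open>GK c\<close> is the identity of \<open>K(c)\<close>.
\<close>

datatype gen = GX colour | GK colour | GM colour tree
instance gen :: countable by countable_datatype

text \<open>Relabelling keeps the shape whatever the maps are, so \<open>h\<close> and
  \<open>h'\<close> may be arbitrary, for instance constant; shape and preorder list of labels
  determine a tree.\<close>

lemma tree_eqI:
  "relabel h t = relabel h' u \<Longrightarrow> labels t = labels u \<Longrightarrow> t = u"
proof (induction t arbitrary: u)
  case (Node i ts)
  then obtain j us where u: "u = Node j us" by (cases u) auto
  have "ts = us"
    if "map (relabel h) ts = map (relabel h') us" "concat (map labels ts) = concat (map labels us)"
      "\<And>t u. t \<in> set ts \<Longrightarrow> relabel h t = relabel h' u \<Longrightarrow> labels t = labels u \<Longrightarrow> t = u" for us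
    using that
  proof (induction ts arbitrary: us)
    case (Cons t ts)
    then obtain u us' where us: "us = u # us'" by (cases us) auto
    \<comment> \<open>Equal shapes give equal numbers of vertices, so the two concatenated label
      lists are cut at the same place.\<close>
    have "length (labels t) = length (labels u)"
      using Cons.prems(1) us labels_relabel[of h t] labels_relabel[of h' u] by (metis length_map list.map(2) list.inject)
    then have "labels t = labels u" "concat (map labels ts) = concat (map labels us')"
      using Cons.prems(2) us by auto
    then show ?case using Cons us by auto
  qed auto
  then show ?case using Node u by auto
next
  case Leaf then show ?case by (cases u) auto
qed

text \<open>The pair of \<open>num 0 t\<close> and \<open>labels t\<close> is a normal form of the
  labelled tree \<open>t\<close>: a tree whose labels are its preorder positions, and the labels to
  be put there. It picks one operation from each orbit under the symmetric groups.\<close>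

fun num :: "nat \<Rightarrow> tree \<Rightarrow> tree" and nums :: "nat \<Rightarrow> tree list \<Rightarrow> tree list" where
  "num k Leaf = Leaf"
| "num k (Node i ts) = Node k (nums (Suc k) ts)"
| "nums k [] = []"
| "nums k (t # ts) = num k t # nums (k + length (labels t)) ts"

lemma labels_num [simp]:
  "labels (num k t) = [k..<k + length (labels t)]"
  "concat (map labels (nums k ts)) = [k..<k + length (concat (map labels ts))]"
proof (induction k t and k ts rule: num_nums.induct)
  case (2 k i ts)
  then show ?case
    using upt_conv_Cons[of k "k + Suc (length (concat (map labels ts)))"] by (simp del: upt_Suc)
next
  case (4 k t ts)
  have "[k..<k + (a + b)] = [k..<k + a] @ [k + a..<k + a + b]" for a b :: nat
    using upt_add_eq_append[of k "k + a" b] by (simp add: add.assoc)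
  with 4 show ?case by simp
qed auto

lemma relabel_num_shape: "relabel (\<lambda>_. 0) (num k t) = relabel (\<lambda>_. 0) t"
  "map (relabel (\<lambda>_. 0)) (nums k ts) = map (relabel (\<lambda>_. 0)) ts"
  by (induction k t and k ts rule: num_nums.induct) auto

lemma relabel_num [simp]: "relabel ((!) (labels t)) (num 0 t) = t"
  by (rule tree_eqI[of "\<lambda>_. 0" _ "\<lambda>_. 0"]) (simp_all add: relabel_num_shape map_nth)

lemma relabel_num_map: "xs = map f (labels t) \<Longrightarrow> relabel ((!) xs) (num 0 t) = relabel f t"
proof -
  assume xs: "xs = map f (labels t)"
  have "relabel ((!) xs) (num 0 t) = relabel (\<lambda>i. f (labels t ! i)) (num 0 t)"
    using xs by (intro relabel_cong) auto
  also have "\<dots> = relabel f t" by (metis relabel_num relabel_relabel)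
  finally show ?thesis .
qed

text \<open>The typing of \<open>treeA\<close>, \<open>treeB\<close> and \<open>treeC\<close> again,
  but with the colour of a vertex read off its label by a function: labels of the classifier are
  codes, may repeat, and do not index a list of inputs.\<close>

fun mono_typed :: "(nat \<Rightarrow> colour) \<Rightarrow> (nat \<Rightarrow> colour) \<Rightarrow> tree \<Rightarrow> bool" where
  "mono_typed mk k Leaf \<longleftrightarrow> True"
| "mono_typed mk k (Node i ts) \<longleftrightarrow> k i = mk (length ts) \<and> (\<forall>t \<in> set ts. mono_typed mk k t)"

fun bimod_typed :: "(nat \<Rightarrow> colour) \<Rightarrow> tree \<Rightarrow> bool" where
  "bimod_typed k Leaf \<longleftrightarrow> False"
| "bimod_typed k (Node i ts) \<longleftrightarrow> k i = ColA (length ts) \<and> (\<forall>t \<in> set ts. bimod_typed k t) \<or>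
     k i = ColC (length ts) \<and> (\<forall>t \<in> set ts. mono_typed ColB k t)"

fun typed :: "(nat \<Rightarrow> colour) \<Rightarrow> colour \<Rightarrow> tree \<Rightarrow> bool" where
  "typed k (ColA n) t \<longleftrightarrow> mono_typed ColA k t \<and> leaves t = n"
| "typed k (ColB n) t \<longleftrightarrow> mono_typed ColB k t \<and> leaves t = n"
| "typed k (ColC n) t \<longleftrightarrow> bimod_typed k t \<and> leaves t = n"

lemma mono_typed_relabel [simp]: "mono_typed mk k (relabel f t) = mono_typed mk (\<lambda>i. k (f i)) t"
  by (induction t) auto

lemma bimod_typed_relabel [simp]: "bimod_typed k (relabel f t) = bimod_typed (\<lambda>i. k (f i)) t"
  by (induction t) auto

lemma typed_relabel [simp]: "typed k a (relabel f t) = typed (\<lambda>i. k (f i)) a t"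
  by (cases a) auto

lemma mono_typed_cong: "(\<And>i. i \<in> set (labels t) \<Longrightarrow> k i = k' i) \<Longrightarrow> mono_typed mk k t = mono_typed mk k' t"
  by (induction t) auto

lemma bimod_typed_cong: "(\<And>i. i \<in> set (labels t) \<Longrightarrow> k i = k' i) \<Longrightarrow> bimod_typed k t = bimod_typed k' t"
proof (induction t)
  case (Node i ts)
  then have "\<And>t. t \<in> set ts \<Longrightarrow> mono_typed ColB k t = mono_typed ColB k' t"
    by (intro mono_typed_cong) auto
  with Node show ?case by auto
qed auto

lemma typed_cong: "(\<And>i. i \<in> set (labels t) \<Longrightarrow> k i = k' i) \<Longrightarrow> typed k a t = typed k' a t"
  using mono_typed_cong[of t k k'] bimod_typed_cong[of t k k'] by (cases a) auto

lemma mono_typed_list: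
  assumes "\<And>i. i \<in> set (labels t) \<Longrightarrow> i < length as \<and> as ! i = k i"
  shows "treeA as t = mono_typed ColA k t" "treeB as t = mono_typed ColB k t"
  using assms by (induction t) auto

lemma bimod_typed_list:
  "(\<And>i. i \<in> set (labels t) \<Longrightarrow> i < length as \<and> as ! i = k i) \<Longrightarrow> treeC as t = bimod_typed k t"
proof (induction t)
  case (Node i ts)
  then have "\<And>t. t \<in> set ts \<Longrightarrow> treeB as t = mono_typed ColB k t"
    by (intro mono_typed_list(2)) auto
  with Node show ?case by auto
qed auto

lemma typed_list:
  "(\<And>i. i \<in> set (labels t) \<Longrightarrow> i < length as \<and> as ! i = k i) \<Longrightarrow> tree_of_colour a as t = typed k a t"
  using mono_typed_list[of t as k] bimod_typed_list[of t as k] by (cases a) auto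

lemma is_op_typed: "is_op (as, a, t) \<Longrightarrow> typed ((!) as) a t"
  using typed_list[of t as "(!) as" a] by (auto dest: is_op_labels is_op_tree)

lemma typed_leaves: "typed k a t \<Longrightarrow> leaves t = width a"
  by (cases a) auto

text \<open>Transfers facts about \<open>tree_of_colour\<close>, whose colours form a finite list,
  to \<open>typed\<close>: the colour function is cut off beyond all labels that occur.\<close>

lemma finite_labels_bound:
  obtains N where "\<And>t i. t \<in> set ts \<Longrightarrow> i \<in> set (labels t) \<Longrightarrow> i < (N::nat)"
proof -
  have "finite (\<Union>t \<in> set ts. set (labels t))" by simp
  then obtain N where "\<forall>i \<in> (\<Union>t \<in> set ts. set (labels t)). i < N"
    using finite_nat_set_iff_bounded by blast
  then show ?thesis using that by blast
qed

lemma typed_fits: "typed k a t \<Longrightarrow> fits (\<lambda>i. width (k i)) t"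
proof -
  assume t: "typed k a t"
  obtain N where N: "\<And>t' i. t' \<in> set [t] \<Longrightarrow> i \<in> set (labels t') \<Longrightarrow> i < (N::nat)"
    using finite_labels_bound[of "[t]"] by blast
  have "tree_of_colour a (map k [0..<N]) t" using t N by (subst typed_list[of t _ k]) auto
  from tree_of_colour_fits[OF this] have "fits (\<lambda>i. width (map k [0..<N] ! i)) t" .
  have "fits w t' = fits w' t'" if "\<And>i. i \<in> set (labels t') \<Longrightarrow> w i = w' i" for w w' t'
    using that by (induction t') auto
  from this[of t "\<lambda>i. width (map k [0..<N] ! i)" "\<lambda>i. width (k i)"] N
  show ?thesis using \<open>fits (\<lambda>i. width (map k [0..<N] ! i)) t\<close> by simp
qed

definition std :: "(nat \<Rightarrow> colour) \<Rightarrow> colour \<Rightarrow> tree \<Rightarrow> tree_op" where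
  "std k a t = (map k (labels t), a, num 0 t)"

lemma is_op_std: "typed k a t \<Longrightarrow> is_op (std k a t)"
proof -
  assume t: "typed k a t"
  have "typed k a (relabel ((!) (labels t)) (num 0 t))" using t by simp
  then have "typed (\<lambda>i. k (labels t ! i)) a (num 0 t)" by (simp only: typed_relabel)
  then show ?thesis
    by (subst (asm) typed_list[symmetric, where as = "map k (labels t)"]) (auto simp: std_def is_op_def)
qed

lemma typed_subst:
  assumes "typed k a t" "\<And>i. i \<in> set (labels t) \<Longrightarrow> typed k' (k i) (s i)"
  shows "typed k' a (subst s t)"
proof -
  let ?G = "labels t" and ?u = "num 0 t"
  \<comment> \<open>\<open>tree_of_colour_subst\<close> wants labels that index a list of colours;
    the preorder numbering supplies them.\<close>
  have t: "subst s t = subst (\<lambda>i. s (?G ! i)) ?u"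
    by (subst (1) relabel_num[symmetric]) (simp only: subst_relabel)
  obtain N where N: "\<And>t' i. t' \<in> set (subst s t # map s ?G) \<Longrightarrow> i \<in> set (labels t') \<Longrightarrow> i < (N::nat)"
    using finite_labels_bound[of "subst s t # map s ?G"] by blast
  let ?bs = "map k' [0..<N]"
  have *: "i < length ?bs \<and> ?bs ! i = k' i" if "t' \<in> set (subst s t # map s ?G)" "i \<in> set (labels t')" for t' i
    using N[OF that] by simp
  have "tree_of_colour a ?bs (subst (\<lambda>i. s (?G ! i)) ?u)"
  proof (rule tree_of_colour_subst)
    show "tree_of_colour a (map k ?G) ?u" using is_op_std[OF assms(1)] by (simp add: std_def is_op_def)
    fix i assume "i < length (map k ?G)"
    then have i: "?G ! i \<in> set ?G" by simp
    then show "tree_of_colour (map k ?G ! i) ?bs (s (?G ! i))"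
      using typed_list[of "s (?G ! i)" ?bs k' "k (?G ! i)"] *[of "s (?G ! i)"] assms(2)[OF i] \<open>i < _\<close>
      by simp
  qed (auto)
  then have "tree_of_colour a ?bs (subst s t)" using t by simp
  then show ?thesis using typed_list[of "subst s t" ?bs k' a] *[of "subst s t"] by simp
qed

text \<open>Freeness of the symmetric group actions enters here.\<close>

lemma op_unique:
  assumes u: "is_op (as, a, u)" and v: "is_op (bs, a, v)"
    and G: "length G = length as" and H: "length H = length bs"
    and eq: "relabel ((!) G) u = relabel ((!) H) v" and k: "as = map k G" "bs = map k H"
  obtains s where "s permutes {..<length as}" "(bs, a, v) = Act triple_operad (as, a, u) s"
    "H = permute_list s G"
proof -
  have lab: "map ((!) G) (labels u) = map ((!) H) (labels v)"
    using arg_cong[OF eq, of labels] by simp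
  have mu: "mset (labels u) = mset [0..<length as]" and mv: "mset (labels v) = mset [0..<length bs]"
    using u v by (auto simp: is_op_def)
  have "length (labels u) = length as" "length (labels v) = length bs"
    using mset_eq_length[OF mu] mset_eq_length[OF mv] by simp_all
  moreover from this have "length as = length bs" using map_eq_imp_length_eq[OF lab] by simp
  ultimately have l: "length as = length bs" "length (labels u) = length as" "length (labels v) = length bs"
    by simp_all
  have du: "distinct (labels u)" "set (labels u) = {..<length as}"
    using iffD1[OF mset_labels_iff mu] by blast+
  have dv: "distinct (labels v)" "set (labels v) = {..<length as}"
    using iffD1[OF mset_labels_iff mv] l by auto
  \<comment> \<open>Both trees have the same shape. Position by position in preorder,
    \<open>s\<close> sends the label of \<open>v\<close> to the label of \<open>u\<close>; each
    operation uses every label once, so this is a permutation.\<close>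
  define s where "s i = (if i < length as then the (map_of (zip (labels v) (labels u)) i) else i)" for i
  have sj: "s (labels v ! j) = labels u ! j" if "j < length as" for j
    using that dv l nth_mem[of j "labels v"] by (simp add: s_def map_of_zip_nth)
  then have ms: "map s (labels v) = labels u" using l by (intro nth_equalityI) auto
  have im: "s ` {..<length as} = {..<length as}"
    using arg_cong[OF ms, of set] by (simp add: du(2) dv(2))
  have "inj_on s {..<length as}" by (rule eq_card_imp_inj_on) (simp_all add: im)
  with im have s: "s permutes {..<length as}"
    by (intro bij_imp_permutes) (simp_all add: bij_betw_def s_def)
  have "relabel s v = u"
    by (rule tree_eqI[of "\<lambda>_. 0" _ "\<lambda>_. 0"]) (use arg_cong[OF eq, of "relabel (\<lambda>_. 0)"] ms in simp_all)
  then have "relabel (inv s) u = relabel (\<lambda>i. inv s (s i)) v"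
    using relabel_relabel[of "inv s" s v] by simp
  then have v': "v = relabel (inv s) u" using permutes_inverses(2)[OF s] by (simp add: relabel_ident)
  have HG: "H = permute_list s G"
  proof (rule nth_equalityI)
    fix i assume "i < length H"
    then have "i \<in> set (labels v)" using dv l H by simp
    then obtain j where j: "j < length as" "labels v ! j = i" using l by (metis in_set_conv_nth)
    then have "H ! i = G ! (labels u ! j)" using arg_cong[OF lab, of "\<lambda>xs. xs ! j"] l by simp
    then show "H ! i = permute_list s G ! i"
      using sj[OF j(1)] j s G \<open>i < length H\<close> H l by (simp add: permute_list_nth)
  qed (use G H l in simp)
  have "s permutes {..<length G}" unfolding G by (rule s)
  then have "permute_list s (map k G) = map k (permute_list s G)" by (rule permute_list_map)
  then have "bs = permute_list s as" unfolding k HG ..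
  then show ?thesis using that[OF s _ HG] v' unfolding triple_simps(7) by blast
qed

section \<open>Evaluation of trees in algebras\<close>

fun gen_colour :: "gen \<Rightarrow> colour" where
  "gen_colour (GX c) = c" | "gen_colour (GK c) = c" | "gen_colour (GM c p) = c"

definition kind :: "nat \<Rightarrow> colour" where "kind l = gen_colour (from_nat l)"

definition cor :: "nat \<Rightarrow> tree" where "cor l = Node l (replicate (width (kind l)) Leaf)"

lemma leaves_cor [simp]: "leaves (cor l) = width (kind l)"
  by (simp add: cor_def sum_list_replicate)

lemma labels_cor [simp]: "labels (cor l) = [l]"
  by (simp add: cor_def)

lemma relabel_cor: "kind (f l) = kind l \<Longrightarrow> relabel f (cor l) = cor (f l)"
  by (simp add: cor_def)

lemma typed_cor: "typed kind (kind l) (cor l)"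
  by (cases "kind l") (simp_all add: cor_def sum_list_replicate)

lemma graft_cor: "length us = width (kind l) \<Longrightarrow> graft (cor l) us = Node l us"
  by (simp add: cor_def graft_list_replicate_Leaf)

lemma subst_cor: "leaves (s l) = width (kind l) \<Longrightarrow> subst s (cor l) = s l"
  by (simp add: cor_def graft_Leaves(1) set_replicate_conv_if)

lemma subst_cors: "typed kind a t \<Longrightarrow> subst cor t = t"
  by (rule subst_corollas[OF typed_fits]) (auto simp: cor_def)

abbreviation stdk :: "colour \<Rightarrow> tree \<Rightarrow> tree_op" where "stdk \<equiv> std kind"

lemma nums_replicate_Leaf: "nums k (replicate n Leaf) = replicate n Leaf"
  by (induction n) auto

lemma std_cor: "stdk (kind l) (cor l) = One triple_operad (kind l)"
  by (simp add: std_def cor_def nums_replicate_Leaf triple_simps(5) corolla_eq map_replicate_const)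

text \<open>With this action the trees labelled in \<open>L\<close> are the free algebra on the
  generators \<open>L\<close>, graded by \<open>kind\<close>.\<close>

definition tree_act :: "tree_op \<Rightarrow> tree list \<Rightarrow> tree" where
  "tree_act p ts = subst ((!) ts) (snd (snd p))"

definition tree_set :: "nat set \<Rightarrow> colour \<Rightarrow> tree set" where
  "tree_set L a = {t. typed kind a t \<and> set (labels t) \<subseteq> L}"

text \<open>\<open>op_unique\<close>, applied to a given numbering and the preorder numbering of one
  labelled tree.\<close>

lemma std_Act:
  assumes p: "is_op (map kind G, a, u)"
  obtains s where "s permutes {..<length G}"
    "stdk a (relabel ((!) G) u) = Act triple_operad (map kind G, a, u) s"
    "labels (relabel ((!) G) u) = permute_list s G"
proof -
  let ?t = "relabel ((!) G) u"
  have "typed ((!) (map kind G)) a u" by (rule is_op_typed[OF p])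
  then have "typed (\<lambda>i. kind (G ! i)) a u"
    using is_op_labels[OF p] by (subst typed_cong[where k' = "(!) (map kind G)"]) auto
  then have "is_op (stdk a ?t)" by (intro is_op_std) simp
  then show ?thesis
    using op_unique[OF p, of "map kind (labels ?t)" "num 0 ?t" G "labels ?t" kind] that
    unfolding std_def by (auto simp del: labels_relabel)
qed

text \<open>Links composition in the operad to substitution of labelled trees. The composite lists
  its inputs in the order of \<open>concat (map labels ds)\<close>, which need not be the preorder
  of the result; hence some numbering \<open>v\<close> appears here and not
  \<open>num 0\<close>.\<close>

lemma Cmp_std:
  assumes p: "is_op (as, a, u)" and ds: "list_all2 (typed kind) as ds"
  obtains v where "composable triple_operad (as, a, u) (map2 stdk as ds)"
    "Cmp triple_operad (as, a, u) (map2 stdk as ds) = (map kind (concat (map labels ds)), a, v)"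
    "is_op (map kind (concat (map labels ds)), a, v)"
    "relabel ((!) (concat (map labels ds))) v = subst ((!) ds) u"
proof -
  let ?qs = "map2 stdk as ds" and ?G = "concat (map labels ds)"
  have l: "length as = length ds" using ds by (rule list_all2_lengthD)
  have q: "\<forall>q \<in> set ?qs. is_op q"
    using ds by (auto simp: list_all2_conv_all_nth in_set_zip is_op_std)
  have out: "map (fst \<circ> snd) ?qs = as" and "map fst ?qs = map (map kind \<circ> labels) ds"
    using l by (auto intro!: nth_equalityI simp: std_def)
  then have fst: "concat (map fst ?qs) = map kind ?G" by (simp add: map_concat comp_def)
  have ks: "map (length \<circ> fst) ?qs = map length (map labels ds)"
    using l by (auto intro!: nth_equalityI simp: std_def)
  have c: "composable triple_operad (as, a, u) ?qs" unfolding composable_triple using p q out by metis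
  have C: "Cmp triple_operad (as, a, u) ?qs = (map kind ?G, a, subst (shifted ?qs) u)"
    unfolding Cmp_triple fst ..
  have opC: "is_op (map kind ?G, a, subst (shifted ?qs) u)"
    using is_op_Cmp[OF p q out[symmetric]] unfolding fst .
  have lab: "set (labels u) = {..<length ds}" using is_op_labels[OF p] l by simp
  have sh: "relabel ((!) ?G) (shifted ?qs i) = ds ! i" if i: "i < length ds" for i
  proof -
    have "shifted ?qs i = relabel (\<lambda>j. offset (map length (map labels ds)) i + j) (num 0 (ds ! i))"
      unfolding shifted_def ks using i l by (simp add: std_def)
    then have "relabel ((!) ?G) (shifted ?qs i) =
        relabel (\<lambda>j. ?G ! (offset (map length (map labels ds)) i + j)) (num 0 (ds ! i))"
      by (simp only: relabel_relabel)
    also have "\<dots> = relabel ((!) (labels (ds ! i))) (num 0 (ds ! i))"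
      using i offset_concat(1)[of i "map labels ds"] by (intro relabel_cong) simp
    finally show ?thesis by simp
  qed
  have "relabel ((!) ?G) (subst (shifted ?qs) u) = subst (\<lambda>i. relabel ((!) ?G) (shifted ?qs i)) u"
    using lab shifted_typed(2)[OF q] l out
    by (intro relabel_subst[OF tree_of_colour_fits[OF is_op_tree[OF p]]]) (auto simp: std_def)
  also have "\<dots> = subst ((!) ds) u" using lab sh by (intro subst_cong) auto
  finally show ?thesis by (rule that[OF c C opC])
qed

lemma num_relabel [simp]: "num k (relabel f t) = num k t" "nums k (map (relabel f) ts) = nums k ts"
  by (induction k t and k ts rule: num_nums.induct) auto

lemma std_relabel:
  "(\<And>l. l \<in> set (labels t) \<Longrightarrow> kind (f l) = kind l) \<Longrightarrow> stdk a (relabel f t) = stdk a t"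
  by (simp add: std_def)

text \<open>Only the equations of an algebra in sets, so that one theory of evaluation serves the
  objects of a categorical algebra, its arrows, and the labelled trees themselves.\<close>

locale triple_algebra =
  fixes S :: "colour \<Rightarrow> 'x set" and act :: "tree_op \<Rightarrow> 'x list \<Rightarrow> 'x"
  assumes act_One: "x \<in> S a \<Longrightarrow> act (One triple_operad a) [x] = x"
    and act_Cmp: "composable triple_operad p qs \<Longrightarrow>
      list_all2 (\<lambda>q xs. list_all2 (\<lambda>a x. x \<in> S a) (fst q) xs) qs xss \<Longrightarrow>
      act (Cmp triple_operad p qs) (concat xss) = act p (map2 act qs xss)"
    and act_Act: "is_op p \<Longrightarrow> s permutes {..<length (fst p)} \<Longrightarrow> list_all2 (\<lambda>a x. x \<in> S a) (fst p) xs \<Longrightarrow>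
      act (Act triple_operad p s) (permute_list s xs) = act p xs"

context triple_algebra
begin

text \<open>The homomorphism out of the free algebra of trees that extends the assignment
  \<open>\<Phi>\<close> of values to generators.\<close>

definition ev :: "(nat \<Rightarrow> 'x) \<Rightarrow> colour \<Rightarrow> tree \<Rightarrow> 'x" where
  "ev \<Phi> a t = act (stdk a t) (map \<Phi> (labels t))"

lemma ev_cong: "(\<And>l. l \<in> set (labels t) \<Longrightarrow> \<Phi> l = \<Psi> l) \<Longrightarrow> ev \<Phi> a t = ev \<Psi> a t"
  unfolding ev_def by (metis (mono_tags, lifting) map_cong)

text \<open>By equivariance the value does not depend on the numbering of the vertices, so any
  operation presenting the labelled tree may replace the preorder one.\<close>

lemma ev_op:
  assumes p: "is_op (map kind G, a, u)" and \<Phi>: "\<And>l. l \<in> set G \<Longrightarrow> \<Phi> l \<in> S (kind l)"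
  shows "ev \<Phi> a (relabel ((!) G) u) = act (map kind G, a, u) (map \<Phi> G)"
proof -
  from std_Act[OF p] obtain s where s: "s permutes {..<length G}"
      "stdk a (relabel ((!) G) u) = Act triple_operad (map kind G, a, u) s"
      "labels (relabel ((!) G) u) = permute_list s G" .
  have "map \<Phi> (labels (relabel ((!) G) u)) = permute_list s (map \<Phi> G)"
    unfolding s(3) using s(1) by (simp add: permute_list_map)
  then show ?thesis
    unfolding ev_def s(2) using act_Act[OF p, of s "map \<Phi> G"] s(1) \<Phi>
    by (simp add: list_all2_conv_all_nth)
qed

lemma ev_relabel:
  assumes "\<And>l. l \<in> set (labels t) \<Longrightarrow> kind (f l) = kind l"
  shows "ev \<Phi> a (relabel f t) = ev (\<lambda>l. \<Phi> (f l)) a t"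
  using std_relabel[of t f a] assms by (simp add: ev_def comp_def)

lemma ev_subst:
  assumes p: "is_op (as, a, u)" and ds: "list_all2 (typed kind) as ds"
    and \<Phi>: "\<And>d l. d \<in> set ds \<Longrightarrow> l \<in> set (labels d) \<Longrightarrow> \<Phi> l \<in> S (kind l)"
  shows "ev \<Phi> a (subst ((!) ds) u) = act (as, a, u) (map2 (ev \<Phi>) as ds)"
proof -
  let ?qs = "map2 stdk as ds" and ?G = "concat (map labels ds)"
  have l: "length as = length ds" using ds by (rule list_all2_lengthD)
  from Cmp_std[OF p ds] obtain v where v: "composable triple_operad (as, a, u) ?qs"
    "Cmp triple_operad (as, a, u) ?qs = (map kind ?G, a, v)" "is_op (map kind ?G, a, v)"
    "relabel ((!) ?G) v = subst ((!) ds) u" .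
  have "ev \<Phi> a (subst ((!) ds) u) = act (Cmp triple_operad (as, a, u) ?qs) (concat (map (map \<Phi>) (map labels ds)))"
    using ev_op[OF v(3), of \<Phi>] \<Phi> unfolding v(2) v(4) by (auto simp: map_concat)
  also have "\<dots> = act (as, a, u) (map2 act ?qs (map (map \<Phi>) (map labels ds)))"
    using \<Phi>[OF nth_mem nth_mem] l by (intro act_Cmp[OF v(1)]) (auto simp: list_all2_conv_all_nth std_def)
  also have "map2 act ?qs (map (map \<Phi>) (map labels ds)) = map2 (ev \<Phi>) as ds"
    using l by (auto intro!: nth_equalityI simp: ev_def)
  finally show ?thesis .
qed

lemma ev_tact:
  assumes "is_op (as, a, u)" "list_all2 (\<lambda>a t. t \<in> tree_set L a) as ts" "\<And>l. l \<in> L \<Longrightarrow> \<Phi> l \<in> S (kind l)"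
  shows "ev \<Phi> a (tree_act (as, a, u) ts) = act (as, a, u) (map2 (ev \<Phi>) as ts)"
  unfolding tree_act_def snd_conv
proof (rule ev_subst[OF assms(1)])
  show "list_all2 (typed kind) as ts"
    by (rule list_all2_mono[OF assms(2)]) (simp add: tree_set_def)
  fix d l assume d: "d \<in> set ts" and l: "l \<in> set (labels d)"
  obtain i where i: "i < length ts" "d = ts ! i" using d by (auto simp: in_set_conv_nth)
  then have "d \<in> tree_set L (as ! i)" using list_all2_nthD2[OF assms(2), of i] by simp
  then show "\<Phi> l \<in> S (kind l)" using l assms(3) by (auto simp: tree_set_def)
qed

text \<open>A tree of trees may be evaluated in two stages. Presenting \<open>t\<close> by its
  preorder numbering makes this a case of \<open>ev_subst\<close>.\<close>

lemma ev_subst_tree: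
  assumes t: "typed kind a t" and s: "\<And>l. l \<in> set (labels t) \<Longrightarrow> typed kind (kind l) (s l)"
    and \<Phi>: "\<And>l m. l \<in> set (labels t) \<Longrightarrow> m \<in> set (labels (s l)) \<Longrightarrow> \<Phi> m \<in> S (kind m)"
  shows "ev \<Phi> a (subst s t) = ev (\<lambda>l. ev \<Phi> (kind l) (s l)) a t"
proof -
  have "subst s t = subst s (relabel ((!) (labels t)) (num 0 t))" by simp
  also have "\<dots> = subst (\<lambda>i. s (labels t ! i)) (num 0 t)" by (rule subst_relabel)
  also have "\<dots> = subst ((!) (map s (labels t))) (num 0 t)" by (rule subst_cong) simp
  finally have "ev \<Phi> a (subst s t) = act (stdk a t) (map2 (ev \<Phi>) (map kind (labels t)) (map s (labels t)))"
    using s \<Phi> is_op_std[OF t] unfolding std_def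
    by (subst ev_subst[symmetric]) (auto simp: list_all2_conv_all_nth)
  also have "map2 (ev \<Phi>) (map kind (labels t)) (map s (labels t)) = map (\<lambda>l. ev \<Phi> (kind l) (s l)) (labels t)"
    by (rule nth_equalityI) auto
  finally show ?thesis unfolding ev_def .
qed

lemma ev_cor: "\<Phi> l \<in> S (kind l) \<Longrightarrow> ev \<Phi> (kind l) (cor l) = \<Phi> l"
  unfolding ev_def std_cor by (simp add: act_One)

end

lemma tact_closed:
  assumes "is_op (as, a, u)" "list_all2 (\<lambda>a t. t \<in> tree_set L a) as ts"
  shows "tree_act (as, a, u) ts \<in> tree_set L a"
proof -
  have l: "length ts = length as" using assms(2) by (simp add: list_all2_lengthD)
  have lab: "set (labels u) = {..<length as}" using is_op_labels[OF assms(1)] .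
  have ts: "typed kind (as ! i) (ts ! i)" "set (labels (ts ! i)) \<subseteq> L" if "i < length as" for i
    using assms(2) that by (auto simp: list_all2_conv_all_nth tree_set_def)
  have "typed kind a (subst ((!) ts) u)"
    using ts lab by (intro typed_subst[OF is_op_typed[OF assms(1)]]) auto
  moreover have "set (labels (subst ((!) ts) u)) = (\<Union>i \<in> set (labels u). set (labels (ts ! i)))"
    using mset_eq_setD[OF mset_labels_subst[OF typed_fits[OF is_op_typed[OF assms(1)]], of "(!) ts"]]
      typed_leaves[OF ts(1)] lab by simp
  ultimately show ?thesis using ts(2) lab by (auto simp: tree_act_def tree_set_def)
qed

text \<open>Composition and the symmetric action in the operad are themselves substitution and
  relabelling of trees, so the laws come from \<open>subst_subst\<close> and
  \<open>subst_relabel\<close>.\<close>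

interpretation tree_algebra: triple_algebra "tree_set L" tree_act for L
proof
  fix x a assume "x \<in> tree_set L a"
  then show "tree_act (One triple_operad a) [x] = x"
    by (auto simp: tree_act_def triple_simps(5) corolla_eq tree_set_def graft_Leaves(1)
        set_replicate_conv_if dest: typed_leaves)
next
  fix p qs and xss :: "tree list list"
  assume c: "composable triple_operad p qs"
    and x: "list_all2 (\<lambda>q xs. list_all2 (\<lambda>a x. x \<in> tree_set L a) (fst q) xs) qs xss"
  obtain as a t where p: "p = (as, a, t)" by (cases p)
  note c = c[unfolded p composable_triple]
  have q: "\<forall>q\<in>set qs. is_op q" using c by blast
  have l: "length qs = length xss" using x by (rule list_all2_lengthD)
  have lab: "set (labels t) = {..<length qs}" using is_op_labels[of as a t] c by auto
  have xi: "length (xss ! i) = length (fst (qs ! i))"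
    "\<And>j. j < length (fst (qs ! i)) \<Longrightarrow> leaves (xss ! i ! j) = width (fst (qs ! i) ! j)" if "i < length qs" for i
    using x that by (auto simp: list_all2_conv_all_nth tree_set_def intro!: typed_leaves[where k = kind])
  have ks: "map (length \<circ> fst) qs = map length xss"
    using xi l by (intro nth_equalityI) auto
  have nth: "concat xss ! (offset (map length xss) i + j) = xss ! i ! j"
      "concat (map fst qs) ! (offset (map length xss) i + j) = fst (qs ! i) ! j"
    if "i < length qs" "j < length (fst (qs ! i))" for i j
    using offset_concat(1)[of i xss j] offset_concat(1)[of i "map fst qs" j] that l xi(1) ks by simp_all
  have "subst ((!) (concat xss)) (subst (shifted qs) t) = subst (\<lambda>i. subst ((!) (concat xss)) (shifted qs i)) t"
  proof (rule subst_subst)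
    show "fits (\<lambda>i. width (as ! i)) t" using c by (blast intro: tree_of_colour_fits is_op_tree)
    fix i assume "i \<in> set (labels t)"
    then have i: "i < length qs" using lab by simp
    show "leaves (shifted qs i) = width (as ! i) \<and> fits (\<lambda>j. width (concat (map fst qs) ! j)) (shifted qs i)"
      using shifted_typed(1,2)[OF q i] c by (auto dest: tree_of_colour_fits)
    fix j assume "j \<in> set (labels (shifted qs i))"
    then have "j \<in> set (blocks (map length xss) ! i)"
      using mset_eq_setD[OF shifted_typed(3)[OF q i]] ks by simp
    then obtain k where k: "j = offset (map length xss) i + k" "k < length (xss ! i)"
      using i l by (auto simp: le_iff_add)
    then show "leaves (concat xss ! j) = width (concat (map fst qs) ! j)"
      using nth[OF i, of k] xi[OF i] by simp
  qed
  also have "\<dots> = subst ((!) (map2 tree_act qs xss)) t"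
  proof (rule subst_cong)
    fix i assume "i \<in> set (labels t)"
    then have i: "i < length qs" using lab by simp
    have "is_op (fst (qs ! i), fst (snd (qs ! i)), snd (snd (qs ! i)))" using q i by simp
    from is_op_labels[OF this] show "subst ((!) (concat xss)) (shifted qs i) = map2 tree_act qs xss ! i"
      using i l nth[OF i] unfolding shifted_def ks subst_relabel by (auto simp: tree_act_def intro!: subst_cong)
  qed
  finally show "tree_act (Cmp triple_operad p qs) (concat xss) = tree_act p (map2 tree_act qs xss)"
    by (simp add: p Cmp_triple tree_act_def)
next
  fix p s and xs :: "tree list"
  assume p: "is_op p" and s: "s permutes {..<length (fst p)}"
    and x: "list_all2 (\<lambda>a x. x \<in> tree_set L a) (fst p) xs"
  obtain as a t where pt: "p = (as, a, t)" by (cases p)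
  have l: "length xs = length as" using x pt by (simp add: list_all2_lengthD)
  have i: "inv s permutes {..<length xs}" using s l pt by (simp add: permutes_inv)
  have "subst (\<lambda>i. permute_list s xs ! inv s i) t = subst ((!) xs) t"
    using is_op_labels[of as a t] p s l pt permutes_in_image[OF i] permutes_inverses(1)[OF s]
    by (intro subst_cong) (auto simp: permute_list_nth)
  then show "tree_act (Act triple_operad p s) (permute_list s xs) = tree_act p xs"
    by (simp add: pt tree_act_def triple_simps(7) subst_relabel)
qed

section \<open>The category of trees\<close>

definition Xl :: "colour \<Rightarrow> nat" where "Xl c = to_nat (GX c)"
definition Kl :: "colour \<Rightarrow> nat" where "Kl c = to_nat (GK c)"
definition Ml :: "colour \<Rightarrow> tree \<Rightarrow> nat" where "Ml c p = to_nat (GM c p)"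

text \<open>On generating arrows: \<open>dg\<close> is the source, a tree; \<open>cg\<close> is the
  label of the target, always a single vertex; \<open>ig\<close> is the label of the identity of a
  generating object; \<open>cl l p\<close> gives \<open>l\<close> the new source \<open>p\<close>.
  The default branches serve \<open>K(c)\<close>, whose label also denotes its identity.\<close>

definition dg :: "nat \<Rightarrow> tree" where
  "dg l = (case from_nat l of GM c p \<Rightarrow> p | _ \<Rightarrow> cor l)"
definition cg :: "nat \<Rightarrow> nat" where
  "cg l = (case from_nat l of GM c p \<Rightarrow> Xl c | _ \<Rightarrow> l)"
definition ig :: "nat \<Rightarrow> nat" where
  "ig l = (case from_nat l of GX c \<Rightarrow> Ml c (cor l) | _ \<Rightarrow> l)"
definition cl :: "nat \<Rightarrow> tree \<Rightarrow> nat" where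
  "cl l p = (case from_nat l of GM c _ \<Rightarrow> Ml c p | _ \<Rightarrow> l)"

lemma label_simps [simp]:
  "kind (Xl c) = c" "kind (Kl c) = c" "kind (Ml c p) = c"
  "dg (Xl c) = cor (Xl c)" "dg (Kl c) = cor (Kl c)" "dg (Ml c p) = p"
  "cg (Xl c) = Xl c" "cg (Kl c) = Kl c" "cg (Ml c p) = Xl c"
  "ig (Xl c) = Ml c (cor (Xl c))" "ig (Kl c) = Kl c"
  "cl (Kl c) q = Kl c" "cl (Ml c p) q = Ml c q"
  "Xl c = Xl d \<longleftrightarrow> c = d" "Kl c = Kl d \<longleftrightarrow> c = d" "Ml c p = Ml d q \<longleftrightarrow> c = d \<and> p = q"
  "Xl c \<noteq> Kl d" "Kl d \<noteq> Xl c" "Ml d p \<noteq> Xl c" "Xl c \<noteq> Ml d p" "Ml d p \<noteq> Kl c" "Kl c \<noteq> Ml d p"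
  by (simp_all add: Xl_def Kl_def Ml_def dg_def cg_def ig_def cl_def kind_def)

text \<open>\<open>LX\<close>, \<open>LO\<close> and \<open>LM\<close> are the labels of
  all-\<open>X\<close> trees, of objects and of arrows. The identity of \<open>X(c)\<close> is the
  generator \<open>Ml c (cor (Xl c))\<close> given by the operad unit.\<close>

definition LX :: "nat set" where "LX = range Xl"
definition LO :: "nat set" where "LO = range Xl \<union> range Kl"
definition LM :: "nat set" where "LM = range Kl \<union> {Ml c p | c p. p \<in> tree_set LX c}"

lemma LO_cases [consumes 1, case_names X K]: "l \<in> LO \<Longrightarrow> (\<And>c. l = Xl c \<Longrightarrow> P) \<Longrightarrow> (\<And>c. l = Kl c \<Longrightarrow> P) \<Longrightarrow> P"
  by (auto simp: LO_def)

lemma LM_cases [consumes 1, case_names K M]: "l \<in> LM \<Longrightarrow> (\<And>c. l = Kl c \<Longrightarrow> P) \<Longrightarrow>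
   (\<And>c p. l = Ml c p \<Longrightarrow> p \<in> tree_set LX c \<Longrightarrow> P) \<Longrightarrow> P"
  by (auto simp: LM_def)

lemma LX_LO: "LX \<subseteq> LO" by (auto simp: LX_def LO_def)

lemma tree_set_mono: "L \<subseteq> L' \<Longrightarrow> tree_set L a \<subseteq> tree_set L' a"
  by (auto simp: tree_set_def)

lemma cor_tree_set: "l \<in> L \<Longrightarrow> cor l \<in> tree_set L (kind l)"
  by (simp add: tree_set_def typed_cor)

lemma LM_facts:
  assumes "l \<in> LM"
  shows "dg l \<in> tree_set LO (kind l)" "kind (cg l) = kind l" "cg l \<in> LO" "kind (cl l p) = kind l"
    "cg (cl l p) = cg l" "leaves (dg l) = width (kind l)" "cl (cl l p) q = cl l q" "cl l (dg l) = l"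
proof -
  have "cor (Kl c) \<in> tree_set LO c" for c
    using cor_tree_set[of "Kl c" LO] by (simp add: LO_def)
  then show "dg l \<in> tree_set LO (kind l)"
    using assms tree_set_mono[OF LX_LO] by (elim LM_cases) auto
  then show "leaves (dg l) = width (kind l)" by (auto simp: tree_set_def dest: typed_leaves)
qed (use assms in \<open>auto elim!: LM_cases simp: LO_def\<close>)

lemma LO_facts:
  assumes "l \<in> LO"
  shows "ig l \<in> LM" "kind (ig l) = kind l" "dg (ig l) = cor l" "cg (ig l) = l"
  using assms cor_tree_set[of "Xl _" LX] by (auto elim!: LO_cases simp: LM_def LX_def)

lemma subst_tree_set:
  assumes "t \<in> tree_set L a" "\<And>l. l \<in> set (labels t) \<Longrightarrow> s l \<in> tree_set L' (kind l)"
  shows "subst s t \<in> tree_set L' a"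
proof -
  have t: "typed kind a t" using assms(1) by (simp add: tree_set_def)
  have s: "typed kind (kind l) (s l)" "set (labels (s l)) \<subseteq> L'" if "l \<in> set (labels t)" for l
    using assms(2)[OF that] by (simp_all add: tree_set_def)
  have "set (labels (subst s t)) = (\<Union>l \<in> set (labels t). set (labels (s l)))"
    using mset_eq_setD[OF mset_labels_subst[OF typed_fits[OF t], of s]] typed_leaves[OF s(1)] by simp
  then show ?thesis using s typed_subst[OF t s(1)] by (auto simp: tree_set_def)
qed

lemma relabel_tree_set:
  assumes "t \<in> tree_set L a" "\<And>l. l \<in> set (labels t) \<Longrightarrow> f l \<in> L' \<and> kind (f l) = kind l"
  shows "relabel f t \<in> tree_set L' a"
  using assms typed_cong[of t "\<lambda>l. kind (f l)" kind a] by (auto simp: tree_set_def)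

text \<open>An arrow is stored as its target in which every vertex carries the tree inserted there.
  Hence the source is a substitution and the target a mere relabelling.\<close>

definition src :: "tree \<Rightarrow> tree" where "src = subst dg"
definition tgt :: "tree \<Rightarrow> tree" where "tgt = relabel cg"
definition idt :: "tree \<Rightarrow> tree" where "idt = relabel ig"

lemma src_simps [simp]: "src Leaf = Leaf" "src (Node l ts) = graft (dg l) (map src ts)"
  by (simp_all add: src_def)

lemma tgt_simps [simp]: "tgt Leaf = Leaf" "tgt (Node l ts) = Node (cg l) (map tgt ts)"
  by (simp_all add: tgt_def)

lemma idt_simps [simp]: "idt Leaf = Leaf" "idt (Node l ts) = Node (ig l) (map idt ts)"
  by (simp_all add: idt_def)

lemma leaves_tgt [simp]: "leaves (tgt t) = leaves t" "leaves (idt t) = leaves t"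
  by (simp_all add: tgt_def idt_def)

abbreviation arr :: "colour \<Rightarrow> tree set" where "arr \<equiv> tree_set LM"
abbreviation obj :: "colour \<Rightarrow> tree set" where "obj \<equiv> tree_set LO"

lemma arr_labels: "t \<in> tree_set L a \<Longrightarrow> l \<in> set (labels t) \<Longrightarrow> l \<in> L"
  by (auto simp: tree_set_def)

lemma src_obj: "t \<in> tree_set LM a \<Longrightarrow> src t \<in> obj a"
  unfolding src_def by (rule subst_tree_set) (auto intro: LM_facts(1) arr_labels)

lemma tgt_obj: "t \<in> arr a \<Longrightarrow> tgt t \<in> obj a"
  unfolding tgt_def by (rule relabel_tree_set) (auto intro: LM_facts(2,3) arr_labels)

lemma idt_arr: "t \<in> obj a \<Longrightarrow> idt t \<in> arr a"
  unfolding idt_def by (rule relabel_tree_set) (auto intro: LO_facts(1,2) arr_labels)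

text \<open>Correct numbers of branches and admissible labels, without the rule on the order of
  colours. Unlike \<open>typed\<close> with its fixed colour, it passes to all subtrees and through
  \<open>graft\<close> in both directions, as the inductions on arrows require.\<close>

definition wf_tree :: "nat set \<Rightarrow> tree \<Rightarrow> bool" where
  "wf_tree L t \<longleftrightarrow> fits (\<lambda>i. width (kind i)) t \<and> set (labels t) \<subseteq> L"

lemma wf_simps [simp]: "wf_tree L Leaf"
  "wf_tree L (Node l ts) \<longleftrightarrow> l \<in> L \<and> width (kind l) = length ts \<and> (\<forall>t \<in> set ts. wf_tree L t)"
  by (auto simp: wf_tree_def)

lemma tree_set_wf: "t \<in> tree_set L a \<Longrightarrow> wf_tree L t"
  by (auto simp: wf_tree_def tree_set_def dest: typed_fits)

lemma wf_mono: "wf_tree L t \<Longrightarrow> L \<subseteq> L' \<Longrightarrow> wf_tree L' t"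
  by (auto simp: wf_tree_def)

lemma wf_graft [simp]:
  "length us = leaves t \<Longrightarrow> wf_tree L (graft t us) \<longleftrightarrow> wf_tree L t \<and> (\<forall>u \<in> set us. wf_tree L u)"
  "length us = sum_list (map leaves ts) \<Longrightarrow>
    (\<forall>t \<in> set (graft_list ts us). wf_tree L t) \<longleftrightarrow> (\<forall>t \<in> set ts. wf_tree L t) \<and> (\<forall>u \<in> set us. wf_tree L u)"
proof (induction t us and ts us rule: graft_graft_list.induct)
  case (1 us) then show ?case by (cases us) auto
next
  case (4 t ts us)
  have "set us = set (take (leaves t) us) \<union> set (drop (leaves t) us)"
    by (metis append_take_drop_id set_append)
  with 4 show ?case by auto
qed auto

lemma wf_cor: "l \<in> L \<Longrightarrow> wf_tree L (cor l)"
  by (simp add: cor_def)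

lemma wf_dg: "l \<in> LM \<Longrightarrow> wf_tree LO (dg l)"
  using LM_facts(1) tree_set_wf by blast

lemma leaves_src [simp]: "wf_tree LM t \<Longrightarrow> leaves (src t) = leaves t"
  unfolding src_def wf_tree_def by (rule leaves_subst[where w = "\<lambda>i. width (kind i)"]) (auto simp: LM_facts)

lemma wf_src: "wf_tree LM t \<Longrightarrow> wf_tree LO (src t)"
  by (induction t) (auto simp: wf_dg LM_facts)

lemma wf_tgt: "wf_tree LM t \<Longrightarrow> wf_tree LO (tgt t)"
  by (induction t) (auto simp: LM_facts)

lemma wf_idt: "wf_tree LO t \<Longrightarrow> wf_tree LM (idt t)"
  by (induction t) (auto simp: LO_facts)

lemma src_graft:
  "wf_tree LM t \<Longrightarrow> length us = leaves t \<Longrightarrow> src (graft t us) = graft (src t) (map src us)"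
  unfolding src_def wf_tree_def by (rule subst_graft(1)[where w = "\<lambda>i. width (kind i)"]) (auto simp: LM_facts)

lemma tgt_graft: "length us = leaves t \<Longrightarrow> tgt (graft t us) = graft (tgt t) (map tgt us)"
  unfolding tgt_def by (rule relabel_graft(1))

lemma idt_graft: "length us = leaves t \<Longrightarrow> idt (graft t us) = graft (idt t) (map idt us)"
  unfolding idt_def by (rule relabel_graft(1))

lemma src_idt: "wf_tree LO t \<Longrightarrow> src (idt t) = t"
proof (induction t)
  case (Node l ts)
  then have "map src (map idt ts) = ts" by (auto intro!: map_idI)
  then show ?case using Node.prems by (simp add: LO_facts graft_cor)
qed simp

lemma tgt_idt: "wf_tree LO t \<Longrightarrow> tgt (idt t) = t"
  by (induction t) (auto simp: LO_facts intro!: map_idI)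

text \<open>For \<open>f\<close> of the form \<open>graft g us\<close> with \<open>g\<close> of the shape of \<open>q\<close>, \<open>trunk q f\<close> is \<open>g\<close> and
  \<open>crown q f\<close> is \<open>us\<close>.\<close>

fun trunk :: "tree \<Rightarrow> tree \<Rightarrow> tree" and trunks :: "tree list \<Rightarrow> tree list \<Rightarrow> tree list" where
  "trunk (Node i qs) (Node l fs) = Node l (trunks qs fs)"
| "trunk _ _ = Leaf"
| "trunks (q # qs) (f # fs) = trunk q f # trunks qs fs"
| "trunks _ _ = []"

fun crown :: "tree \<Rightarrow> tree \<Rightarrow> tree list" and crowns :: "tree list \<Rightarrow> tree list \<Rightarrow> tree list" where
  "crown (Node i qs) (Node l fs) = crowns qs fs"
| "crown _ f = [f]"
| "crowns (q # qs) (f # fs) = crown q f @ crowns qs fs"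
| "crowns _ _ = []"

text \<open>The shape of \<open>q\<close> tells where \<open>g\<close> stops, so the graft can be
  undone; \<open>graft g us\<close> alone does not determine the cut.\<close>

lemma top_graft:
  "relabel h g = relabel h' q \<Longrightarrow> length us = leaves q \<Longrightarrow> trunk q (graft g us) = g \<and> crown q (graft g us) = us"
proof (induction q arbitrary: g us)
  case Leaf
  then show ?case by (cases g; cases us) auto
next
  case (Node i qs)
  then obtain l gs where g: "g = Node l gs" by (cases g) auto
  have "trunks qs (graft_list gs us) = gs \<and> crowns qs (graft_list gs us) = us"
    if "map (relabel h) gs = map (relabel h') qs" "length us = sum_list (map leaves qs)"
      "\<And>q g us. q \<in> set qs \<Longrightarrow> relabel h g = relabel h' q \<Longrightarrow> length us = leaves q \<Longrightarrow>
        trunk q (graft g us) = g \<and> crown q (graft g us) = us" for gs us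
    using that
  proof (induction qs arbitrary: gs us)
    case (Cons q qs)
    then obtain g gs' where gs: "gs = g # gs'" by (cases gs) auto
    then have "leaves g = leaves q" using Cons.prems(1) leaves_relabel[of h g] leaves_relabel[of h' q] by simp
    then show ?case using Cons.prems Cons.IH[of gs' "drop (leaves q) us"] gs by simp
  qed auto
  from this[of gs us] show ?case using Node g by simp
qed

text \<open>Relabelling preserves shapes, so a decomposition of the relabelled tree lifts. With
  \<open>cg\<close> for \<open>h\<close> this splits an arrow along a decomposition of its
  target.\<close>

lemma graft_decomp:
  "relabel h f = graft q us \<Longrightarrow> length us = leaves q \<Longrightarrow>
    \<exists>g vs. f = graft g vs \<and> relabel h g = q \<and> map (relabel h) vs = us"
proof (induction q arbitrary: f us)
  case Leaf
  then obtain u where "us = [u]" by (cases us) auto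
  with Leaf show ?case by (intro exI[of _ Leaf] exI[of _ "[f]"]) simp
next
  case (Node i qs)
  then obtain l fs where f: "f = Node l fs" by (cases f) auto
  have "\<exists>gs vs. fs = graft_list gs vs \<and> map (relabel h) gs = qs \<and> map (relabel h) vs = us"
    if "map (relabel h) fs = graft_list qs us" "length us = sum_list (map leaves qs)"
      "\<And>q f us. q \<in> set qs \<Longrightarrow> relabel h f = graft q us \<Longrightarrow> length us = leaves q \<Longrightarrow>
        \<exists>g vs. f = graft g vs \<and> relabel h g = q \<and> map (relabel h) vs = us" for fs us
    using that
  proof (induction qs arbitrary: fs us)
    case (Cons q qs)
    then obtain f fs' where fs: "fs = f # fs'" by (cases fs) auto
    obtain g vs where 1: "f = graft g vs" "relabel h g = q" "map (relabel h) vs = take (leaves q) us"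
    proof -
      have "relabel h f = graft q (take (leaves q) us)" "length (take (leaves q) us) = leaves q"
        using Cons.prems fs by auto
      from Cons.prems(3)[OF _ this] show ?thesis using that by auto
    qed
    obtain gs vs' where 2: "fs' = graft_list gs vs'" "map (relabel h) gs = qs" "map (relabel h) vs' = drop (leaves q) us"
      using Cons.IH[of fs' "drop (leaves q) us"] Cons.prems fs by auto
    have "length vs = leaves g"
      using arg_cong[OF 1(3), of length] 1(2) Cons.prems(2) by auto
    then show ?case using fs 1 2
      by (intro exI[of _ "g # gs"] exI[of _ "vs @ vs'"]) auto
  qed auto
  from this[of fs us] f Node obtain gs vs where
    "fs = graft_list gs vs" "map (relabel h) gs = qs" "map (relabel h) vs = us" by auto
  then show ?case using f Node.prems by (intro exI[of _ "Node l gs"] exI[of _ vs]) auto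
qed

text \<open>Over a vertex \<open>M(c, q)\<close> of \<open>g\<close> the arrow \<open>f\<close> has a part of the shape of \<open>q\<close>, whose source becomes
  the label of the composite.\<close>

fun cmp :: "tree \<Rightarrow> tree \<Rightarrow> tree" and cmps :: "tree list \<Rightarrow> tree list \<Rightarrow> tree list" where
  "cmp Leaf f = Leaf"
| "cmp (Node l gs) f = Node (cl l (src (trunk (dg l) f))) (cmps gs (crown (dg l) f))"
| "cmps [] fs = []"
| "cmps (g # gs) fs = cmp g (hd fs) # cmps gs (tl fs)"

lemma cmps_map2: "length gs = length fs \<Longrightarrow> cmps gs fs = map2 cmp gs fs"
proof (induction gs arbitrary: fs)
  case (Cons g gs) then show ?case by (cases fs) auto
qed simp

lemma length_cmps [simp]: "length (cmps gs fs) = length gs"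
  by (induction gs arbitrary: fs) auto

lemma cmps_append: "cmps (gs @ gs') fs = cmps gs (take (length gs) fs) @ cmps gs' (drop (length gs) fs)"
  by (induction gs arbitrary: fs) (auto simp: drop_Suc take_Suc hd_take tl_take)

lemma cmp_Node:
  assumes "tgt F = dg l" "length fs = leaves (dg l)"
  shows "cmp (Node l gs) (graft F fs) = Node (cl l (src F)) (cmps gs fs)"
  using top_graft[of cg F "\<lambda>i. i" "dg l" fs] assms by (simp add: tgt_def relabel_ident)

text \<open>The source of \<open>Node l gs\<close> is \<open>dg l\<close> with the sources of
  \<open>gs\<close> grafted on, so a composable \<open>f\<close> splits into a part \<open>F\<close>
  over the root and parts \<open>fs\<close> over the branches. The inductions on composition rest on
  this.\<close>

lemma src_decomp:
  assumes "tgt f = src (Node l gs)" "wf_tree LM (Node l gs)" "wf_tree LM f"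
  obtains F fs where "f = graft F fs" "tgt F = dg l" "map tgt fs = map src gs" "length fs = leaves (dg l)"
    "length fs = leaves F" "wf_tree LM F" "\<forall>f \<in> set fs. wf_tree LM f"
proof -
  have "length (map src gs) = leaves (dg l)" using assms(2) by (simp add: LM_facts)
  then obtain F fs where F: "f = graft F fs" "tgt F = dg l" "map tgt fs = map src gs"
    using graft_decomp[of cg f "dg l" "map src gs"] assms(1) unfolding tgt_def by auto
  then have l: "length fs = leaves (dg l)" using \<open>length (map src gs) = _\<close> by (metis length_map)
  then have "length fs = leaves F" using F(2) by (metis leaves_tgt(1))
  then show ?thesis using that[OF F l] assms(3) F(1) by simp
qed

text \<open>The only arrow label with target \<open>K(c)\<close> is that of its identity.\<close>

lemma tgt_eq_cor_Kl:
  assumes "wf_tree LM F" "tgt F = cor (Kl c)" shows "F = cor (Kl c)"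
proof -
  from assms(2) obtain l' fs where F: "F = Node l' fs" "cg l' = Kl c" "map tgt fs = replicate (width c) Leaf"
    unfolding cor_def by (cases F) auto
  have "tgt t = Leaf \<Longrightarrow> t = Leaf" for t by (cases t) auto
  moreover have len: "length fs = width c" using arg_cong[OF F(3), of length] by simp
  moreover have "tgt (fs ! i) = Leaf" if "i < width c" for i
    using arg_cong[OF F(3), of "\<lambda>x. x ! i"] len that by simp
  ultimately have "fs = replicate (width c) Leaf" by (auto intro!: nth_equalityI)
  moreover have "l' = Kl c" using assms(1) F(1,2) by (auto elim!: LM_cases)
  ultimately show ?thesis using F(1) by (simp add: cor_def)
qed

text \<open>In the \<open>M\<close> case the targets of the labels of \<open>F\<close> occur in an
  all-\<open>X\<close> tree, so these labels are of the form \<open>M\<close> again. Hence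
  \<open>src F\<close> is all-\<open>X\<close> and may serve as the source of a generator.\<close>

lemma cl_src:
  assumes "l \<in> LM" "wf_tree LM F" "tgt F = dg l"
  shows "cl l (src F) \<in> LM" "dg (cl l (src F)) = src F" 
    "kind (cl l (src F)) = kind l" "cg (cl l (src F)) = cg l"
proof -
  have "cl l (src F) \<in> LM \<and> dg (cl l (src F)) = src F"
    using assms(1)
  proof (cases rule: LM_cases)
    case (K c)
    then have "tgt F = cor (Kl c)" using assms(3) by simp
    then have "F = cor (Kl c)" by (rule tgt_eq_cor_Kl[OF assms(2)])
    then show ?thesis using K assms(1) by (simp add: src_def subst_cor)
  next
    case (M c p)
    have eq: "relabel cg F = p" using assms(3) M by (simp add: tgt_def)
    have F: "l' \<in> LM" if "l' \<in> set (labels F)" for l' using assms(2) that by (auto simp: wf_tree_def)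
    have "typed kind c (relabel cg F)" using M eq by (simp add: tree_set_def)
    then have "typed kind c F"
      unfolding typed_relabel using typed_cong[of F "\<lambda>i. kind (cg i)" kind c] F LM_facts(2) by auto
    then have "F \<in> tree_set LM c" using F by (auto simp: tree_set_def)
    moreover have "dg l' \<in> tree_set LX (kind l')" if "l' \<in> set (labels F)" for l'
    proof -
      have "cg l' \<in> set (labels p)" using that eq by auto
      then have "cg l' \<in> LX" using M by (auto simp: tree_set_def)
      then show ?thesis using F[OF that] by (auto elim!: LM_cases simp: LX_def)
    qed
    ultimately have "src F \<in> tree_set LX c" unfolding src_def by (rule subst_tree_set)
    then show ?thesis using M by (auto simp: LM_def)
  qed
  then show "cl l (src F) \<in> LM" "dg (cl l (src F)) = src F" by auto
qed (use assms(1) in \<open>simp_all add: LM_facts\<close>)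

lemma cmp_props:
  "wf_tree LM g \<Longrightarrow> wf_tree LM f \<Longrightarrow> tgt f = src g \<Longrightarrow>
    wf_tree LM (cmp g f) \<and> src (cmp g f) = src f \<and> tgt (cmp g f) = tgt g"
proof (induction g arbitrary: f)
  case Leaf
  then show ?case by (cases f) auto
next
  case (Node l gs)
  from src_decomp[OF Node.prems(3,1,2)] obtain F fs where F: "f = graft F fs" "tgt F = dg l"
    "map tgt fs = map src gs" "length fs = leaves (dg l)" "length fs = leaves F" "wf_tree LM F" "\<forall>f\<in>set fs. wf_tree LM f" .
  have len: "length gs = length fs" using F(3) by (metis length_map)
  have i: "wf_tree LM (cmp (gs ! i) (fs ! i)) \<and> src (cmp (gs ! i) (fs ! i)) = src (fs ! i) \<and>
      tgt (cmp (gs ! i) (fs ! i)) = tgt (gs ! i)" if "i < length fs" for i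
    using Node.IH[of "gs ! i" "fs ! i"] Node.prems(1) F(7) that len arg_cong[OF F(3), of "\<lambda>x. x ! i"] by simp
  have "map src (cmps gs fs) = map src fs" "map tgt (cmps gs fs) = map tgt gs" "\<forall>h \<in> set (cmps gs fs). wf_tree LM h"
    using i len by (auto intro!: nth_equalityI simp: cmps_map2 in_set_zip)
  moreover have "l \<in> LM" using Node.prems by simp
  ultimately show ?case
    using cmp_Node[OF F(2,4), of gs] F cl_src[OF _ F(6,2)] Node.prems(1) len by (simp add: src_graft)
qed

text \<open>The interchange law, on which associativity and the functoriality of the operations
  depend.\<close>

lemma cmp_graft:
  "wf_tree LM G \<Longrightarrow> wf_tree LM F \<Longrightarrow> tgt F = src G \<Longrightarrow> length gs = leaves G \<Longrightarrow> length fs = leaves G \<Longrightarrow>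
    cmp (graft G gs) (graft F fs) = graft (cmp G F) (cmps gs fs)"
proof (induction G arbitrary: F gs fs)
  case Leaf
  then show ?case by (cases F; cases gs; cases fs) auto
next
  case (Node l Gs)
  from src_decomp[OF Node.prems(3,1,2)] obtain F' Fs where F: "F = graft F' Fs" "tgt F' = dg l"
    "map tgt Fs = map src Gs" "length Fs = leaves (dg l)" "length Fs = leaves F'" "wf_tree LM F'" "\<forall>f\<in>set Fs. wf_tree LM f" .
  have len: "length Gs = length Fs" using F(3) by (metis length_map)
  have lF: "map leaves Fs = map leaves Gs"
  proof -
    have "map leaves (map tgt Fs) = map leaves (map src Gs)" using F(3) by simp
    also have "\<dots> = map leaves Gs" using Node.prems(1) by (auto)
    finally show ?thesis by (simp add: comp_def)
  qed
  have "cmps (graft_list Gs gs) (graft_list Fs fs) = graft_list (cmps Gs Fs) (cmps gs fs)"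
    if "map leaves Fs = map leaves Gs" "map tgt Fs = map src Gs" "length gs = sum_list (map leaves Gs)"
      "length fs = length gs" "\<forall>f\<in>set Gs. wf_tree LM f" "\<forall>f\<in>set Fs. wf_tree LM f"
      "\<And>G F gs fs. G \<in> set Gs \<Longrightarrow> wf_tree LM G \<Longrightarrow> wf_tree LM F \<Longrightarrow> tgt F = src G \<Longrightarrow> length gs = leaves G \<Longrightarrow>
        length fs = leaves G \<Longrightarrow> cmp (graft G gs) (graft F fs) = graft (cmp G F) (cmps gs fs)" for gs fs
    using that
  proof (induction Gs arbitrary: Fs gs fs)
    case (Cons G Gs)
    then obtain H Hs where Fs: "Fs = H # Hs" by (cases Fs) auto
    have "leaves (cmp G H) = leaves G"
      using cmp_props[of G H] Cons.prems Fs leaves_tgt(1)[of "cmp G H"] leaves_tgt(1)[of G] by simp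
    moreover have "cmps (take (leaves G) gs) (take (leaves G) fs) = take (leaves G) (cmps gs fs)"
      "cmps (drop (leaves G) gs) (drop (leaves G) fs) = drop (leaves G) (cmps gs fs)"
      using Cons.prems(4) by (simp_all add: cmps_map2 take_map drop_map take_zip drop_zip)
    moreover have "cmps (graft_list Gs (drop (leaves G) gs)) (graft_list Hs (drop (leaves G) fs)) =
        graft_list (cmps Gs Hs) (cmps (drop (leaves G) gs) (drop (leaves G) fs))"
      using Cons.prems Fs by (intro Cons.IH) auto
    ultimately show ?case using Cons.prems Fs by simp
  qed simp
  from this[of gs fs] lF F len Node.prems
  have cs: "cmps (graft_list Gs gs) (graft_list Fs fs) = graft_list (cmps Gs Fs) (cmps gs fs)"
    using Node.IH by auto
  have "length fs = sum_list (map leaves Fs)" using Node.prems lF by simp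
  then have "graft F fs = graft F' (graft_list Fs fs)" using F by (simp add: graft_graft)
  then have "cmp (graft (Node l Gs) gs) (graft F fs) =
      Node (cl l (src F')) (cmps (graft_list Gs gs) (graft_list Fs fs))"
    using cmp_Node[OF F(2), of "graft_list Fs fs" "graft_list Gs gs"] F by simp
  also have "\<dots> = graft (cmp (Node l Gs) F) (cmps gs fs)"
    using cmp_Node[OF F(2,4), of Gs] F cs by simp
  finally show ?case .
qed

lemma cmp_idt_left: "wf_tree LM f \<Longrightarrow> cmp (idt (tgt f)) f = f"
proof (induction f)
  case (Node l fs)
  have l: "cg l \<in> LO" "kind (cg l) = kind l" "width (kind l) = length fs" using Node.prems by (auto simp: LM_facts)
  have dg: "dg (ig (cg l)) = cor (cg l)" by (rule LO_facts(3)[OF l(1)])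
  have "cmps (map (\<lambda>t. idt (tgt t)) fs) fs = fs"
    using Node by (auto simp: cmps_map2 intro!: nth_equalityI)
  moreover have "tgt (cor l) = dg (ig (cg l))"
    using l unfolding dg by (simp add: tgt_def relabel_cor)
  moreover have "Node l fs = graft (cor l) fs" using l by (simp add: graft_cor)
  moreover have "src (cor l) = dg l"
    using Node.prems by (simp add: src_def subst_cor LM_facts)
  moreover have "cl (ig (cg l)) (dg l) = l"
    using Node.prems by (auto elim!: LM_cases)
  ultimately have "cmp (Node (ig (cg l)) (map (\<lambda>t. idt (tgt t)) fs)) (Node l fs) = Node l fs"
    using cmp_Node[of "cor l" "ig (cg l)" fs "map (\<lambda>t. idt (tgt t)) fs"] l dg by simp
  then show ?case by (simp add: comp_def)
qed simp

lemma cmp_idt_right: "wf_tree LM f \<Longrightarrow> cmp f (idt (src f)) = f"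
proof (induction f)
  case (Node l fs)
  have l: "l \<in> LM" "wf_tree LO (dg l)" "leaves (dg l) = length fs" using Node.prems by (auto simp: LM_facts wf_dg)
  have "cmps fs (map idt (map src fs)) = fs"
    using Node by (auto simp: cmps_map2 intro!: nth_equalityI)
  then show ?case
    using cmp_Node[of "idt (dg l)" l "map idt (map src fs)" fs] l
    by (simp add: idt_graft src_idt tgt_idt LM_facts)
qed simp

text \<open>At the root both sides carry \<open>l\<close> with the new source \<open>src F\<close>;
  \<open>cmp_graft\<close> splits \<open>cmp g f\<close> accordingly, and over the branches the
  pieces associate by induction.\<close>

lemma cmp_assoc:
  "wf_tree LM h \<Longrightarrow> wf_tree LM g \<Longrightarrow> wf_tree LM f \<Longrightarrow> tgt g = src h \<Longrightarrow> tgt f = src g \<Longrightarrow>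
    cmp h (cmp g f) = cmp (cmp h g) f"
proof (induction h arbitrary: g f)
  case (Node l hs)
  from src_decomp[OF Node.prems(4,1,2)] obtain G gs where G: "g = graft G gs" "tgt G = dg l"
    "map tgt gs = map src hs" "length gs = leaves (dg l)" "length gs = leaves G" "wf_tree LM G" "\<forall>f\<in>set gs. wf_tree LM f" .
  have l: "l \<in> LM" "width (kind l) = length hs" using Node.prems(1) by auto
  let ?m = "cl l (src G)"
  have m: "?m \<in> LM" "dg ?m = src G" "kind ?m = kind l"
    using cl_src[OF l(1) G(6,2)] by auto
  have hg: "cmp (Node l hs) g = Node ?m (cmps hs gs)" unfolding G(1) by (rule cmp_Node[OF G(2,4)])
  have lhg: "length hs = length gs" using G(3) by (metis length_map)
  have tf: "tgt f = src (Node ?m gs)" using Node.prems(5) G m by (simp add: src_graft)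
  have wm: "wf_tree LM (Node ?m gs)" using m G l lhg by simp
  from src_decomp[OF tf wm Node.prems(3)] obtain F fs where F: "f = graft F fs" "tgt F = dg ?m"
    "map tgt fs = map src gs" "length fs = leaves (dg ?m)" "length fs = leaves F" "wf_tree LM F" "\<forall>f\<in>set fs. wf_tree LM f" .
  have lgf: "length gs = length fs" using F(3) by (metis length_map)
  have GF: "tgt F = src G" using F(2) m(2) by simp
  have gf: "cmp g f = graft (cmp G F) (cmps gs fs)"
    unfolding G(1) F(1) using G F GF lgf by (intro cmp_graft) auto
  have p: "wf_tree LM (cmp G F)" "src (cmp G F) = src F" "tgt (cmp G F) = dg l"
    using cmp_props[OF G(6) F(6) GF] G(2) by auto
  have "cmp (hs ! i) (cmp (gs ! i) (fs ! i)) = cmp (cmp (hs ! i) (gs ! i)) (fs ! i)" if "i < length fs" for i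
    using Node.prems(1) G(7) F(7) lhg lgf arg_cong[OF G(3), of "\<lambda>x. x ! i"] arg_cong[OF F(3), of "\<lambda>x. x ! i"] that
    by (intro Node.IH) simp_all
  then have "cmps hs (cmps gs fs) = cmps (cmps hs gs) fs"
    using lhg lgf by (auto simp: cmps_map2 intro!: nth_equalityI)
  moreover have "cmp (Node l hs) (cmp g f) = Node (cl l (src F)) (cmps hs (cmps gs fs))"
    unfolding gf using cmp_Node[OF p(3), of "cmps gs fs" hs] p G by simp
  moreover have "cmp (cmp (Node l hs) g) f = Node (cl l (src F)) (cmps (cmps hs gs) fs)"
    unfolding hg F(1) using cmp_Node[OF F(2,4)] l by (simp add: LM_facts)
  ultimately show ?case by simp
qed simp

text \<open>\<open>cg\<close> preserves colours, so the typing of an arrow can be tested at its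
  target.\<close>

lemma arr_of_tgt:
  assumes "wf_tree LM f" "tgt f \<in> obj a" shows "f \<in> arr a"
proof -
  have "typed (\<lambda>i. kind (cg i)) a f" using assms(2) by (simp add: tree_set_def tgt_def)
  then have "typed kind a f"
    using typed_cong[of f "\<lambda>i. kind (cg i)" kind a] assms(1) LM_facts(2) by (auto simp: wf_tree_def)
  then show ?thesis using assms(1) by (auto simp: wf_tree_def tree_set_def)
qed

lemma cmp_arr:
  assumes "g \<in> arr a" "f \<in> arr a" "tgt f = src g"
  shows "cmp g f \<in> arr a" "src (cmp g f) = src f" "tgt (cmp g f) = tgt g"
proof -
  have p: "wf_tree LM (cmp g f)" "src (cmp g f) = src f" "tgt (cmp g f) = tgt g"
    using cmp_props[of g f] assms tree_set_wf by auto
  then show "src (cmp g f) = src f" "tgt (cmp g f) = tgt g" by auto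
  show "cmp g f \<in> arr a" using arr_of_tgt[OF p(1)] p(3) tgt_obj[OF assms(1)] by simp
qed

lemma cmp_subst:
  assumes "fits w t" "\<And>i. i \<in> set (labels t) \<Longrightarrow> wf_tree LM (g i) \<and> wf_tree LM (f i) \<and> tgt (f i) = src (g i) \<and> leaves (g i) = w i"
  shows "cmp (subst g t) (subst f t) = subst (\<lambda>i. cmp (g i) (f i)) t"
  using assms
proof (induction t)
  case (Node i ts)
  have "cmp (subst g t) (subst f t) = subst (\<lambda>i. cmp (g i) (f i)) t" if "t \<in> set ts" for t
    using that Node.prems by (intro Node.IH) auto
  then have "cmps (map (subst g) ts) (map (subst f) ts) = map (subst (\<lambda>i. cmp (g i) (f i))) ts"
    by (auto simp: cmps_map2 intro!: nth_equalityI)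
  then show ?case
    using Node.prems cmp_graft[of "g i" "f i" "map (subst g) ts" "map (subst f) ts"] by simp
qed simp

lemma cmp_cor:
  assumes "wf_tree LM \<phi>" "l \<in> LM" "tgt \<phi> = dg l"
  shows "cmp (cor l) \<phi> = cor (cl l (src \<phi>))"
proof -
  let ?r = "replicate (width (kind l)) Leaf"
  have "leaves \<phi> = width (kind l)" using LM_facts(6)[OF assms(2)] assms(3) by (metis leaves_tgt(1))
  then have "\<phi> = graft \<phi> ?r" by (simp add: graft_Leaves(1) set_replicate_conv_if)
  moreover have "cmps ?r fs = ?r" for fs
  proof -
    have "cmps (replicate n Leaf) fs = replicate n Leaf" for n
      by (induction n arbitrary: fs) auto
    then show ?thesis .
  qed
  ultimately show ?thesis
    using cmp_Node[OF assms(3), of ?r ?r] LM_facts(6)[OF assms(2)] LM_facts(4)[OF assms(2)] by (simp add: cor_def)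
qed

lemma distinct_concat_disjoint:
  "distinct (concat xss) \<Longrightarrow> i < length xss \<Longrightarrow> j < length xss \<Longrightarrow> i \<noteq> j \<Longrightarrow>
    set (xss ! i) \<inter> set (xss ! j) = {}"
proof (induction xss arbitrary: i j)
  case (Cons xs xss)
  then have "set xs \<inter> set (xss ! k) = {}" if "k < length xss" for k
  proof -
    have "set (xss ! k) \<subseteq> \<Union> (set ` set xss)" using nth_mem[OF that] by blast
    then show ?thesis using Cons.prems(1) by auto
  qed
  with Cons show ?case by (cases i; cases j) auto
qed simp

text \<open>\<open>graft_decomp\<close> for a whole tree of substitutions. Distinct labels of
  \<open>u\<close> give each vertex its own piece \<open>\<phi> i\<close>, even where the trees
  \<open>s i\<close> coincide.\<close>

lemma subst_decomp:
  "relabel h f = subst s u \<Longrightarrow> distinct (labels u) \<Longrightarrow> fits w u \<Longrightarrow>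
    (\<And>i. i \<in> set (labels u) \<Longrightarrow> leaves (s i) = w i) \<Longrightarrow> wf_tree L f \<Longrightarrow>
    \<exists>\<phi>. f = subst \<phi> u \<and> (\<forall>i \<in> set (labels u). relabel h (\<phi> i) = s i \<and> wf_tree L (\<phi> i))"
proof (induction u arbitrary: f)
  case Leaf
  then show ?case by (cases f) auto
next
  case (Node i us)
  have wi: "leaves (s i) = length us" using Node.prems by simp
  from Node.prems(1) obtain g vs where f: "f = graft g vs" "relabel h g = s i" "map (relabel h) vs = map (subst s) us"
    using graft_decomp[of h f "s i" "map (subst s) us"] wi by auto
  have l: "length vs = length us" "length vs = leaves g"
    using arg_cong[OF f(3), of length] arg_cong[OF f(2), of leaves] wi by simp_all
  have "\<exists>\<phi>. vs ! j = subst \<phi> (us ! j) \<and> (\<forall>i \<in> set (labels (us ! j)). relabel h (\<phi> i) = s i \<and> wf_tree L (\<phi> i))"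
    if j: "j < length us" for j
  proof (rule Node.IH)
    show "relabel h (vs ! j) = subst s (us ! j)"
      using arg_cong[OF f(3), of "\<lambda>x. x ! j"] l j by simp
    show "distinct (labels (us ! j))"
      using Node.prems(2) j by (auto simp: distinct_concat_iff)
    show "leaves (s k) = w k" if "k \<in> set (labels (us ! j))" for k
      using that Node.prems(4) nth_mem[OF j] by auto
    show "fits w (us ! j)" "wf_tree L (vs ! j)" using j l Node.prems(3,5) f(1) by simp_all
  qed (use j in simp)
  then obtain \<Phi> where \<Phi>: "\<And>j. j < length us \<Longrightarrow> vs ! j = subst (\<Phi> j) (us ! j)"
    "\<And>j i. j < length us \<Longrightarrow> i \<in> set (labels (us ! j)) \<Longrightarrow> relabel h (\<Phi> j i) = s i \<and> wf_tree L (\<Phi> j i)"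
    by metis
  \<comment> \<open>The branches of \<open>u\<close> have disjoint labels, so the label
    \<open>k\<close> determines the branch whose family of pieces is meant.\<close>
  define \<phi> where "\<phi> k = (if k = i then g else \<Phi> (SOME j. j < length us \<and> k \<in> set (labels (us ! j))) k)" for k
  have \<phi>: "\<phi> k = \<Phi> j k" if "j < length us" "k \<in> set (labels (us ! j))" for j k
  proof -
    have "j' = j" if "j' < length us" "k \<in> set (labels (us ! j'))" for j'
    proof (rule ccontr)
      assume "j' \<noteq> j"
      then have "set (map labels us ! j') \<inter> set (map labels us ! j) = {}"
        using that \<open>j < length us\<close> Node.prems(2) distinct_concat_disjoint[of "map labels us" j' j] by simp
      then show False using that \<open>k \<in> set (labels (us ! j))\<close> \<open>j < length us\<close> by auto
    qed
    then have "(SOME j. j < length us \<and> k \<in> set (labels (us ! j))) = j" using that by blast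
    moreover have "k \<noteq> i" using that Node.prems(2) by auto
    ultimately show ?thesis by (simp add: \<phi>_def)
  qed
  have "vs = map (subst \<phi>) us"
    using l \<phi> \<Phi>(1) by (auto intro!: nth_equalityI subst_cong)
  then have "f = subst \<phi> (Node i us)" using f(1) by (simp add: \<phi>_def)
  moreover have "relabel h (\<phi> k) = s k \<and> wf_tree L (\<phi> k)" if k: "k \<in> set (labels (Node i us))" for k
  proof (cases "k = i")
    case True then show ?thesis using f l Node.prems(5) by (simp add: \<phi>_def)
  next
    case False
    then obtain j where "j < length us" "k \<in> set (labels (us ! j))" using k by (auto simp: in_set_conv_nth[of _ us])
    then show ?thesis using \<phi> \<Phi>(2) by simp
  qed
  ultimately show ?case by blast
qed

section \<open>The classifier\<close>

text \<open>Substitution commutes with substitution, relabelling and composition; together the four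
  facts make every operation a functor.\<close>

lemma tact_maps:
  assumes p: "is_op (as, a, u)"
  shows "list_all2 (\<lambda>a t. t \<in> arr a) as fs \<Longrightarrow> src (tree_act (as, a, u) fs) = tree_act (as, a, u) (map src fs)"
    and "list_all2 (\<lambda>a t. t \<in> arr a) as fs \<Longrightarrow> tgt (tree_act (as, a, u) fs) = tree_act (as, a, u) (map tgt fs)"
    and "list_all2 (\<lambda>a t. t \<in> obj a) as fs \<Longrightarrow> idt (tree_act (as, a, u) fs) = tree_act (as, a, u) (map idt fs)"
    and "list_all2 (\<lambda>a t. t \<in> arr a) as gs \<Longrightarrow> list_all2 (\<lambda>a t. t \<in> arr a) as fs \<Longrightarrow> map tgt fs = map src gs \<Longrightarrow>
      cmp (tree_act (as, a, u) gs) (tree_act (as, a, u) fs) = tree_act (as, a, u) (map2 cmp gs fs)"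
proof -
  have lab: "set (labels u) = {..<length as}" using is_op_labels[OF p] .
  have f: "fits (\<lambda>i. width (as ! i)) u" by (rule tree_of_colour_fits[OF is_op_tree[OF p]])
  show "src (tree_act (as, a, u) fs) = tree_act (as, a, u) (map src fs)" if fs: "list_all2 (\<lambda>a t. t \<in> arr a) as fs"
  proof -
    have ar: "fs ! i \<in> arr (as ! i)" "i < length fs" if "i \<in> set (labels u)" for i
      using fs that lab by (auto simp: list_all2_conv_all_nth)
    have "subst dg (subst ((!) fs) u) = subst (\<lambda>i. subst dg (fs ! i)) u"
    proof (rule subst_subst[OF f])
      fix i assume i: "i \<in> set (labels u)"
      show "leaves (fs ! i) = width (as ! i) \<and> fits (\<lambda>l. width (kind l)) (fs ! i)"
        using ar[OF i] tree_set_wf by (auto simp: tree_set_def wf_tree_def intro: typed_leaves)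
      show "leaves (dg j) = width (kind j)" if "j \<in> set (labels (fs ! i))" for j
        using arr_labels[OF ar(1)[OF i] that] by (simp add: LM_facts)
    qed
    also have "\<dots> = subst ((!) (map src fs)) u" using ar by (intro subst_cong) (simp add: src_def)
    finally show ?thesis by (simp add: tree_act_def src_def)
  qed
  have rel: "relabel h (tree_act (as, a, u) fs) = tree_act (as, a, u) (map (relabel h) fs)"
    if fs: "list_all2 (\<lambda>a t. t \<in> tree_set L a) as fs" for h L
  proof -
    have ar: "fs ! i \<in> tree_set L (as ! i)" "i < length fs" if "i \<in> set (labels u)" for i
      using fs that lab by (auto simp: list_all2_conv_all_nth)
    have "relabel h (subst ((!) fs) u) = subst (\<lambda>i. relabel h (fs ! i)) u"
      using ar by (intro relabel_subst[OF f]) (auto simp: tree_set_def intro: typed_leaves)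
    also have "\<dots> = subst ((!) (map (relabel h) fs)) u" using ar by (intro subst_cong) simp
    finally show ?thesis by (simp add: tree_act_def)
  qed
  show "list_all2 (\<lambda>a t. t \<in> arr a) as fs \<Longrightarrow> tgt (tree_act (as, a, u) fs) = tree_act (as, a, u) (map tgt fs)"
    unfolding tgt_def by (rule rel)
  show "list_all2 (\<lambda>a t. t \<in> obj a) as fs \<Longrightarrow> idt (tree_act (as, a, u) fs) = tree_act (as, a, u) (map idt fs)"
    unfolding idt_def by (rule rel)
  show "cmp (tree_act (as, a, u) gs) (tree_act (as, a, u) fs) = tree_act (as, a, u) (map2 cmp gs fs)"
    if gs: "list_all2 (\<lambda>a t. t \<in> arr a) as gs" and fs: "list_all2 (\<lambda>a t. t \<in> arr a) as fs"
      and st: "map tgt fs = map src gs"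
  proof -
    have ar: "fs ! i \<in> arr (as ! i)" "gs ! i \<in> arr (as ! i)" "i < length fs" "i < length gs" if "i \<in> set (labels u)" for i
      using fs gs that lab by (auto simp: list_all2_conv_all_nth)
    have "cmp (subst ((!) gs) u) (subst ((!) fs) u) = subst (\<lambda>i. cmp (gs ! i) (fs ! i)) u"
    proof (rule cmp_subst[OF f])
      fix i assume i: "i \<in> set (labels u)"
      show "wf_tree LM (gs ! i) \<and> wf_tree LM (fs ! i) \<and> tgt (fs ! i) = src (gs ! i) \<and> leaves (gs ! i) = width (as ! i)"
        using ar[OF i] tree_set_wf arg_cong[OF st, of "\<lambda>x. x ! i"]
        by (auto simp: tree_set_def intro: typed_leaves)
    qed
    also have "\<dots> = subst ((!) (map2 cmp gs fs)) u" using ar by (intro subst_cong) simp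
    finally show ?thesis by (simp add: tree_act_def)
  qed
qed

text \<open>The tree of the object \<open>p(X, ..., X)\<close>. It is independent of the numbering
  of the inputs and, together with the output colour, determines the orbit of
  \<open>p\<close>.\<close>

definition X_tree :: "tree_op \<Rightarrow> tree" where
  "X_tree p = relabel (\<lambda>i. Xl (fst p ! i)) (snd (snd p))"

lemma X_tree: "is_op (as, a, u) \<Longrightarrow> X_tree (as, a, u) \<in> tree_set LX a"
  using is_op_typed[of as a u] by (auto simp: X_tree_def tree_set_def LX_def)

lemma X_tree_stdk: "p \<in> tree_set LX a \<Longrightarrow> X_tree (stdk a p) = p"
proof -
  assume "p \<in> tree_set LX a"
  then have "relabel (\<lambda>l. Xl (kind l)) p = p"
    by (intro relabel_ident) (auto simp: tree_set_def LX_def)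
  moreover have "X_tree (stdk a p) = relabel ((!) (map (\<lambda>l. Xl (kind l)) (labels p))) (num 0 p)"
    unfolding X_tree_def std_def fst_conv snd_conv by (rule relabel_cong) simp
  moreover have "\<dots> = relabel (\<lambda>l. Xl (kind l)) p" by (rule relabel_num_map[OF refl])
  ultimately show ?thesis by (simp only:)
qed

lemma X_tree_std_Act:
  assumes "is_op (as, a, u)"
  obtains s where "s permutes {..<length as}" "stdk a (X_tree (as, a, u)) = Act triple_operad (as, a, u) s"
proof -
  have as: "map kind (map Xl as) = as" by (simp add: comp_def)
  have X: "X_tree (as, a, u) = relabel ((!) (map Xl as)) u"
    unfolding X_tree_def fst_conv snd_conv
    by (rule relabel_cong) (simp only: is_op_labels[OF assms] lessThan_iff nth_map)
  have op: "is_op (map kind (map Xl as), a, u)" using assms unfolding as .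
  show ?thesis
  proof (rule std_Act[OF op])
    fix s assume s: "s permutes {..<length (map Xl as)}"
      "stdk a (relabel ((!) (map Xl as)) u) = Act triple_operad (map kind (map Xl as), a, u) s"
    show ?thesis
      by (rule that[of s]) (use s in \<open>simp_all only: as length_map X\<close>)
  qed
qed

lemma Ml_X_tree: "is_op (as, a, u) \<Longrightarrow> Ml a (X_tree (as, a, u)) \<in> LM"
  using X_tree[of as a u] unfolding LM_def by blast

text \<open>The classifier has to live in the type \<open>'v\<close> of small sets, so trees are
  carried over along an injection.\<close>

locale tree_encoding =
  fixes enc :: "tree \<Rightarrow> 'v"
  assumes inj_enc: "inj enc"
begin

definition dec :: "'v \<Rightarrow> tree" where "dec = inv enc"

lemma dec_enc [simp]: "dec (enc t) = t"
  unfolding dec_def by (rule inv_f_f[OF inj_enc])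

definition W :: "(colour, tree_op, 'v, 'v) cat_alg" where
  "W = \<lparr>Cat = (\<lambda>a. \<lparr>Obj = enc ` obj a, Arr = enc ` arr a, Dom = (\<lambda>f. enc (src (dec f))),
      Cod = (\<lambda>f. enc (tgt (dec f))), Id = (\<lambda>x. enc (idt (dec x))), Comp = (\<lambda>g f. enc (cmp (dec g) (dec f)))\<rparr>),
     OpO = (\<lambda>p xs. enc (tree_act p (map dec xs))), OpM = (\<lambda>p fs. enc (tree_act p (map dec fs)))\<rparr>"

text \<open>\<open>mu\<close> sends \<open>p\<close> to the generating arrow with source
  \<open>X_tree p\<close>. The base is discrete, so \<open>kappa\<close> consists of identities, and
  the label \<open>Kl c\<close> of an object is also that of its identity.\<close>

definition U :: "(colour, tree_op, colour, 'v, 'v) int_alg" where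
  "U = \<lparr>X_of = (\<lambda>c. enc (cor (Xl c))), K_of = (\<lambda>c. enc (cor (Kl c))),
     mu = (\<lambda>p. enc (cor (Ml (fst (snd p)) (X_tree p)))), kappa = (\<lambda>c. enc (cor (Kl c)))\<rparr>"

lemma Cat_W [simp]:
  "Obj (Cat W a) = enc ` obj a" "Arr (Cat W a) = enc ` arr a" "Dom (Cat W a) f = enc (src (dec f))"
  "Cod (Cat W a) f = enc (tgt (dec f))" "Id (Cat W a) x = enc (idt (dec x))"
  "Comp (Cat W a) g f = enc (cmp (dec g) (dec f))"
  by (simp_all add: W_def)

lemma Op_W: "OpO W p xs = enc (tree_act p (map dec xs))" "OpM W p xs = enc (tree_act p (map dec xs))"
  by (simp_all add: W_def)

lemma U_simps [simp]: "X_of U c = enc (cor (Xl c))" "K_of U c = enc (cor (Kl c))"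
  "mu U (as, a, u) = enc (cor (Ml a (X_tree (as, a, u))))" "kappa U c = enc (cor (Kl c))"
  by (simp_all add: U_def)

lemma objs_W: "xs \<in> objs W as \<Longrightarrow> list_all2 (\<lambda>a t. t \<in> obj a) as (map dec xs)"
  "xs \<in> objs W as \<Longrightarrow> map (\<lambda>x. enc (dec x)) xs = xs"
  by (auto simp: objs_def list_all2_conv_all_nth image_iff intro!: nth_equalityI)

lemma arrs_W: "xs \<in> arrs W as \<Longrightarrow> list_all2 (\<lambda>a t. t \<in> arr a) as (map dec xs)"
  "xs \<in> arrs W as \<Longrightarrow> map (\<lambda>x. enc (dec x)) xs = xs"
  by (auto simp: arrs_def list_all2_conv_all_nth image_iff intro!: nth_equalityI)

lemma category_W: "category (Cat W a)"
proof
  fix f g h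
  assume "f \<in> Arr (Cat W a)" "g \<in> Arr (Cat W a)" "h \<in> Arr (Cat W a)"
    "Cod (Cat W a) f = Dom (Cat W a) g" "Cod (Cat W a) g = Dom (Cat W a) h"
  then show "Comp (Cat W a) h (Comp (Cat W a) g f) = Comp (Cat W a) (Comp (Cat W a) h g) f"
    using cmp_assoc inj_enc by (auto simp: inj_eq dest!: tree_set_wf)
qed (use inj_enc in \<open>auto simp: src_obj tgt_obj idt_arr src_idt tgt_idt cmp_idt_left cmp_idt_right tree_set_wf cmp_arr inj_eq\<close>)

lemma total_cat_W:
  "category (total_cat triple_operad W)"
proof -
  interpret category "Cat W a" for a by (rule category_W)
  show ?thesis
    by standard (auto simp: total_cat_def triple_simps(1) Dom_closed Cod_closed Id_closed Dom_Id Cod_Id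
       Comp_closed Dom_Comp Cod_Comp Comp_Id_right Comp_Id_left Comp_assoc simp del: Cat_W)
qed

lemma categorical_algebra_W: "categorical_algebra triple_operad W"
proof (rule categorical_algebra.intro)
  fix a show "category (Cat W a)" by (rule category_W)
next
  fix p xs assume p: "p \<in> Ops triple_operad" and xs: "xs \<in> objs W (In triple_operad p)"
  obtain as a u where [simp]: "p = (as, a, u)" by (cases p)
  have op: "is_op (as, a, u)" using p by (simp add: triple_simps)
  have xs: "list_all2 (\<lambda>a t. t \<in> obj a) as (map dec xs)" using objs_W(1)[OF xs] by (simp add: triple_simps)
  then have l: "length xs = length as" by (auto dest: list_all2_lengthD)
  show "OpO W p xs \<in> Obj (Cat W (Out triple_operad p))"
    using tact_closed[OF op xs] by (simp add: Op_W triple_simps(4))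
  have "ids W as xs = map (\<lambda>x. enc (idt (dec x))) xs"
    using l by (auto simp: ids_def intro!: nth_equalityI)
  then show "OpM W p (ids W (In triple_operad p) xs) = Id (Cat W (Out triple_operad p)) (OpO W p xs)"
    using tact_maps(3)[OF op xs] by (simp add: Op_W triple_simps(3) comp_def)
next
  fix p fs assume p: "p \<in> Ops triple_operad" and fs: "fs \<in> arrs W (In triple_operad p)"
  obtain as a u where [simp]: "p = (as, a, u)" by (cases p)
  have op: "is_op (as, a, u)" using p by (simp add: triple_simps)
  have fs: "list_all2 (\<lambda>a t. t \<in> arr a) as (map dec fs)" using arrs_W(1)[OF fs] by (simp add: triple_simps)
  then have l: "length fs = length as" by (auto dest: list_all2_lengthD)
  have "doms W as fs = map (\<lambda>x. enc (src (dec x))) fs" "cods W as fs = map (\<lambda>x. enc (tgt (dec x))) fs"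
    using l by (auto simp: doms_def cods_def intro!: nth_equalityI)
  then show "arrow (Cat W (Out triple_operad p)) (OpM W p fs)
       (OpO W p (doms W (In triple_operad p) fs)) (OpO W p (cods W (In triple_operad p) fs))"
    using tact_maps(1,2)[OF op fs] tact_closed[OF op fs]
    by (simp add: Op_W triple_simps(3,4) arrow_def comp_def)
  fix gs assume gs: "gs \<in> arrs W (In triple_operad p)"
    and st: "cods W (In triple_operad p) fs = doms W (In triple_operad p) gs"
  have gs: "list_all2 (\<lambda>a t. t \<in> arr a) as (map dec gs)" using arrs_W(1)[OF gs] by (simp add: triple_simps)
  then have l': "length gs = length as" by (auto dest: list_all2_lengthD)
  have "map tgt (map dec fs) = map src (map dec gs)"
  proof (rule nth_equalityI)
    fix i assume "i < length (map tgt (map dec fs))"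
    then show "map tgt (map dec fs) ! i = map src (map dec gs) ! i"
      using arg_cong[OF st, of "\<lambda>x. x ! i"] l l' inj_enc by (simp add: cods_def doms_def triple_simps(3) inj_eq)
  qed (use l l' in simp)
  from tact_maps(4)[OF op gs fs this]
  have "cmp (tree_act (as, a, u) (map dec gs)) (tree_act (as, a, u) (map dec fs)) = tree_act (as, a, u) (map2 cmp (map dec gs) (map dec fs))" .
  moreover have "map dec (comps W as gs fs) = map2 cmp (map dec gs) (map dec fs)"
    using l l' by (auto simp: comps_def intro!: nth_equalityI)
  ultimately show "OpM W p (comps W (In triple_operad p) gs fs) =
      Comp (Cat W (Out triple_operad p)) (OpM W p gs) (OpM W p fs)"
    by (simp add: Op_W triple_simps(3))
next
  fix a x
  show "x \<in> Obj (Cat W a) \<Longrightarrow> OpO W (One triple_operad a) [x] = x"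
    "x \<in> Arr (Cat W a) \<Longrightarrow> OpM W (One triple_operad a) [x] = x"
    by (auto simp: Op_W tree_algebra.act_One)
next
  fix p qs and xss :: "'v list list"
  assume c: "composable triple_operad p qs"
  have *: "enc (tree_act (Cmp triple_operad p qs) (map dec (concat xss))) =
      enc (tree_act p (map dec (map2 (\<lambda>q xs. enc (tree_act q (map dec xs))) qs xss)))"
    if "list_all2 (\<lambda>q xs. list_all2 (\<lambda>a t. t \<in> tree_set L a) (fst q) (map dec xs)) qs xss" for L
  proof -
    have "list_all2 (\<lambda>q xs. list_all2 (\<lambda>a x. x \<in> tree_set L a) (fst q) xs) qs (map (map dec) xss)"
      using that by (simp add: list.rel_map)
    moreover have "map dec (map2 (\<lambda>q xs. enc (tree_act q (map dec xs))) qs xss) = map2 tree_act qs (map (map dec) xss)"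
      by (rule nth_equalityI) auto
    ultimately show ?thesis
      using tree_algebra.act_Cmp[OF c, of L "map (map dec) xss"] by (simp only: map_concat)
  qed
  show "OpO W (Cmp triple_operad p qs) (concat xss) = OpO W p (map2 (OpO W) qs xss)"
    if "list_all2 (\<lambda>q xs. xs \<in> objs W (In triple_operad q)) qs xss"
    unfolding Op_W by (rule *[where L = LO], rule list_all2_mono[OF that]) (use objs_W in \<open>simp add: triple_simps\<close>)
  show "OpM W (Cmp triple_operad p qs) (concat xss) = OpM W p (map2 (OpM W) qs xss)"
    if "list_all2 (\<lambda>q xs. xs \<in> arrs W (In triple_operad q)) qs xss"
    unfolding Op_W by (rule *[where L = LM], rule list_all2_mono[OF that]) (use arrs_W in \<open>simp add: triple_simps\<close>)
next
  fix p s and xs :: "'v list"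
  assume p: "p \<in> Ops triple_operad" and s: "s permutes {..<arity triple_operad p}"
  have *: "enc (tree_act (Act triple_operad p s) (map dec (permute_list s xs))) = enc (tree_act p (map dec xs))"
    if "list_all2 (\<lambda>a t. t \<in> tree_set L a) (fst p) (map dec xs)" for L
  proof -
    have "length xs = length (fst p)" using that by (auto dest: list_all2_lengthD)
    then have "map dec (permute_list s xs) = permute_list s (map dec xs)"
      using s by (simp add: permute_list_map arity_def triple_simps)
    then show ?thesis
      using tree_algebra.act_Act[OF _ _ that, of s] p s by (simp add: arity_def triple_simps)
  qed
  show "xs \<in> objs W (In triple_operad p) \<Longrightarrow> OpO W (Act triple_operad p s) (permute_list s xs) = OpO W p xs"
    unfolding Op_W by (rule *[where L = LO]) (use objs_W in \<open>simp add: triple_simps\<close>)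
  show "xs \<in> arrs W (In triple_operad p) \<Longrightarrow> OpM W (Act triple_operad p s) (permute_list s xs) = OpM W p xs"
    unfolding Op_W by (rule *[where L = LM]) (use arrs_W in \<open>simp add: triple_simps\<close>)
qed

end

lemma triple_substitude_simps [simp]:
  "Opd triple_substitude = triple_operad" "Base triple_substitude = discrete_cat UNIV"
  "Eta triple_substitude = One triple_operad"
  by (simp_all add: triple_substitude_def discrete_substitude_def triple_simps(1))

lemma discrete_cat_simps [simp]:
  "Obj (discrete_cat S) = S" "Arr (discrete_cat S) = S" "Dom (discrete_cat S) x = x"
  "Cod (discrete_cat S) x = x" "Id (discrete_cat S) x = x" "Comp (discrete_cat S) y x = x"
  by (simp_all add: discrete_cat_def)

lemma subst_cor_relabel: "typed (\<lambda>i. kind (f i)) a u \<Longrightarrow> subst (\<lambda>i. cor (f i)) u = relabel f u"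
  using subst_cors[of a "relabel f u"] by (simp add: subst_relabel)

lemma X_tree_tact:
  assumes "is_op (as, a, u)"
  shows "tree_act (as, a, u) (map (\<lambda>c. cor (Xl c)) as) = X_tree (as, a, u)"
proof -
  have "subst ((!) (map (\<lambda>c. cor (Xl c)) as)) u = subst (\<lambda>i. cor (Xl (as ! i))) u"
    using is_op_labels[OF assms] by (intro subst_cong) simp
  also have "\<dots> = relabel (\<lambda>i. Xl (as ! i)) u"
    using is_op_typed[OF assms] by (intro subst_cor_relabel) simp
  finally show ?thesis by (simp add: tree_act_def X_tree_def)
qed

lemma X_tree_One: "X_tree (One triple_operad a) = cor (Xl a)"
  by (simp add: X_tree_def triple_simps(5) corolla_eq cor_def)

lemma X_tree_Act:
  assumes p: "is_op (as, a, u)" and s: "s permutes {..<length as}"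
  shows "X_tree (Act triple_operad (as, a, u) s) = X_tree (as, a, u)"
proof -
  have "inv s i < length as \<and> s (inv s i) = i" if "i < length as" for i
    using permutes_in_image[OF permutes_inv[OF s], of i] permutes_inverses(1)[OF s] that by simp
  then show ?thesis
    unfolding X_tree_def triple_simps(7) fst_conv snd_conv relabel_relabel
    using is_op_labels[OF p] s by (intro relabel_cong) (simp add: permute_list_nth)
qed

text \<open>The shift of labels in a composite matches the concatenation of the inputs, so the i-th
  piece becomes the \<open>X_tree\<close> of the i-th operation. This gives the source in the
  associativity law of \<open>mu\<close>.\<close>

lemma X_tree_Cmp:
  assumes "composable triple_operad (as, a, u) qs"
  shows "X_tree (Cmp triple_operad (as, a, u) qs) = tree_act (as, a, u) (map X_tree qs)"
proof -
  note c = assms[unfolded composable_triple]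
  have q: "\<forall>q\<in>set qs. is_op q" using c by blast
  have p: "is_op (as, a, u)" using c by blast
  have lab: "set (labels u) = {..<length qs}" using is_op_labels[OF p] c by auto
  let ?f = "\<lambda>j. Xl (concat (map fst qs) ! j)"
  have "relabel ?f (subst (shifted qs) u) = subst (\<lambda>i. relabel ?f (shifted qs i)) u"
    using lab c shifted_typed(2)[OF q] by (intro relabel_subst[OF tree_of_colour_fits[OF is_op_tree[OF p]]]) auto
  also have "\<dots> = subst ((!) (map X_tree qs)) u"
  proof (rule subst_cong)
    fix i assume "i \<in> set (labels u)"
    then have i: "i < length qs" using lab by simp
    obtain bs b v where qi: "qs ! i = (bs, b, v)" by (cases "qs ! i")
    have op: "is_op (bs, b, v)" using q i qi by (metis nth_mem)
    have "relabel (\<lambda>j. ?f (offset (map (length \<circ> fst) qs) i + j)) v = relabel (\<lambda>j. Xl (bs ! j)) v"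
      using is_op_labels[OF op] offset_concat(1)[of i "map fst qs"] i qi
      by (intro relabel_cong) (simp add: comp_def)
    then show "relabel ?f (shifted qs i) = map X_tree qs ! i"
      using i qi by (simp add: shifted_def X_tree_def)
  qed
  finally show ?thesis by (simp add: X_tree_def Cmp_triple tree_act_def)
qed

lemma idt_cor: "l \<in> LO \<Longrightarrow> idt (cor l) = cor (ig l)"
  by (simp add: idt_def relabel_cor LO_facts)

lemma src_cor: "l \<in> LM \<Longrightarrow> src (cor l) = dg l"
  by (simp add: src_def subst_cor LM_facts)

lemma tgt_cor: "l \<in> LM \<Longrightarrow> tgt (cor l) = cor (cg l)"
  by (simp add: tgt_def relabel_cor LM_facts)

lemma label_in [simp]: "Xl c \<in> LO" "Kl c \<in> LO" "Kl c \<in> LM" "Xl c \<in> LX" "Ml c p \<in> LM \<longleftrightarrow> p \<in> tree_set LX c"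
  by (auto simp: LO_def LM_def LX_def)

lemma cor_in [simp]: "l \<in> L \<Longrightarrow> kind l = c \<Longrightarrow> cor l \<in> tree_set L c"
  using cor_tree_set by blast

lemma (in tree_encoding) internal_algebra_U: "internal_algebra triple_substitude W U"
proof (rule internal_algebra.intro; unfold triple_substitude_simps discrete_cat_simps)
  fix p assume "p \<in> Ops triple_operad"
  moreover obtain as a u where p: "p = (as, a, u)" by (cases p)
  ultimately have op: "is_op (as, a, u)" by (simp add: triple_simps)
  show "arrow (Cat W (Out triple_operad p)) (mu U p) (OpO W p (map (X_of U) (In triple_operad p)))
     (X_of U (Out triple_operad p))"
    using X_tree_tact[OF op] X_tree[OF op]
    by (simp add: arrow_def p triple_simps(3,4) Op_W comp_def src_cor tgt_cor)
  fix s assume "s permutes {..<arity triple_operad p}"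
  then have s: "s permutes {..<length as}" by (simp add: arity_def p triple_simps)
  obtain bs b v where q: "Act triple_operad (as, a, u) s = (bs, b, v)" by (cases "Act triple_operad (as, a, u) s")
  then have "b = a" by (simp add: triple_simps)
  then show "mu U (Act triple_operad p s) = mu U p"
    using X_tree_Act[OF op s] by (simp add: p q)
next
  fix p and qs :: "tree_op list" assume "composable triple_operad p qs"
  moreover obtain as a u where p: "p = (as, a, u)" by (cases p)
  ultimately have c: "composable triple_operad (as, a, u) qs" by simp
  then have op: "is_op (as, a, u)" "\<forall>q\<in>set qs. is_op q" "as = map (fst \<circ> snd) qs" unfolding composable_triple by blast+
  let ?m = "\<lambda>q. cor (Ml (fst (snd q)) (X_tree q))"
  let ?\<phi> = "tree_act (as, a, u) (map ?m qs)"
  have m: "?m q \<in> arr (fst (snd q)) \<and> src (?m q) = X_tree q \<and> tgt (?m q) = cor (Xl (fst (snd q)))" if "q \<in> set qs" for q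
    using op(2) that X_tree[of "fst q" "fst (snd q)" "snd (snd q)"] by (simp add: src_cor tgt_cor)
  have ar: "list_all2 (\<lambda>a t. t \<in> arr a) as (map ?m qs)"
    using m op(3) by (simp add: list_all2_conv_all_nth)
  have \<phi>: "?\<phi> \<in> arr a" by (rule tact_closed[OF op(1) ar])
  have ts: "map tgt (map ?m qs) = map (\<lambda>c. cor (Xl c)) as" "map src (map ?m qs) = map X_tree qs"
    using m op(3) by auto
  \<comment> \<open>So \<open>?\<phi>\<close> is composable with the generator of the operation
    \<open>(as, a, u)\<close>, and \<open>cmp_cor\<close> merely gives that generator a new source:
    the associativity law.\<close>
  have "tgt ?\<phi> = X_tree (as, a, u)" "src ?\<phi> = X_tree (Cmp triple_operad (as, a, u) qs)"
    unfolding tact_maps(1,2)[OF op(1) ar] ts by (rule X_tree_tact[OF op(1)], rule X_tree_Cmp[OF c, symmetric])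
  then have "cmp (cor (Ml a (X_tree (as, a, u)))) ?\<phi> = cor (Ml a (X_tree (Cmp triple_operad (as, a, u) qs)))"
    using cmp_cor[OF tree_set_wf[OF \<phi>], of "Ml a (X_tree (as, a, u))"] X_tree[OF op(1)] by simp
  moreover have d: "map dec (map (mu U) qs) = map ?m qs" by (auto simp: U_def)
  moreover have "mu U (Cmp triple_operad (as, a, u) qs) = enc (cor (Ml a (X_tree (Cmp triple_operad (as, a, u) qs))))"
    by (simp add: Cmp_triple)
  ultimately show "mu U (Cmp triple_operad p qs) = Comp (Cat W (Out triple_operad p)) (mu U p) (OpM W p (map (mu U) qs))"
    by (simp add: p triple_simps(4) Op_W d del: map_map)
next
  fix a
  show "mu U (One triple_operad a) = Id (Cat W a) (X_of U a)"
    using X_tree_One[of a] by (simp add: triple_simps(5) idt_cor)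
qed (simp_all add: arrow_def Op_W tree_algebra.act_One[of _ LO] tree_algebra.act_One[of _ LM] idt_cor src_cor tgt_cor
    cmp_cor[OF wf_cor])

section \<open>Evaluation of trees in a categorical algebra\<close>

locale cat_target = C: categorical_algebra triple_operad C
  for C :: "(colour, tree_op, 'o, 'm) cat_alg"
begin

lemma cat: "category (Cat C a)"
  using C.category by (simp add: triple_simps(1))

sublocale cat: category "Cat C a" for a by (rule cat)

sublocale O: triple_algebra "\<lambda>a. Obj (Cat C a)" "OpO C"
  by unfold_locales (use C.OpO_One C.OpO_Cmp C.OpO_Act in \<open>simp_all add: triple_simps(1-3) objs_def arity_def\<close>)

sublocale M: triple_algebra "\<lambda>a. Arr (Cat C a)" "OpM C"
  by unfold_locales (use C.OpM_One C.OpM_Cmp C.OpM_Act in \<open>simp_all add: triple_simps(1-3) arrs_def arity_def\<close>)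

lemma stdk_op:
  assumes "typed kind a t"
  shows "stdk a t \<in> Ops triple_operad" "In triple_operad (stdk a t) = map kind (labels t)"
    "Out triple_operad (stdk a t) = a"
  using is_op_std[OF assms] by (simp_all add: triple_simps(2-4) std_def)

lemma O_ev_closed:
  "typed kind a t \<Longrightarrow> (\<And>l. l \<in> set (labels t) \<Longrightarrow> \<phi> l \<in> Obj (Cat C (kind l))) \<Longrightarrow> O.ev \<phi> a t \<in> Obj (Cat C a)"
  unfolding O.ev_def using C.OpO_closed[OF stdk_op(1), of a t "map \<phi> (labels t)"]
  by (simp add: stdk_op objs_def list_all2_conv_all_nth)

lemma M_ev:
  assumes t: "typed kind a t" and \<Phi>: "\<And>l. l \<in> set (labels t) \<Longrightarrow> \<Phi> l \<in> Arr (Cat C (kind l))"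
  shows "M.ev \<Phi> a t \<in> Arr (Cat C a)"
    "Dom (Cat C a) (M.ev \<Phi> a t) = O.ev (\<lambda>l. Dom (Cat C (kind l)) (\<Phi> l)) a t"
    "Cod (Cat C a) (M.ev \<Phi> a t) = O.ev (\<lambda>l. Cod (Cat C (kind l)) (\<Phi> l)) a t"
proof -
  have "map \<Phi> (labels t) \<in> arrs C (map kind (labels t))"
    using \<Phi> by (simp add: arrs_def list_all2_conv_all_nth)
  moreover have "doms C (map kind (labels t)) (map \<Phi> (labels t)) = map (\<lambda>l. Dom (Cat C (kind l)) (\<Phi> l)) (labels t)"
    "cods C (map kind (labels t)) (map \<Phi> (labels t)) = map (\<lambda>l. Cod (Cat C (kind l)) (\<Phi> l)) (labels t)"
    by (auto simp: doms_def cods_def intro!: nth_equalityI)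
  ultimately show "M.ev \<Phi> a t \<in> Arr (Cat C a)"
    "Dom (Cat C a) (M.ev \<Phi> a t) = O.ev (\<lambda>l. Dom (Cat C (kind l)) (\<Phi> l)) a t"
    "Cod (Cat C a) (M.ev \<Phi> a t) = O.ev (\<lambda>l. Cod (Cat C (kind l)) (\<Phi> l)) a t"
    using C.OpM_arrow[OF stdk_op(1)[OF t], of "map \<Phi> (labels t)"]
    unfolding M.ev_def O.ev_def arrow_def by (simp_all add: stdk_op[OF t])
qed

lemma M_ev_Id:
  assumes t: "typed kind a t" and \<phi>: "\<And>l. l \<in> set (labels t) \<Longrightarrow> \<phi> l \<in> Obj (Cat C (kind l))"
  shows "M.ev (\<lambda>l. Id (Cat C (kind l)) (\<phi> l)) a t = Id (Cat C a) (O.ev \<phi> a t)"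
proof -
  have "map \<phi> (labels t) \<in> objs C (map kind (labels t))"
    using \<phi> by (simp add: objs_def list_all2_conv_all_nth)
  moreover have "ids C (map kind (labels t)) (map \<phi> (labels t)) = map (\<lambda>l. Id (Cat C (kind l)) (\<phi> l)) (labels t)"
    by (auto simp: ids_def intro!: nth_equalityI)
  ultimately show ?thesis
    using C.OpM_ids[OF stdk_op(1)[OF t], of "map \<phi> (labels t)"]
    unfolding M.ev_def O.ev_def by (simp add: stdk_op[OF t])
qed

text \<open>Indexed by positions and not by labels, because two vertices with the same label may
  carry different arrows, as in \<open>ev_cmp\<close>.\<close>

lemma OpM_Comp:
  assumes p: "is_op (map kind G, a, u)" and \<Phi>: "\<And>i. i < length G \<Longrightarrow>
    \<Phi> i \<in> Arr (Cat C (kind (G ! i))) \<and> \<Psi> i \<in> Arr (Cat C (kind (G ! i))) \<and>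
    Cod (Cat C (kind (G ! i))) (\<Psi> i) = Dom (Cat C (kind (G ! i))) (\<Phi> i)"
  shows "OpM C (map kind G, a, u) (map (\<lambda>i. Comp (Cat C (kind (G ! i))) (\<Phi> i) (\<Psi> i)) [0..<length G]) =
    Comp (Cat C a) (OpM C (map kind G, a, u) (map \<Phi> [0..<length G])) (OpM C (map kind G, a, u) (map \<Psi> [0..<length G]))"
proof -
  let ?f = "map \<Phi> [0..<length G]" and ?g = "map \<Psi> [0..<length G]"
  have "?f \<in> arrs C (map kind G)" "?g \<in> arrs C (map kind G)"
    using \<Phi> by (auto simp: arrs_def list_all2_conv_all_nth)
  moreover have "cods C (map kind G) ?g = doms C (map kind G) ?f"
    using \<Phi> by (auto simp: cods_def doms_def intro!: nth_equalityI)
  moreover have "comps C (map kind G) ?f ?g = map (\<lambda>i. Comp (Cat C (kind (G ! i))) (\<Phi> i) (\<Psi> i)) [0..<length G]"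
    by (auto simp: comps_def intro!: nth_equalityI)
  ultimately show ?thesis
    using C.OpM_comps[of "(map kind G, a, u)" ?g ?f] p by (simp add: triple_simps(2-4))
qed

lemma M_ev_Comp:
  assumes t: "typed kind a t" and \<Phi>: "\<And>l. l \<in> set (labels t) \<Longrightarrow>
    \<Phi> l \<in> Arr (Cat C (kind l)) \<and> \<Psi> l \<in> Arr (Cat C (kind l)) \<and> Cod (Cat C (kind l)) (\<Psi> l) = Dom (Cat C (kind l)) (\<Phi> l)"
  shows "M.ev (\<lambda>l. Comp (Cat C (kind l)) (\<Phi> l) (\<Psi> l)) a t = Comp (Cat C a) (M.ev \<Phi> a t) (M.ev \<Psi> a t)"
proof -
  have *: "map f (labels t) = map (\<lambda>i. f (labels t ! i)) [0..<length (labels t)]" for f :: "nat \<Rightarrow> 'z"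
    by (auto intro!: nth_equalityI)
  show ?thesis
    using OpM_Comp[OF is_op_std[OF t, unfolded std_def], of "\<lambda>i. \<Phi> (labels t ! i)" "\<lambda>i. \<Psi> (labels t ! i)"] \<Phi>
    unfolding M.ev_def std_def * by simp
qed

end

text \<open>Every tree is an operation applied to generators, whence uniqueness in the universal
  property.\<close>

lemma tact_cors: "typed kind a t \<Longrightarrow> tree_act (stdk a t) (map cor (labels t)) = t"
proof -
  assume t: "typed kind a t"
  have "subst cor t = subst cor (relabel ((!) (labels t)) (num 0 t))" by simp
  also have "\<dots> = subst (\<lambda>i. cor (labels t ! i)) (num 0 t)" by (rule subst_relabel)
  also have "\<dots> = subst ((!) (map cor (labels t))) (num 0 t)" by (rule subst_cong) simp
  finally show ?thesis using subst_cors[OF t] by (simp add: tree_act_def std_def)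
qed

lemma tree_set_typed: "p \<in> tree_set L c \<Longrightarrow> typed kind c p"
  by (simp add: tree_set_def)

lemma map2_map_right: "map2 f xs (map g ys) = map2 (\<lambda>x y. f x (g y)) xs ys"
  by (rule nth_equalityI) auto

section \<open>Strict morphisms and 2-cells out of the classifier\<close>

locale classifier_target = tree_encoding enc + cat_target C
  for enc :: "tree \<Rightarrow> 'v" and C :: "(colour, tree_op, 'o, 'm) cat_alg"
begin

text \<open>A strict morphism commutes with the operation that builds a tree from corollas, so it is
  the evaluation of its own values on corollas.\<close>

lemma alg_map_ev:
  assumes F: "is_alg_map triple_operad W C F"
  shows "t \<in> obj a \<Longrightarrow> MapO F a (enc t) = O.ev (\<lambda>l. MapO F (kind l) (enc (cor l))) a t"
    "t \<in> arr a \<Longrightarrow> MapM F a (enc t) = M.ev (\<lambda>l. MapM F (kind l) (enc (cor l))) a t"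
proof -
  let ?xs = "map (\<lambda>l. enc (cor l)) (labels t)"
  have *: "f (stdk a t) ?xs = enc t" if "typed kind a t" "\<And>p xs. f p xs = enc (tree_act p (map dec xs))" for f
    using tact_cors[OF that(1)] that(2) by (simp add: comp_def)
  have z: "map2 f (map kind (labels t)) ?xs = map (\<lambda>l. f (kind l) (enc (cor l))) (labels t)" for f :: "colour \<Rightarrow> 'v \<Rightarrow> 'z"
    by (auto intro!: nth_equalityI)
  show "MapO F a (enc t) = O.ev (\<lambda>l. MapO F (kind l) (enc (cor l))) a t" if t: "t \<in> obj a"
  proof -
    have ty: "typed kind a t" using t by (simp add: tree_set_def)
    have "?xs \<in> objs W (map kind (labels t))"
      using arr_labels[OF t nth_mem] by (simp add: objs_def list_all2_conv_all_nth)
    then have "MapO F a (OpO W (stdk a t) ?xs) = OpO C (stdk a t) (map2 (MapO F) (map kind (labels t)) ?xs)"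
      using F stdk_op[OF ty] unfolding is_alg_map_def by metis
    then show ?thesis using *[OF ty Op_W(1)] unfolding z O.ev_def by simp
  qed
  show "MapM F a (enc t) = M.ev (\<lambda>l. MapM F (kind l) (enc (cor l))) a t" if t: "t \<in> arr a"
  proof -
    have ty: "typed kind a t" using t by (simp add: tree_set_def)
    have "?xs \<in> arrs W (map kind (labels t))"
      using arr_labels[OF t nth_mem] by (simp add: arrs_def list_all2_conv_all_nth)
    then have "MapM F a (OpM W (stdk a t) ?xs) = OpM C (stdk a t) (map2 (MapM F) (map kind (labels t)) ?xs)"
      using F stdk_op[OF ty] unfolding is_alg_map_def by metis
    then show ?thesis using *[OF ty Op_W(2)] unfolding z M.ev_def by simp
  qed
qed

lemma two_cell_ev:
  assumes F: "is_alg_2cell triple_operad W C F G t" and x: "x \<in> obj a"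
  shows "t a (enc x) = M.ev (\<lambda>l. t (kind l) (enc (cor l))) a x"
proof -
  let ?xs = "map (\<lambda>l. enc (cor l)) (labels x)"
  have ty: "typed kind a x" using x by (simp add: tree_set_def)
  have "?xs \<in> objs W (map kind (labels x))"
    using arr_labels[OF x nth_mem] by (simp add: objs_def list_all2_conv_all_nth)
  then have "t a (OpO W (stdk a x) ?xs) = OpM C (stdk a x) (map2 t (map kind (labels x)) ?xs)"
    using F stdk_op[OF ty] unfolding is_alg_2cell_def by metis
  moreover have "OpO W (stdk a x) ?xs = enc x" using tact_cors[OF ty] by (simp add: Op_W comp_def)
  moreover have "map2 t (map kind (labels x)) ?xs = map (\<lambda>l. t (kind l) (enc (cor l))) (labels x)"
    by (auto intro!: nth_equalityI)
  ultimately show ?thesis unfolding M.ev_def by simp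
qed

definition gen_obj :: "(colour, tree_op, colour, 'o, 'm) int_alg \<Rightarrow> nat \<Rightarrow> 'o" where
  "gen_obj I l = (case from_nat l of GK c \<Rightarrow> K_of I c | g \<Rightarrow> X_of I (gen_colour g))"

definition gen_arr :: "(colour, tree_op, colour, 'o, 'm) int_alg \<Rightarrow> nat \<Rightarrow> 'm" where
  "gen_arr I l = (case from_nat l of GX c \<Rightarrow> Id (Cat C c) (X_of I c)
     | GK c \<Rightarrow> Id (Cat C c) (K_of I c) | GM c p \<Rightarrow> mu I (stdk c p))"

lemma gen_simps [simp]:
  "gen_obj I (Xl c) = X_of I c" "gen_obj I (Kl c) = K_of I c"
  "gen_arr I (Xl c) = Id (Cat C c) (X_of I c)" "gen_arr I (Kl c) = Id (Cat C c) (K_of I c)"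
  "gen_arr I (Ml c p) = mu I (stdk c p)"
  by (simp_all add: gen_obj_def gen_arr_def Xl_def Kl_def Ml_def)

definition induced :: "(colour, tree_op, colour, 'o, 'm) int_alg \<Rightarrow> (colour, 'v, 'v, 'o, 'm) alg_map" where
  "induced I = \<lparr>MapO = (\<lambda>a x. O.ev (gen_obj I) a (dec x)), MapM = (\<lambda>a f. M.ev (gen_arr I) a (dec f))\<rparr>"

context
  fixes I assumes I: "internal_algebra triple_substitude C I"
begin

interpretation I: internal_algebra triple_substitude C I by (rule I)

lemma gen_obj_in: "l \<in> LO \<Longrightarrow> gen_obj I l \<in> Obj (Cat C (kind l))"
  using I.X_closed I.K_closed by (auto elim!: LO_cases simp: triple_simps(1))

lemma gen_arr_arrow:
  assumes "l \<in> LM"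
  shows "gen_arr I l \<in> Arr (Cat C (kind l))" "Dom (Cat C (kind l)) (gen_arr I l) = O.ev (gen_obj I) (kind l) (dg l)"
    "Cod (Cat C (kind l)) (gen_arr I l) = gen_obj I (cg l)"
proof -
  have "arrow (Cat C (kind l)) (gen_arr I l) (O.ev (gen_obj I) (kind l) (dg l)) (gen_obj I (cg l))"
    using assms
  proof (cases rule: LM_cases)
    case (K c)
    then show ?thesis
      using O.ev_cor[of "gen_obj I" "Kl c"] I.K_closed[of c]
      by (simp add: arrow_def triple_simps(1) cat.Id_closed cat.Dom_Id cat.Cod_Id)
  next
    case (M c p)
    have "map (X_of I) (map kind (labels p)) = map (gen_obj I) (labels p)"
      using M by (auto simp: tree_set_def LX_def)
    then show ?thesis
      using I.mu_arrow[of "stdk c p"] M stdk_op[OF tree_set_typed[OF M(2)]]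
      by (simp add: O.ev_def del: map_map)
  qed
  then show "gen_arr I l \<in> Arr (Cat C (kind l))" "Dom (Cat C (kind l)) (gen_arr I l) = O.ev (gen_obj I) (kind l) (dg l)"
    "Cod (Cat C (kind l)) (gen_arr I l) = gen_obj I (cg l)"
    by (auto simp: arrow_def)
qed

lemma gen_arr_ig: "l \<in> LO \<Longrightarrow> gen_arr I (ig l) = Id (Cat C (kind l)) (gen_obj I l)"
  using I.mu_One std_cor[of "Xl _"] by (auto elim!: LO_cases simp: triple_simps(1))

lemma mu_X_tree: "is_op (as, a, u) \<Longrightarrow> mu I (stdk a (X_tree (as, a, u))) = mu I (as, a, u)"
proof -
  assume op: "is_op (as, a, u)"
  show ?thesis
  proof (rule X_tree_std_Act[OF op])
    fix s assume s: "s permutes {..<length as}" "stdk a (X_tree (as, a, u)) = Act triple_operad (as, a, u) s"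
    show ?thesis using I.mu_Act[of "(as, a, u)" s] s op by (simp add: triple_simps(2,3) arity_def)
  qed
qed

lemma ev_arrow:
  assumes "f \<in> arr a"
  shows "M.ev (gen_arr I) a f \<in> Arr (Cat C a)"
    "Dom (Cat C a) (M.ev (gen_arr I) a f) = O.ev (gen_obj I) a (src f)"
    "Cod (Cat C a) (M.ev (gen_arr I) a f) = O.ev (gen_obj I) a (tgt f)"
proof -
  have t: "typed kind a f" and l: "\<And>l. l \<in> set (labels f) \<Longrightarrow> l \<in> LM"
    using assms by (auto simp: tree_set_def)
  note M = M_ev[OF t gen_arr_arrow(1)[OF l]]
  show "M.ev (gen_arr I) a f \<in> Arr (Cat C a)" by (rule M(1))
  have "O.ev (gen_obj I) a (src f) = O.ev (\<lambda>l. O.ev (gen_obj I) (kind l) (dg l)) a f"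
    unfolding src_def
  proof (rule O.ev_subst_tree[OF t])
    fix k assume k: "k \<in> set (labels f)"
    show "typed kind (kind k) (dg k)" using LM_facts(1)[OF l[OF k]] by (simp add: tree_set_def)
    show "gen_obj I m \<in> Obj (Cat C (kind m))" if "m \<in> set (labels (dg k))" for m
      using gen_obj_in arr_labels[OF LM_facts(1)[OF l[OF k]] that] by blast
  qed
  also have "\<dots> = O.ev (\<lambda>l. Dom (Cat C (kind l)) (gen_arr I l)) a f"
    by (rule O.ev_cong) (simp add: gen_arr_arrow(2) l)
  finally show "Dom (Cat C a) (M.ev (gen_arr I) a f) = O.ev (gen_obj I) a (src f)" using M(2) by simp
  have "O.ev (gen_obj I) a (tgt f) = O.ev (\<lambda>l. gen_obj I (cg l)) a f"
    unfolding tgt_def by (rule O.ev_relabel) (simp add: LM_facts l)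
  also have "\<dots> = O.ev (\<lambda>l. Cod (Cat C (kind l)) (gen_arr I l)) a f"
    by (rule O.ev_cong) (simp add: gen_arr_arrow(3) l)
  finally show "Cod (Cat C a) (M.ev (gen_arr I) a f) = O.ev (gen_obj I) a (tgt f)" using M(3) by simp
qed

lemma ev_idt:
  assumes "x \<in> obj a" shows "M.ev (gen_arr I) a (idt x) = Id (Cat C a) (O.ev (gen_obj I) a x)"
proof -
  have t: "typed kind a x" and l: "\<And>l. l \<in> set (labels x) \<Longrightarrow> l \<in> LO"
    using assms by (auto simp: tree_set_def)
  have "M.ev (gen_arr I) a (idt x) = M.ev (\<lambda>l. gen_arr I (ig l)) a x"
    unfolding idt_def by (rule M.ev_relabel) (simp add: LO_facts l)
  also have "\<dots> = M.ev (\<lambda>l. Id (Cat C (kind l)) (gen_obj I l)) a x"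
    by (rule M.ev_cong) (simp add: gen_arr_ig l)
  finally show ?thesis using M_ev_Id[OF t] gen_obj_in l by simp
qed

text \<open>Composition over a single vertex; here the associativity axiom of the internal algebra
  enters. In the \<open>M\<close> case all labels of \<open>\<phi>\<close> are generators
  \<open>M\<close>, so \<open>src \<phi>\<close> is named by the operadic composite of the operation
  of \<open>q\<close> with the operations in these labels.\<close>

lemma gen_arr_cl:
  assumes "l \<in> LM" "\<phi> \<in> arr (kind l)" "tgt \<phi> = dg l"
  shows "gen_arr I (cl l (src \<phi>)) = Comp (Cat C (kind l)) (gen_arr I l) (M.ev (gen_arr I) (kind l) \<phi>)"
  using assms(1)
proof (cases rule: LM_cases)
  case (K c)
  then have \<phi>: "\<phi> = cor (Kl c)" using tgt_eq_cor_Kl assms tree_set_wf by simp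
  have x: "K_of I c \<in> Obj (Cat C c)" using I.K_closed by (simp add: triple_simps(1))
  then have "M.ev (gen_arr I) c (cor (Kl c)) = Id (Cat C c) (K_of I c)"
    using M.ev_cor[of "gen_arr I" "Kl c"] by (simp add: cat.Id_closed)
  then show ?thesis
    using K \<phi> x cat.Comp_Id_left[OF cat.Id_closed[OF x]] by (simp add: cat.Cod_Id)
next
  case (M c q)
  have \<phi>: "relabel cg \<phi> = q" "\<phi> \<in> arr c" using M assms by (simp_all add: tgt_def)
  have t: "typed kind c \<phi>" and l: "\<And>l. l \<in> set (labels \<phi>) \<Longrightarrow> l \<in> LM" 
    using \<phi>(2) by (auto simp: tree_set_def)
  have m: "\<exists>d p. k = Ml d p \<and> p \<in> tree_set LX d" if "k \<in> set (labels \<phi>)" for k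
  proof -
    have "cg k \<in> LX" using that \<phi>(1) M(2) by (auto simp: tree_set_def)
    then show ?thesis using l[OF that] by (auto elim!: LM_cases simp: LX_def)
  qed
  let ?ds = "map dg (labels \<phi>)"
  have std: "stdk c \<phi> = stdk c q" using std_relabel[of \<phi> cg c] LM_facts(2) l \<phi>(1) by simp
  have ds: "list_all2 (typed kind) (map kind (labels \<phi>)) ?ds"
    using LM_facts(1)[OF l] by (simp add: list_all2_conv_all_nth tree_set_def)
  have op: "is_op (map kind (labels \<phi>), c, num 0 \<phi>)" using is_op_std[OF t] by (simp add: std_def)
  show ?thesis
  proof (rule Cmp_std[OF op ds])
    let ?p = "(map kind (labels \<phi>), c, num 0 \<phi>)" and ?G = "concat (map labels ?ds)"
    let ?qs = "map2 stdk (map kind (labels \<phi>)) ?ds"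
    fix v assume v: "composable triple_operad ?p ?qs" "Cmp triple_operad ?p ?qs = (map kind ?G, c, v)"
      "is_op (map kind ?G, c, v)" "relabel ((!) ?G) v = subst ((!) ?ds) (num 0 \<phi>)"
    have p: "?p = stdk c q" using std by (simp add: std_def)
    have "src \<phi> = subst dg (relabel ((!) (labels \<phi>)) (num 0 \<phi>))" by (simp add: src_def)
    also have "\<dots> = subst (\<lambda>i. dg (labels \<phi> ! i)) (num 0 \<phi>)" by (rule subst_relabel)
    also have "\<dots> = subst ((!) ?ds) (num 0 \<phi>)" by (rule subst_cong) simp
    finally have src: "relabel ((!) ?G) v = src \<phi>" using v(4) by simp
    \<comment> \<open>The composite may number the vertices otherwise than in preorder;
      \<open>mu_Act\<close> removes the difference.\<close>
    have "mu I (stdk c (src \<phi>)) = mu I (Cmp triple_operad ?p ?qs)"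
    proof (rule std_Act[OF v(3)], unfold src v(2))
      fix s assume s: "s permutes {..<length ?G}" "stdk c (src \<phi>) = Act triple_operad (map kind ?G, c, v) s"
      then show "mu I (stdk c (src \<phi>)) = mu I (map kind ?G, c, v)"
        using I.mu_Act[of "(map kind ?G, c, v)" s] v(3) by (simp add: triple_simps(2,3) arity_def del: length_concat)
    qed
    also have "\<dots> = Comp (Cat C c) (mu I ?p) (OpM C ?p (map (mu I) ?qs))"
      using I.mu_Cmp[of ?p ?qs] v(1) by (simp add: triple_simps(4))
    also have "map (mu I) ?qs = map (gen_arr I) (labels \<phi>)"
      using m by (intro nth_equalityI) (fastforce dest: nth_mem)+
    finally show ?thesis using M p std by (simp add: M.ev_def)
  qed
qed

text \<open>Both arrows are written over the preorder tree of \<open>g\<close>: \<open>g\<close> by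
  its generators, \<open>f\<close> by the pieces \<open>\<phi> i\<close> lying over them. Then
  \<open>gen_arr_cl\<close> applies at each vertex, and functoriality of one operation of
  \<open>C\<close> recombines the results.\<close>

lemma ev_cmp:
  assumes f: "f \<in> arr a" and g: "g \<in> arr a" and fg: "tgt f = src g"
  shows "M.ev (gen_arr I) a (cmp g f) = Comp (Cat C a) (M.ev (gen_arr I) a g) (M.ev (gen_arr I) a f)"
proof -
  let ?G = "labels g" and ?u = "num 0 g"
  let ?n = "length ?G"
  have t: "typed kind a g" and G: "\<And>i. i < ?n \<Longrightarrow> ?G ! i \<in> LM"
    using g by (auto simp: tree_set_def)
  have op: "is_op (map kind ?G, a, ?u)" using is_op_std[OF t] by (simp add: std_def)
  have fit: "fits (\<lambda>i. width (map kind ?G ! i)) ?u" by (rule tree_of_colour_fits[OF is_op_tree[OF op]])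
  have lab: "set (labels ?u) = {..<?n}" by auto
  have gu: "subst (s \<circ> (!) ?G) ?u = subst s g" for s
    using subst_relabel[of s "(!) ?G" ?u] by (simp add: comp_def)
  have "relabel cg f = subst (dg \<circ> (!) ?G) ?u" using fg gu[of dg] by (simp add: tgt_def src_def)
  then obtain \<phi> where \<phi>: "f = subst \<phi> ?u" "\<And>i. i < ?n \<Longrightarrow> tgt (\<phi> i) = dg (?G ! i) \<and> wf_tree LM (\<phi> i)"
    using subst_decomp[of cg f "dg \<circ> (!) ?G" ?u, OF _ _ fit _ tree_set_wf[OF f]] G
    by (auto simp: LM_facts tgt_def)
  have \<phi>a: "\<phi> i \<in> arr (kind (?G ! i))" if "i < ?n" for i
    using arr_of_tgt[of "\<phi> i"] \<phi>(2)[OF that] LM_facts(1)[OF G[OF that]] by simp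
  have g': "g = subst (cor \<circ> (!) ?G) ?u" using gu[of cor] subst_cors[OF t] by simp
  have "cmp (subst (cor \<circ> (!) ?G) ?u) (subst \<phi> ?u) = subst (\<lambda>i. cmp ((cor \<circ> (!) ?G) i) (\<phi> i)) ?u"
    using G \<phi>(2) lab by (intro cmp_subst[OF fit]) (auto simp: wf_cor src_cor)
  also have "\<dots> = subst ((!) (map (\<lambda>i. cor (cl (?G ! i) (src (\<phi> i)))) [0..<?n])) ?u"
    using G \<phi>(2) lab by (intro subst_cong) (auto simp: cmp_cor)
  finally have "cmp g f = subst ((!) (map (\<lambda>i. cor (cl (?G ! i) (src (\<phi> i)))) [0..<?n])) ?u"
    using g' \<phi>(1) by simp
  moreover have cl: "cl (?G ! i) (src (\<phi> i)) \<in> LM \<and> kind (cl (?G ! i) (src (\<phi> i))) = kind (?G ! i)" if "i < ?n" for i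
    using cl_src(1,3)[of "?G ! i" "\<phi> i"] G[OF that] \<phi>(2)[OF that] by simp
  moreover have "M.ev (gen_arr I) a (subst ((!) (map (\<lambda>i. cor (cl (?G ! i) (src (\<phi> i)))) [0..<?n])) ?u) =
      OpM C (map kind ?G, a, ?u)
        (map2 (M.ev (gen_arr I)) (map kind ?G) (map (\<lambda>i. cor (cl (?G ! i) (src (\<phi> i)))) [0..<?n]))"
  proof (rule M.ev_subst[OF op])
    have "typed kind (kind (?G ! i)) (cor (cl (?G ! i) (src (\<phi> i))))" if "i < ?n" for i
      using typed_cor[of "cl (?G ! i) (src (\<phi> i))"] cl[OF that] by simp
    then show "list_all2 (typed kind) (map kind ?G) (map (\<lambda>i. cor (cl (?G ! i) (src (\<phi> i)))) [0..<?n])"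
      by (simp add: list_all2_conv_all_nth)
    have "gen_arr I (cl (?G ! i) (src (\<phi> i))) \<in> Arr (Cat C (kind (cl (?G ! i) (src (\<phi> i)))))" if "i < ?n" for i
      using gen_arr_arrow(1) cl[OF that] by blast
    then show "gen_arr I l \<in> Arr (Cat C (kind l))"
      if "d \<in> set (map (\<lambda>i. cor (cl (?G ! i) (src (\<phi> i)))) [0..<?n])" "l \<in> set (labels d)" for d l
      using that by (auto simp del: Cat_W)
  qed
  ultimately have "M.ev (gen_arr I) a (cmp g f) = OpM C (map kind ?G, a, ?u)
      (map2 (M.ev (gen_arr I)) (map kind ?G) (map (\<lambda>i. cor (cl (?G ! i) (src (\<phi> i)))) [0..<?n]))"
    by simp
  also have "map2 (M.ev (gen_arr I)) (map kind ?G) (map (\<lambda>i. cor (cl (?G ! i) (src (\<phi> i)))) [0..<?n]) =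
      map (\<lambda>i. Comp (Cat C (kind (?G ! i))) (gen_arr I (?G ! i)) (M.ev (gen_arr I) (kind (?G ! i)) (\<phi> i))) [0..<?n]"
  proof (rule nth_equalityI)
    fix i assume "i < length (map2 (M.ev (gen_arr I)) (map kind ?G) (map (\<lambda>i. cor (cl (?G ! i) (src (\<phi> i)))) [0..<?n]))"
    then have i: "i < ?n" by simp
    have "M.ev (gen_arr I) (kind (?G ! i)) (cor (cl (?G ! i) (src (\<phi> i)))) = gen_arr I (cl (?G ! i) (src (\<phi> i)))"
      using M.ev_cor[of "gen_arr I", OF gen_arr_arrow(1)] cl[OF i] by metis
    also have "\<dots> = Comp (Cat C (kind (?G ! i))) (gen_arr I (?G ! i)) (M.ev (gen_arr I) (kind (?G ! i)) (\<phi> i))"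
      using G[OF i] \<phi>a[OF i] \<phi>(2)[OF i] by (intro gen_arr_cl) auto
    finally show "map2 (M.ev (gen_arr I)) (map kind ?G) (map (\<lambda>i. cor (cl (?G ! i) (src (\<phi> i)))) [0..<?n]) ! i =
      map (\<lambda>i. Comp (Cat C (kind (?G ! i))) (gen_arr I (?G ! i)) (M.ev (gen_arr I) (kind (?G ! i)) (\<phi> i))) [0..<?n] ! i"
      using i by simp
  qed simp
  also have "OpM C (map kind ?G, a, ?u) \<dots> = Comp (Cat C a)
      (OpM C (map kind ?G, a, ?u) (map (\<lambda>i. gen_arr I (?G ! i)) [0..<?n]))
      (OpM C (map kind ?G, a, ?u) (map (\<lambda>i. M.ev (gen_arr I) (kind (?G ! i)) (\<phi> i)) [0..<?n]))"
    using G \<phi>a ev_arrow \<phi>(2) gen_arr_arrow by (intro OpM_Comp[OF op]) auto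
  also have "OpM C (map kind ?G, a, ?u) (map (\<lambda>i. gen_arr I (?G ! i)) [0..<?n]) = M.ev (gen_arr I) a g"
  proof -
    have "map (\<lambda>i. gen_arr I (?G ! i)) [0..<?n] = map (gen_arr I) ?G" by (auto intro!: nth_equalityI)
    then show ?thesis by (simp add: M.ev_def std_def)
  qed
  also have "OpM C (map kind ?G, a, ?u) (map (\<lambda>i. M.ev (gen_arr I) (kind (?G ! i)) (\<phi> i)) [0..<?n]) = M.ev (gen_arr I) a f"
  proof -
    have "f = subst ((!) (map \<phi> [0..<?n])) ?u" unfolding \<phi>(1) using lab by (intro subst_cong) auto
    moreover have "list_all2 (typed kind) (map kind ?G) (map \<phi> [0..<?n])"
      using \<phi>a by (simp add: list_all2_conv_all_nth tree_set_def)
    moreover have "gen_arr I l \<in> Arr (Cat C (kind l))" if "d \<in> set (map \<phi> [0..<?n])" "l \<in> set (labels d)" for d l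
      using that by (auto intro!: gen_arr_arrow(1) arr_labels[OF \<phi>a])
    ultimately have "M.ev (gen_arr I) a f = OpM C (map kind ?G, a, ?u) (map2 (M.ev (gen_arr I)) (map kind ?G) (map \<phi> [0..<?n]))"
      using M.ev_subst[OF op, of "map \<phi> [0..<?n]" "gen_arr I"] by (simp only:)
    also have "map2 (M.ev (gen_arr I)) (map kind ?G) (map \<phi> [0..<?n]) = map (\<lambda>i. M.ev (gen_arr I) (kind (?G ! i)) (\<phi> i)) [0..<?n]"
      by (auto intro!: nth_equalityI)
    finally show ?thesis by simp
  qed
  finally show ?thesis .
qed

lemma induced_alg_map: "is_alg_map triple_operad W C (induced I)"
proof -
  have "is_functor (Cat W a) (Cat C a) (MapO (induced I) a) (MapM (induced I) a)" for a
    using inj_enc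
    by (auto simp: is_functor_def induced_def arrow_def ev_idt ev_arrow ev_cmp inj_eq src_obj tgt_obj
        O_ev_closed tree_set_def gen_obj_in subset_iff)
  moreover have "MapO (induced I) (Out triple_operad p) (OpO W p xs) = OpO C p (map2 (MapO (induced I)) (In triple_operad p) xs)"
    if p: "p \<in> Ops triple_operad" and xs: "xs \<in> objs W (In triple_operad p)" for p xs
  proof -
    obtain as a u where [simp]: "p = (as, a, u)" by (cases p)
    have op: "is_op (as, a, u)" using p by (simp add: triple_simps)
    have xs: "list_all2 (\<lambda>a t. t \<in> obj a) as (map dec xs)" using objs_W(1)[OF xs] by (simp add: triple_simps)
    have "O.ev (gen_obj I) a (tree_act p (map dec xs)) = OpO C p (map2 (O.ev (gen_obj I)) as (map dec xs))"
      using O.ev_tact[OF op xs gen_obj_in] by simp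
    then show ?thesis by (simp add: induced_def Op_W triple_simps(3,4) map2_map_right)
  qed
  moreover have "MapM (induced I) (Out triple_operad p) (OpM W p xs) = OpM C p (map2 (MapM (induced I)) (In triple_operad p) xs)"
    if p: "p \<in> Ops triple_operad" and xs: "xs \<in> arrs W (In triple_operad p)" for p xs
  proof -
    obtain as a u where [simp]: "p = (as, a, u)" by (cases p)
    have op: "is_op (as, a, u)" using p by (simp add: triple_simps)
    have xs: "list_all2 (\<lambda>a t. t \<in> arr a) as (map dec xs)" using arrs_W(1)[OF xs] by (simp add: triple_simps)
    have "M.ev (gen_arr I) a (tree_act p (map dec xs)) = OpM C p (map2 (M.ev (gen_arr I)) as (map dec xs))"
      using M.ev_tact[OF op xs gen_arr_arrow(1)] by simp
    then show ?thesis by (simp add: induced_def Op_W triple_simps(3,4) map2_map_right)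
  qed
  ultimately show ?thesis by (simp add: is_alg_map_def)
qed

lemma induced_push: "int_alg_eq triple_substitude (push triple_substitude (induced I) U) I"
proof -
  have X: "O.ev (gen_obj I) c (cor (Xl c)) = X_of I c" "O.ev (gen_obj I) c (cor (Kl c)) = K_of I c" for c
    using O.ev_cor[of "gen_obj I" "Xl c"] O.ev_cor[of "gen_obj I" "Kl c"] gen_obj_in[of "Xl c"] gen_obj_in[of "Kl c"]
    by simp_all
  have M: "M.ev (gen_arr I) a (cor (Ml a (X_tree (as, a, u)))) = mu I (as, a, u)" if "is_op (as, a, u)" for as a u
    using M.ev_cor[of "gen_arr I" "Ml a (X_tree (as, a, u))"] gen_arr_arrow(1)[OF Ml_X_tree[OF that]] mu_X_tree[OF that]
    by simp
  \<comment> \<open>As the base is discrete, \<open>kappa_Id\<close> forces every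
    \<open>kappa I c\<close> to be an identity.\<close>
  have K: "M.ev (gen_arr I) c (cor (Kl c)) = kappa I c" for c
    using M.ev_cor[of "gen_arr I" "Kl c"] gen_arr_arrow(1)[of "Kl c"] I.kappa_Id[of c] by simp
  show ?thesis
    using X M K by (auto simp: int_alg_eq_def push_def induced_def triple_simps(1,2,4))
qed

lemma induced_unique:
  assumes G: "is_alg_map triple_operad W C G" and eq: "int_alg_eq triple_substitude (push triple_substitude G U) I"
  shows "alg_map_eq triple_operad W (induced I) G"
proof -
  have XK: "MapO G c (enc (cor (Xl c))) = X_of I c" "MapO G c (enc (cor (Kl c))) = K_of I c" for c
    using eq by (auto simp: int_alg_eq_def push_def triple_simps(1))
  have m: "MapM G a (enc (cor (Ml a (X_tree (as, a, u))))) = mu I (as, a, u)" if "is_op (as, a, u)" for as a u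
  proof -
    have "\<forall>p \<in> Ops triple_operad. MapM G (Out triple_operad p) (mu U p) = mu I p"
      using eq by (simp add: int_alg_eq_def push_def)
    moreover have "(as, a, u) \<in> Ops triple_operad" using that by (simp add: triple_simps)
    ultimately have "MapM G (Out triple_operad (as, a, u)) (mu U (as, a, u)) = mu I (as, a, u)" by blast
    then show ?thesis by (simp add: triple_simps(4))
  qed
  have O: "MapO G (kind l) (enc (cor l)) = gen_obj I l" if "l \<in> LO" for l
    using that XK by (auto elim!: LO_cases)
  have M: "MapM G (kind l) (enc (cor l)) = gen_arr I l" if "l \<in> LM" for l
    using that
  proof (cases rule: LM_cases)
    case (K c)
    have "MapM G c (Id (Cat W c) (enc (cor (Kl c)))) = Id (Cat C c) (MapO G c (enc (cor (Kl c))))"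
      using G by (simp add: is_alg_map_def is_functor_def triple_simps(1))
    then show ?thesis using K XK by (simp add: idt_cor)
  next
    case (M c p)
    then show ?thesis
      using m[OF is_op_std[OF tree_set_typed[OF M(2)], unfolded std_def]] X_tree_stdk[OF M(2)] by (simp add: std_def)
  qed
  have "MapO G a (enc x) = O.ev (gen_obj I) a x" if "x \<in> obj a" for a x
    unfolding alg_map_ev(1)[OF G that] using O arr_labels[OF that] by (intro O.ev_cong) auto
  moreover have "MapM G a (enc x) = M.ev (gen_arr I) a x" if "x \<in> arr a" for a x
    unfolding alg_map_ev(2)[OF G that] using M arr_labels[OF that] by (intro M.ev_cong) auto
  ultimately show ?thesis by (auto simp: alg_map_eq_def induced_def)
qed

end

definition gen_cell :: "(colour \<Rightarrow> 'm) \<Rightarrow> (colour \<Rightarrow> 'm) \<Rightarrow> nat \<Rightarrow> 'm" where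
  "gen_cell h k l = (case from_nat l of GK c \<Rightarrow> k c | g \<Rightarrow> h (gen_colour g))"

lemma gen_cell_simps [simp]: "gen_cell h k (Xl c) = h c" "gen_cell h k (Kl c) = k c"
  by (simp_all add: gen_cell_def Xl_def Kl_def)

text \<open>Naturality is checked at generating arrows, where it is the square of a morphism of
  internal algebras at \<open>mu\<close>, or an instance of the unit laws for \<open>K\<close>.
  Evaluation preserves composition and so extends it to all arrows.\<close>

lemma two_cell:
  assumes F: "is_alg_map triple_operad W C F" and G: "is_alg_map triple_operad W C G"
    and hk: "is_int_alg_mor triple_substitude C (push triple_substitude F U) (push triple_substitude G U) h k"
  defines "t \<equiv> \<lambda>a x. M.ev (gen_cell h k) a (dec x)"
  shows "is_alg_2cell triple_operad W C F G t"
    "t a (X_of U a) = h a" "t a (K_of U a) = k a"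
proof -
  let ?\<Psi> = "gen_cell h k"
  have hk1: "arrow (Cat C c) (h c) (MapO F c (enc (cor (Xl c)))) (MapO G c (enc (cor (Xl c))))"
    "arrow (Cat C c) (k c) (MapO F c (enc (cor (Kl c)))) (MapO G c (enc (cor (Kl c))))" for c
    using hk by (auto simp: is_int_alg_mor_def push_def triple_simps(1))
  have hk2: "Comp (Cat C a) (h a) (MapM F a (enc (cor (Ml a (X_tree (as, a, u)))))) =
      Comp (Cat C a) (MapM G a (enc (cor (Ml a (X_tree (as, a, u)))))) (OpM C (as, a, u) (map h as))"
    if "is_op (as, a, u)" for as a u
  proof -
    have "(as, a, u) \<in> Ops triple_operad" using that by (simp add: triple_simps)
    then have "Comp (Cat C a) (h a) (MapM F a (mu U (as, a, u))) =
        Comp (Cat C a) (MapM G a (mu U (as, a, u))) (OpM C (as, a, u) (map h as))"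
      using hk by (fastforce simp: is_int_alg_mor_def push_def triple_simps(3,4) simp del: U_simps(3))
    then show ?thesis by simp
  qed
  have \<Psi>: "arrow (Cat C (kind l)) (?\<Psi> l) (MapO F (kind l) (enc (cor l))) (MapO G (kind l) (enc (cor l)))" if "l \<in> LO" for l
    using that hk1 by (auto elim!: LO_cases)
  have ev: "arrow (Cat C a) (M.ev ?\<Psi> a x) (MapO F a (enc x)) (MapO G a (enc x))" if x: "x \<in> obj a" for a x
  proof -
    have ty: "typed kind a x" using x by (simp add: tree_set_def)
    have l: "l \<in> LO" if "l \<in> set (labels x)" for l using arr_labels[OF x that] .
    note M = M_ev[of a x ?\<Psi>, OF ty]
    show ?thesis
      unfolding alg_map_ev(1)[OF F x] alg_map_ev(1)[OF G x] arrow_def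
      using M \<Psi>[OF l] by (auto simp: arrow_def intro!: O.ev_cong)
  qed
  show "t a (X_of U a) = h a" "t a (K_of U a) = k a"
    using M.ev_cor[of ?\<Psi> "Xl a"] M.ev_cor[of ?\<Psi> "Kl a"] hk1[of a] by (auto simp: t_def arrow_def)
  have fnc: "is_functor (Cat W a) (Cat C a) (MapO F a) (MapM F a)" "is_functor (Cat W a) (Cat C a) (MapO G a) (MapM G a)" for a
    using F G by (auto simp: is_alg_map_def triple_simps(1))
  have gen: "Comp (Cat C (kind l)) (?\<Psi> (cg l)) (MapM F (kind l) (enc (cor l))) =
      Comp (Cat C (kind l)) (MapM G (kind l) (enc (cor l))) (M.ev ?\<Psi> (kind l) (dg l))" if "l \<in> LM" for l
    using that
  proof (cases rule: LM_cases)
    case (K c)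
    have "MapM H c (Id (Cat W c) (enc (cor (Kl c)))) = Id (Cat C c) (MapO H c (enc (cor (Kl c))))"
      if "is_functor (Cat W c) (Cat C c) (MapO H c) (MapM H c)" for H
      using that by (simp add: is_functor_def)
    from this[OF fnc(1)] this[OF fnc(2)]
    have "MapM F c (enc (cor (Kl c))) = Id (Cat C c) (MapO F c (enc (cor (Kl c))))"
      "MapM G c (enc (cor (Kl c))) = Id (Cat C c) (MapO G c (enc (cor (Kl c))))"
      by (simp_all add: idt_cor)
    moreover have "M.ev ?\<Psi> c (cor (Kl c)) = k c"
      using M.ev_cor[of ?\<Psi> "Kl c"] hk1[of c] by (auto simp: arrow_def)
    ultimately show ?thesis
      using K hk1(2)[of c] cat.Comp_Id_left[of "k c" c] cat.Comp_Id_right[of "k c" c] by (auto simp: arrow_def)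
  next
    case (M c p)
    have "map h (map kind (labels p)) = map ?\<Psi> (labels p)"
      using M by (auto simp: tree_set_def LX_def)
    then show ?thesis
      using hk2[OF is_op_std[OF tree_set_typed[OF M(2)], unfolded std_def]] X_tree_stdk[OF M(2)] M
      by (simp add: std_def M.ev_def del: map_map)
  qed
  have nat: "Comp (Cat C a) (M.ev ?\<Psi> a (tgt f)) (MapM F a (enc f)) =
      Comp (Cat C a) (MapM G a (enc f)) (M.ev ?\<Psi> a (src f))" if f: "f \<in> arr a" for a f
  proof -
    have ty: "typed kind a f" using f by (simp add: tree_set_def)
    have l: "l \<in> LM" if "l \<in> set (labels f)" for l using arr_labels[OF f that] .
    have FG: "arrow (Cat C (kind l)) (MapM H (kind l) (enc (cor l))) (MapO H (kind l) (enc (dg l))) (MapO H (kind l) (enc (cor (cg l))))"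
      if H: "is_functor (Cat W (kind l)) (Cat C (kind l)) (MapO H (kind l)) (MapM H (kind l))" and "l \<in> LM" for l H
    proof -
      have "cor l \<in> arr (kind l)" using that by simp
      then show ?thesis using H src_cor[OF that(2)] tgt_cor[OF that(2)] by (auto simp: is_functor_def)
    qed
    have d: "arrow (Cat C (kind l)) (M.ev ?\<Psi> (kind l) (dg l)) (MapO F (kind l) (enc (dg l))) (MapO G (kind l) (enc (dg l)))"
      "arrow (Cat C (kind l)) (?\<Psi> (cg l)) (MapO F (kind l) (enc (cor (cg l)))) (MapO G (kind l) (enc (cor (cg l))))"
      if "l \<in> LM" for l
      using ev[OF LM_facts(1)[OF that]] \<Psi>[OF LM_facts(3)[OF that]] LM_facts(2)[OF that] by simp_all
    have "M.ev ?\<Psi> a (tgt f) = M.ev (\<lambda>l. ?\<Psi> (cg l)) a f"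
      unfolding tgt_def by (rule M.ev_relabel) (simp add: LM_facts l)
    then have "Comp (Cat C a) (M.ev ?\<Psi> a (tgt f)) (MapM F a (enc f)) =
        M.ev (\<lambda>l. Comp (Cat C (kind l)) (?\<Psi> (cg l)) (MapM F (kind l) (enc (cor l)))) a f"
      unfolding alg_map_ev(2)[OF F f] using FG[OF fnc(1) l] d(2)[OF l]
      by (subst M_ev_Comp[OF ty]) (auto simp: arrow_def)
    also have "\<dots> = M.ev (\<lambda>l. Comp (Cat C (kind l)) (MapM G (kind l) (enc (cor l))) (M.ev ?\<Psi> (kind l) (dg l))) a f"
      by (rule M.ev_cong) (rule gen[OF l])
    also have "\<dots> = Comp (Cat C a) (MapM G a (enc f)) (M.ev (\<lambda>l. M.ev ?\<Psi> (kind l) (dg l)) a f)"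
      unfolding alg_map_ev(2)[OF G f] using FG[OF fnc(2) l] d(1)[OF l]
      by (subst M_ev_Comp[OF ty]) (auto simp: arrow_def)
    also have "M.ev (\<lambda>l. M.ev ?\<Psi> (kind l) (dg l)) a f = M.ev ?\<Psi> a (src f)"
      unfolding src_def
    proof (rule M.ev_subst_tree[OF ty, symmetric])
      fix j assume j: "j \<in> set (labels f)"
      show "typed kind (kind j) (dg j)" using LM_facts(1)[OF l[OF j]] by (simp add: tree_set_def)
      show "?\<Psi> m \<in> Arr (Cat C (kind m))" if "m \<in> set (labels (dg j))" for m
        using \<Psi>[OF arr_labels[OF LM_facts(1)[OF l[OF j]] that]] by (simp add: arrow_def)
    qed
    finally show ?thesis .
  qed
  have "is_nat_trans (Cat W a) (Cat C a) (MapO F a) (MapM F a) (MapO G a) (MapM G a) (t a)" for a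
    using ev nat by (auto simp: is_nat_trans_def t_def)
  moreover have "t (Out triple_operad p) (OpO W p xs) = OpM C p (map2 t (In triple_operad p) xs)"
    if p: "p \<in> Ops triple_operad" and xs: "xs \<in> objs W (In triple_operad p)" for p xs
  proof -
    obtain as a u where [simp]: "p = (as, a, u)" by (cases p)
    have op: "is_op (as, a, u)" using p by (simp add: triple_simps)
    have xs: "list_all2 (\<lambda>a t. t \<in> obj a) as (map dec xs)" using objs_W(1)[OF xs] by (simp add: triple_simps)
    have "M.ev ?\<Psi> a (tree_act p (map dec xs)) = OpM C p (map2 (M.ev ?\<Psi>) as (map dec xs))"
      using M.ev_tact[OF op xs, of ?\<Psi>] \<Psi> by (simp add: arrow_def)
    then show ?thesis by (simp add: t_def Op_W triple_simps(3,4) map2_map_right)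
  qed
  ultimately show "is_alg_2cell triple_operad W C F G t" by (simp add: is_alg_2cell_def)
qed

lemma two_cell_unique:
  assumes "is_alg_2cell triple_operad W C F G t" "is_alg_2cell triple_operad W C F G t'"
    and "\<And>c. t c (X_of U c) = t' c (X_of U c)" "\<And>c. t c (K_of U c) = t' c (K_of U c)"
    and "x \<in> Obj (Cat W a)"
  shows "t a x = t' a x"
proof -
  obtain y where y: "x = enc y" "y \<in> obj a" using assms(5) by auto
  have "t (kind l) (enc (cor l)) = t' (kind l) (enc (cor l))" if "l \<in> LO" for l
    using that assms(3,4) by (auto elim!: LO_cases)
  then show ?thesis
    unfolding y(1) two_cell_ev[OF assms(1) y(2)] two_cell_ev[OF assms(2) y(2)]
    using arr_labels[OF y(2)] by (intro M.ev_cong) auto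
qed

end

theorem (in tree_encoding) is_classifier_W: "is_classifier triple_substitude W U"
proof -
  have 1: "\<exists>F. is_alg_map triple_operad W C F \<and> int_alg_eq triple_substitude (push triple_substitude F U) I \<and>
      (\<forall>G. is_alg_map triple_operad W C G \<and> int_alg_eq triple_substitude (push triple_substitude G U) I \<longrightarrow>
        alg_map_eq triple_operad W F G)"
    if C: "categorical_algebra triple_operad C" and I: "internal_algebra triple_substitude C I"
    for C :: "(colour, tree_op, 'v, 'v) cat_alg" and I
  proof -
    interpret categorical_algebra triple_operad C by (rule C)
    interpret classifier_target enc C by unfold_locales
    show ?thesis using induced_alg_map[OF I] induced_push[OF I] induced_unique[OF I] by blast
  qed
  have 2: "\<exists>t. is_alg_2cell triple_operad W C F G t \<and>
        (\<forall>a. t a (X_of U a) = h a \<and> t a (K_of U a) = k a) \<and>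
        (\<forall>t'. is_alg_2cell triple_operad W C F G t' \<and>
            (\<forall>a. t' a (X_of U a) = h a \<and> t' a (K_of U a) = k a) \<longrightarrow>
          (\<forall>a. \<forall>x \<in> Obj (Cat W a). t' a x = t a x))"
    if C: "categorical_algebra triple_operad C" and F: "is_alg_map triple_operad W C F"
      "is_alg_map triple_operad W C G"
      "is_int_alg_mor triple_substitude C (push triple_substitude F U) (push triple_substitude G U) h k"
    for C :: "(colour, tree_op, 'v, 'v) cat_alg" and F G h k
  proof -
    interpret categorical_algebra triple_operad C by (rule C)
    interpret classifier_target enc C by unfold_locales
    let ?t = "\<lambda>a x. M.ev (gen_cell h k) a (dec x)"
    note t = two_cell[OF F]
    have "t' a x = ?t a x" if t': "is_alg_2cell triple_operad W C F G t'"
      "\<forall>a. t' a (X_of U a) = h a \<and> t' a (K_of U a) = k a" and x: "x \<in> Obj (Cat W a)" for t' a x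
    proof (rule two_cell_unique[OF t'(1) t(1) _ _ x])
      show "t' c (X_of U c) = ?t c (X_of U c)" "t' c (K_of U c) = ?t c (K_of U c)" for c
        unfolding t(2) t(3) using t'(2) by blast+
    qed
    then show ?thesis using t by (intro exI[of _ ?t]) blast
  qed
  show ?thesis
    unfolding is_classifier_def triple_substitude_simps triple_simps(1)
  proof (intro conjI allI impI)
    fix C :: "(colour, tree_op, 'v, 'v) cat_alg" and I
    assume "categorical_algebra triple_operad C \<and> internal_algebra triple_substitude C I"
    then show "\<exists>F. is_alg_map triple_operad W C F \<and> int_alg_eq triple_substitude (push triple_substitude F U) I \<and>
      (\<forall>G. is_alg_map triple_operad W C G \<and> int_alg_eq triple_substitude (push triple_substitude G U) I \<longrightarrow>
        alg_map_eq triple_operad W F G)" by (intro 1) auto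
  next
    fix C :: "(colour, tree_op, 'v, 'v) cat_alg" and F G h k
    assume "categorical_algebra triple_operad C \<and> is_alg_map triple_operad W C F \<and> is_alg_map triple_operad W C G \<and>
      is_int_alg_mor triple_substitude C (push triple_substitude F U) (push triple_substitude G U) h k"
    then show "\<exists>t. is_alg_2cell triple_operad W C F G t \<and>
        (\<forall>a \<in> UNIV. t a (X_of U a) = h a \<and> t a (K_of U a) = k a) \<and>
        (\<forall>t'. is_alg_2cell triple_operad W C F G t' \<and>
            (\<forall>a \<in> UNIV. t' a (X_of U a) = h a \<and> t' a (K_of U a) = k a) \<longrightarrow>
          (\<forall>a \<in> UNIV. \<forall>x \<in> Obj (Cat W a). t' a x = t a x))"
      using 2[of C F G h k] by (simp only: ball_UNIV) 
  qed (rule categorical_algebra_W internal_algebra_U)+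
qed

section \<open>Contraction of clusters\<close>

lemma Kl_LX [simp]: "Kl c \<notin> LX" by (auto simp: LX_def)

lemma tree_set_iff: "t \<in> tree_set L a \<longleftrightarrow> typed kind a t \<and> wf_tree L t"
  by (auto simp: tree_set_def wf_tree_def dest: typed_fits)

lemma LO_K: "l \<in> LO \<Longrightarrow> l \<notin> LX \<Longrightarrow> (\<And>c. l = Kl c \<Longrightarrow> P) \<Longrightarrow> P"
  by (auto simp: LO_def LX_def)

lemma split_list_lengths:
  "length us = sum_list ns \<Longrightarrow> \<exists>uss. us = concat uss \<and> map length uss = ns"
proof (induction ns arbitrary: us)
  case (Cons n ns)
  from Cons.IH[of "drop n us"] Cons.prems obtain uss where "drop n us = concat uss" "map length uss = ns" by auto
  then show ?case
    using Cons.prems append_take_drop_id[of n us] by (intro exI[of _ "take n us # uss"]) auto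
qed simp

lemma graft_list_concat: "map length uss = map leaves ts \<Longrightarrow> graft_list ts (concat uss) = map2 graft ts uss"
proof (induction ts arbitrary: uss)
  case (Cons t ts) then show ?case by (cases uss) auto
qed simp

lemma cmps_concat: "map length gss = map length fss \<Longrightarrow> cmps (concat gss) (concat fss) = concat (map2 cmps gss fss)"
proof (induction gss arbitrary: fss)
  case (Cons gs gss) then show ?case by (cases fss) (auto simp: cmps_append)
qed simp

text \<open>The later arrow is an identity at the root, so the label \<open>l\<close> survives. In
  \<open>cmp_idt_dg\<close> it survives because the earlier arrow is an identity there.\<close>

lemma cmp_ig:
  assumes "l \<in> LM" "width (kind l) = length fs" "length gs = length fs"
  shows "cmp (Node (ig (cg l)) gs) (Node l fs) = Node l (cmps gs fs)"
proof -
  have "tgt (cor l) = dg (ig (cg l))" using assms by (simp add: tgt_cor LO_facts LM_facts)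
  moreover have "cl (ig (cg l)) (dg l) = l" using assms(1) by (auto elim!: LM_cases)
  ultimately show ?thesis
    using cmp_Node[of "cor l" "ig (cg l)" fs gs] assms
    by (simp add: graft_cor LO_facts LM_facts src_cor)
qed

lemma cmp_idt_dg:
  assumes "l \<in> LM" "width (kind l) = length fs"
  shows "cmp (Node l gs) (graft (idt (dg l)) fs) = Node l (cmps gs fs)"
  using cmp_Node[of "idt (dg l)" l fs gs] assms wf_dg[OF assms(1)]
  by (simp add: src_idt tgt_idt LM_facts)

lemma cmps_idt_left: "\<forall>f \<in> set fs. wf_tree LM f \<Longrightarrow> cmps (map idt (map tgt fs)) fs = fs"
  by (induction fs) (auto simp: cmp_idt_left)

lemma idt_idem: "wf_tree LO t \<Longrightarrow> cmp (idt t) (idt t) = idt t"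
  using cmp_idt_left[of "idt t"] by (simp add: wf_idt tgt_idt)

text \<open>One development for the colours \<open>A\<close> and \<open>B\<close>. With
  \<open>ColA\<close> it is also applied to trees of colour \<open>C\<close>, in which vertices of
  the other colours stay untouched.\<close>

locale mono_colour =
  fixes kd :: "nat \<Rightarrow> colour"
  assumes kd: "kd = ColA \<or> kd = ColB"
begin

lemma kd_simps [simp]: "kd n = kd m \<longleftrightarrow> n = m" "width (kd n) = n"
  "typed k (kd n) t \<longleftrightarrow> mono_typed kd k t \<and> leaves t = n"
  using kd by auto

fun cluster :: "tree \<Rightarrow> tree" where
  "cluster Leaf = Leaf"
| "cluster (Node l ts) = (if kind l \<in> range kd \<and> l \<in> LX then Node l (map cluster ts) else Leaf)"

text \<open>What hangs on the leaves of \<open>cluster t\<close>, in order and already contracted.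
  The expression under a \<open>K\<close>-vertex is \<open>contract t\<close> unfolded, as the
  recursion runs through it. A vertex of another colour is covered by an identity, with all that
  lies below it.\<close>

fun items :: "tree \<Rightarrow> tree list" where
  "items Leaf = [Leaf]"
| "items (Node l ts) = (if kind l \<in> range kd then
      if l \<in> LX then concat (map items ts)
      else [Node l (map (\<lambda>t. Node (Ml (kd (length (items t))) (cluster t)) (items t)) ts)]
    else [idt (Node l ts)])"

text \<open>An empty cluster yields \<open>M(kd 1, Leaf)\<close>, the unit, which inserts a unary
  \<open>X\<close>-vertex. So in a tree of colour \<open>kd\<close> the target has \<open>X\<close>-
  and \<open>K\<close>-vertices in alternation.\<close>

definition contract :: "tree \<Rightarrow> tree" where
  "contract t = Node (Ml (kd (length (items t))) (cluster t)) (items t)"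

lemma citems_K: "kind l \<in> range kd \<Longrightarrow> l \<notin> LX \<Longrightarrow> items (Node l ts) = [Node l (map contract ts)]"
  by (simp add: contract_def)

declare items.simps(2) [simp del]

lemma citems_X: "kind l \<in> range kd \<Longrightarrow> l \<in> LX \<Longrightarrow> items (Node l ts) = concat (map items ts)"
  by (simp add: items.simps(2))

lemma citems_other: "kind l \<notin> range kd \<Longrightarrow> items (Node l ts) = [idt (Node l ts)]"
  by (simp add: items.simps(2))

text \<open>The invariants that make \<open>contract t\<close> an arrow with source
  \<open>t\<close>. They are proved jointly since a \<open>K\<close>-vertex puts contracted branches
  inside the items.\<close>

lemma con_props:
  assumes "wf_tree LO t"
  shows "leaves (cluster t) = length (items t) \<and> wf_tree LX (cluster t) \<and> mono_typed kd kind (cluster t) \<and>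
    (\<forall>i \<in> set (items t). wf_tree LM i) \<and> graft (cluster t) (map src (items t)) = t"
  using assms
proof (induction t)
  case (Node l ts)
  have IH: "leaves (cluster t) = length (items t)" "wf_tree LX (cluster t)" "mono_typed kd kind (cluster t)"
    "\<forall>i \<in> set (items t). wf_tree LM i" "graft (cluster t) (map src (items t)) = t" if "t \<in> set ts" for t
    using Node.IH[OF that] Node.prems that by auto
  have contract: "wf_tree LM (contract t) \<and> src (contract t) = t" if "t \<in> set ts" for t
    using IH[OF that] by (simp add: contract_def tree_set_iff)
  consider "kind l \<in> range kd" "l \<in> LX" | "kind l \<in> range kd" "l \<notin> LX" | "kind l \<notin> range kd" by blast
  then show ?case
  proof cases
    case 1
    have "(\<Sum>t\<leftarrow>ts. leaves (cluster t)) = (\<Sum>t\<leftarrow>ts. length (items t))" using IH(1) by (simp cong: map_cong)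
    moreover have "graft_list (map cluster ts) (concat (map (map src) (map items ts))) = ts"
      using IH(1,5) by (subst graft_list_concat) (auto intro!: nth_equalityI)
    moreover have "kind l = kd (length ts)" using 1 Node.prems by auto
    ultimately show ?thesis
      using 1 IH Node.prems by (simp add: citems_X length_concat map_concat comp_def)
  next
    case 2
    then obtain c where "l = Kl c" using LO_K[of l] Node.prems by auto
    then have "l \<in> LM" "dg l = cor l" by simp_all
    moreover have "map (\<lambda>t. src (contract t)) ts = ts" using contract by (auto intro!: map_idI)
    ultimately show ?thesis
      using 2 contract Node.prems by (simp add: citems_K comp_def graft_cor)
  next
    case 3
    then show ?thesis
      using Node.prems wf_idt[OF Node.prems] src_idt[OF Node.prems] by (simp add: citems_other del: idt_simps)
  qed
qed simp

lemma ctops_citems: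
  assumes "\<forall>t \<in> set ts. wf_tree LO t"
  shows "graft_list (map cluster ts) (map src (concat (map items ts))) = ts"
    "leaves (Node l (map cluster ts)) = length (concat (map items ts))"
proof -
  note p = con_props[OF bspec[OF assms]]
  have "graft_list (map cluster ts) (concat (map (map src) (map items ts))) = ts"
    using p by (subst graft_list_concat) (auto intro!: nth_equalityI)
  then show "graft_list (map cluster ts) (map src (concat (map items ts))) = ts" by (simp only: map_concat)
  show "leaves (Node l (map cluster ts)) = length (concat (map items ts))"
    using p by (simp add: length_concat comp_def cong: map_cong)
qed

lemma wf_con: "wf_tree LO t \<Longrightarrow> wf_tree LM (contract t)"
  using con_props[of t] by (simp add: contract_def tree_set_iff)

lemma src_con: "wf_tree LO t \<Longrightarrow> src (contract t) = t"
  using con_props[of t] by (simp add: contract_def)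

lemma citems_mono: "wf_tree LO t \<Longrightarrow> mono_typed kd kind t \<Longrightarrow> \<forall>i \<in> set (items t). mono_typed kd kind i"
proof (induction t)
  case (Node l ts)
  then have l: "kind l = kd (length ts)" by simp
  show ?case
  proof (cases "l \<in> LX")
    case True
    then show ?thesis using Node l by (auto simp: citems_X)
  next
    case False
    then show ?thesis using Node l by (auto simp: citems_K contract_def)
  qed
qed simp

lemma con_mono: "wf_tree LO t \<Longrightarrow> mono_typed kd kind t \<Longrightarrow> mono_typed kd kind (contract t)"
  using citems_mono by (simp add: contract_def)

lemma con_arr: "t \<in> obj (kd n) \<Longrightarrow> contract t \<in> arr (kd n)"
proof -
  assume t: "t \<in> obj (kd n)"
  have w: "wf_tree LO t" by (rule tree_set_wf[OF t])
  then have "leaves (contract t) = leaves t" using leaves_src[OF wf_con[OF w]] src_con[OF w] by simp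
  then show ?thesis using t wf_con[OF w] con_mono[OF w] by (auto simp: tree_set_iff)
qed

text \<open>A tree \<open>q\<close> of \<open>X\<close>-vertices on top only enlarges the cluster:
  the clusters of the branches join it, and their items are concatenated.\<close>

lemma con_graft:
  "length us = leaves q \<Longrightarrow> wf_tree LX q \<Longrightarrow> mono_typed kd kind q \<Longrightarrow>
     cluster (graft q us) = graft q (map cluster us) \<and> items (graft q us) = concat (map items us)"
  "length us = sum_list (map leaves qs) \<Longrightarrow> \<forall>q \<in> set qs. wf_tree LX q \<and> mono_typed kd kind q \<Longrightarrow>
     map cluster (graft_list qs us) = graft_list qs (map cluster us) \<and>
     concat (map items (graft_list qs us)) = concat (map items us)"
proof (induction q us and qs us rule: graft_graft_list.induct)
  case (1 us) then show ?case by (cases us) auto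
next
  case (2 l qs us)
  then show ?case by (auto simp: citems_X)
next
  case (4 q qs us)
  have "concat (map items us) = concat (map items (take (leaves q) us)) @ concat (map items (drop (leaves q) us))"
    by (metis append_take_drop_id concat_append map_append)
  with 4 show ?case by (simp add: take_map drop_map)
qed simp

text \<open>The arrows along which \<open>contract\<close> is natural. As \<open>items\<close>
  covers everything from a vertex of another colour on by an identity, the arrow has to be an
  identity there as well.\<close>

fun pure :: "tree \<Rightarrow> bool" where
  "pure Leaf \<longleftrightarrow> True"
| "pure (Node l fs) \<longleftrightarrow> (if kind l \<in> range kd then \<forall>f \<in> set fs. pure f else \<exists>t. wf_tree LO t \<and> Node l fs = idt t)"

lemma mono_typed_pure: "mono_typed kd kind f \<Longrightarrow> pure f"
  by (induction f) auto

text \<open>The splitting of \<open>f\<close> from which naturality of \<open>contract\<close> is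
  read off: \<open>Q\<close> lies over the cluster of the target and \<open>F\<close> over its
  items.\<close>

definition con_split :: "tree \<Rightarrow> tree \<Rightarrow> tree list \<Rightarrow> bool" where
  "con_split f Q F \<longleftrightarrow> f = graft Q F \<and> length F = leaves Q \<and> wf_tree LM Q \<and> (\<forall>f \<in> set F. wf_tree LM f) \<and>
    tgt Q = cluster (tgt f) \<and> src Q = cluster (src f) \<and> cmps (items (tgt f)) F = items (src f)"

lemma con_split_natural:
  assumes "con_split f Q F" shows "cmp (contract (tgt f)) f = contract (src f)"
proof -
  have Q: "f = graft Q F" "length F = leaves Q" "tgt Q = cluster (tgt f)"
    "src Q = cluster (src f)" "cmps (items (tgt f)) F = items (src f)" using assms unfolding con_split_def by blast+
  have "length (items (src f)) = length (items (tgt f))" using Q(5) by (metis length_cmps)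
  moreover have "cmp (contract (tgt f)) (graft Q F) =
      Node (cl (Ml (kd (length (items (tgt f)))) (cluster (tgt f))) (src Q)) (cmps (items (tgt f)) F)"
    unfolding contract_def using Q(2,3) leaves_tgt(1)[of Q] by (intro cmp_Node) auto
  ultimately show ?thesis using Q by (simp add: contract_def)
qed

text \<open>At a \<open>K\<close>-vertex or a vertex of another colour the cluster is empty and
  \<open>Q\<close> is \<open>Leaf\<close>. At a vertex \<open>M(c, q)\<close> the splittings of the
  branches are put together, and their clusters merge with \<open>q\<close>.\<close>

lemma con_split:
  assumes "wf_tree LM f" "pure f"
  shows "\<exists>Q F. con_split f Q F"
  using assms
proof (induction f)
  case Leaf
  then show ?case by (intro exI[of _ Leaf] exI[of _ "[Leaf]"]) (simp add: con_split_def)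
next
  case (Node l fs)
  have l: "l \<in> LM" "width (kind l) = length fs" using Node.prems by auto
  have kcg: "kind (cg l) = kind l" "cg l \<in> LO" using LM_facts[OF l(1)] by auto
  show ?case
  proof (cases "kind l \<in> range kd")
    case kl: True
    have "\<exists>Q F. con_split f Q F" if "f \<in> set fs" for f
      using that Node.prems kl by (intro Node.IH) auto
    then obtain Q F where QF0: "\<And>f. f \<in> set fs \<Longrightarrow> con_split f (Q f) (F f)" by metis
    then have QF: "\<And>f. f \<in> set fs \<Longrightarrow> f = graft (Q f) (F f)" 
      "\<And>f. f \<in> set fs \<Longrightarrow> length (F f) = leaves (Q f)" "\<And>f. f \<in> set fs \<Longrightarrow> wf_tree LM (Q f)"
      "\<And>f. f \<in> set fs \<Longrightarrow> \<forall>g \<in> set (F f). wf_tree LM g" "\<And>f. f \<in> set fs \<Longrightarrow> tgt (Q f) = cluster (tgt f)"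
      "\<And>f. f \<in> set fs \<Longrightarrow> src (Q f) = cluster (src f)"
      "\<And>f. f \<in> set fs \<Longrightarrow> cmps (items (tgt f)) (F f) = items (src f)"
      unfolding con_split_def by blast+
    have len: "length (items (tgt f)) = length (F f)" if "f \<in> set fs" for f
    proof -
      have "wf_tree LO (tgt f)" using Node.prems that by (auto simp: wf_tgt)
      then show ?thesis using con_props[of "tgt f"] QF(2,5)[OF that] by (metis leaves_tgt(1))
    qed
    have contract: "cmp (contract (tgt f)) f = contract (src f)" if "f \<in> set fs" for f
      using con_split_natural[OF QF0[OF that]] .
    from l(1) show ?thesis
    proof (cases rule: LM_cases)
      case (K c)
      have "cmps (map contract (map tgt fs)) fs = map contract (map src fs)"
        using contract by (auto simp: cmps_map2 intro!: nth_equalityI)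
      then have "cmp (Node l (map contract (map tgt fs))) (Node l fs) = Node l (map contract (map src fs))"
        using cmp_Node[of "cor l" l fs "map contract (map tgt fs)"] l K by (simp add: tgt_cor src_cor graft_cor)
      then show ?thesis
        using K kl l Node.prems
        by (intro exI[of _ Leaf] exI[of _ "[Node l fs]"]) (simp add: con_split_def graft_cor citems_K)
    next
      case (M c q)
      then obtain m where c: "c = kd m" using kl by auto
      have q: "wf_tree LX q" "mono_typed kd kind q" "leaves q = length fs"
        using M c l tree_set_wf[OF M(2)] by (auto simp: tree_set_def)
      have src: "cluster (src (Node l fs)) = graft q (map cluster (map src fs))"
        "items (src (Node l fs)) = concat (map items (map src fs))"
        using con_graft(1)[of "map src fs" q] q M by simp_all
      have "map length (map F fs) = map leaves (map Q fs)" using QF(2) by simp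
      then have "graft_list (map Q fs) (concat (map F fs)) = map2 graft (map Q fs) (map F fs)"
        by (rule graft_list_concat)
      also have "\<dots> = fs" using QF(1) by (auto intro!: nth_equalityI)
      finally have "Node l fs = graft (Node l (map Q fs)) (concat (map F fs))" by simp
      moreover have "cmps (items (tgt (Node l fs))) (concat (map F fs)) = items (src (Node l fs))"
      proof -
        have tgt: "items (tgt (Node l fs)) = concat (map items (map tgt fs))"
          using M c by (simp add: citems_X)
        have "map2 cmps (map items (map tgt fs)) (map F fs) = map items (map src fs)"
          using QF(7) by (auto intro!: nth_equalityI)
        then show ?thesis unfolding src(2) tgt using len by (subst cmps_concat) auto
      qed
      moreover have "length (concat (map F fs)) = leaves (Node l (map Q fs))"
        using QF(2) by (simp add: length_concat comp_def cong: map_cong)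
      moreover have "src (Node l (map Q fs)) = cluster (src (Node l fs))"
        unfolding src using QF(6) M by (simp add: comp_def cong: map_cong)
      moreover have "tgt (Node l (map Q fs)) = cluster (tgt (Node l fs))"
        using QF(5) M c by simp
      ultimately show ?thesis
        using QF(3,4) l
        by (intro exI[of _ "Node l (map Q fs)"] exI[of _ "concat (map F fs)"]) (auto simp: con_split_def simp del: src_simps tgt_simps)
    qed
  next
    case False
    then obtain t where t: "wf_tree LO t" "Node l fs = idt t" using Node.prems by auto
    then obtain l' ts where t': "t = Node l' ts" by (cases t) auto
    then have "kind l' = kind l" using t by (simp add: LO_facts)
    then have "items t = [idt t]" "cluster t = Leaf" using False t' by (simp_all add: citems_other)
    then show ?thesis
      unfolding t(2) using t(1) idt_idem[OF t(1)]
      by (intro exI[of _ Leaf] exI[of _ "[idt t]"]) (simp add: con_split_def src_idt tgt_idt wf_idt)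
  qed
qed

text \<open>On comparing targets, \<open>tgt (contract t)\<close> is constant along pure arrows;
  this provides the normal forms.\<close>

lemma con_natural: "wf_tree LM f \<Longrightarrow> pure f \<Longrightarrow> cmp (contract (tgt f)) f = contract (src f)"
  using con_split con_split_natural by blast

end

interpretation A: mono_colour ColA by standard simp
interpretation B: mono_colour ColB by standard simp

section \<open>Absorption and spreading in colour \<open>C\<close>\<close>

lemma mono_typed_idt: "wf_tree LO t \<Longrightarrow> mono_typed mk kind (idt t) = mono_typed mk kind t"
  unfolding idt_def mono_typed_relabel by (rule mono_typed_cong) (auto simp: wf_tree_def LO_facts)

lemma bimod_typed_idt: "wf_tree LO t \<Longrightarrow> bimod_typed kind (idt t) = bimod_typed kind t"
  unfolding idt_def bimod_typed_relabel by (rule bimod_typed_cong) (auto simp: wf_tree_def LO_facts)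

lemma bimod_typed_tgt: "wf_tree LM t \<Longrightarrow> bimod_typed kind (tgt t) = bimod_typed kind t"
  unfolding tgt_def bimod_typed_relabel by (rule bimod_typed_cong) (auto simp: wf_tree_def LM_facts)

lemma bimod_arr: "wf_tree LM f \<Longrightarrow> bimod_typed kind f \<Longrightarrow> f \<in> arr (ColC (leaves f))"
  by (simp add: tree_set_iff)

lemma bimod_typed_src: "wf_tree LM f \<Longrightarrow> bimod_typed kind f \<Longrightarrow> bimod_typed kind (src f)"
  using src_obj[OF bimod_arr] by (simp add: tree_set_def)

abbreviation XC1 :: tree where "XC1 \<equiv> Node (Xl (ColC (Suc 0))) [Leaf]"

text \<open>\<open>absorb t\<close> absorbs the \<open>B\<close>-vertices marked \<open>X\<close> into the \<open>C\<close>-vertices marked \<open>X\<close> above them.\<close>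

fun absorb :: "tree \<Rightarrow> tree" where
  "absorb Leaf = Leaf"
| "absorb (Node l ts) = (if kind l \<in> range ColC then
      if l \<in> LX then Node (Ml (ColC (length (concat (map B.items ts)))) (Node l (map B.cluster ts))) (concat (map B.items ts))
      else Node l (map B.contract ts)
    else Node (ig l) (map absorb ts))"

text \<open>The target of \<open>spread t\<close> is \<open>t\<close>; its source has \<open>XA(n)(XC(1), \<dots>, XC(1))\<close> in place of each \<open>XC(n)\<close>.\<close>

fun spread :: "tree \<Rightarrow> tree" where
  "spread Leaf = Leaf"
| "spread (Node l ts) = (if kind l \<in> range ColC then
      if l \<in> LX then Node (Ml (ColC (length ts)) (Node (Xl (ColA (length ts))) (replicate (length ts) XC1))) (map idt ts)
      else idt (Node l ts)
    else Node (ig l) (map spread ts))"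

declare absorb.simps(2) [simp del] spread.simps(2) [simp del]

lemma range_col [simp]: "ColA n \<notin> range ColC" "ColA n \<notin> range ColB" "ColC n \<notin> range ColA"
  "ColB n \<notin> range ColC" "ColB n \<notin> range ColA" "ColC n \<notin> range ColB"
  by auto

lemma bt_A: "kind l = ColA n \<Longrightarrow> absorb (Node l ts) = Node (ig l) (map absorb ts)"
  and ep_A: "kind l = ColA n \<Longrightarrow> spread (Node l ts) = Node (ig l) (map spread ts)"
  by (simp_all add: absorb.simps spread.simps)

lemma bt_XC: "absorb (Node (Xl (ColC n)) ts) = 
    Node (Ml (ColC (length (concat (map B.items ts)))) (Node (Xl (ColC n)) (map B.cluster ts))) (concat (map B.items ts))"
  by (simp add: absorb.simps)

lemma bt_KC: "absorb (Node (Kl (ColC n)) ts) = Node (Kl (ColC n)) (map B.contract ts)"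
  and ep_KC: "spread (Node (Kl (ColC n)) ts) = idt (Node (Kl (ColC n)) ts)"
  by (simp_all add: absorb.simps spread.simps)

lemma ep_XC: "spread (Node (Xl (ColC n)) ts) =
    Node (Ml (ColC (length ts)) (Node (Xl (ColA (length ts))) (replicate (length ts) XC1))) (map idt ts)"
  by (simp add: spread.simps)

lemma bimod_cases [consumes 2, case_names A XC KC]:
  assumes "bimod_typed kind (Node l ts)" "l \<in> LO"
    "kind l = ColA (length ts) \<Longrightarrow> \<forall>t \<in> set ts. bimod_typed kind t \<Longrightarrow> P"
    "l = Xl (ColC (length ts)) \<Longrightarrow> \<forall>t \<in> set ts. mono_typed ColB kind t \<Longrightarrow> P"
    "l = Kl (ColC (length ts)) \<Longrightarrow> \<forall>t \<in> set ts. mono_typed ColB kind t \<Longrightarrow> P"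
  shows P
  using assms by (auto elim!: LO_cases)

text \<open>At \<open>XC\<close> the vertex and the \<open>B\<close>-clusters of its branches form
  the source of one generator. \<open>KC\<close> absorbs nothing, so its branches are contracted as
  trees of colour \<open>B\<close>.\<close>

lemma bt_props:
  "wf_tree LO t \<Longrightarrow> bimod_typed kind t \<Longrightarrow> wf_tree LM (absorb t) \<and> src (absorb t) = t \<and> bimod_typed kind (absorb t)"
proof (induction t)
  case (Node l ts)
  have l: "l \<in> LO" "\<forall>t \<in> set ts. wf_tree LO t" using Node.prems by auto
  from Node.prems(2) l(1) show ?case
  proof (cases rule: bimod_cases)
    case A
    have IH: "wf_tree LM (absorb t) \<and> src (absorb t) = t \<and> bimod_typed kind (absorb t)" if "t \<in> set ts" for t
      using Node.IH[OF that] A l that by simp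
    then have "map src (map absorb ts) = ts" by (auto intro!: map_idI)
    then show ?thesis using A IH l by (simp add: bt_A LO_facts graft_cor)
  next
    case XC
    let ?k = "length (concat (map B.items ts))"
    note p = B.con_props[OF bspec[OF l(2)]]
    have "Node l (map B.cluster ts) \<in> tree_set LX (ColC ?k)"
      using XC p B.ctops_citems(2)[OF l(2), of l] by (simp add: tree_set_iff)
    moreover have "\<forall>i \<in> set (concat (map B.items ts)). wf_tree LM i \<and> mono_typed ColB kind i"
      using p B.citems_mono XC l(2) by auto
    ultimately show ?thesis
      using B.ctops_citems(1)[OF l(2)] XC by (simp add: bt_XC)
  next
    case KC
    have c: "wf_tree LM (B.contract t) \<and> src (B.contract t) = t \<and> mono_typed ColB kind (B.contract t)" if "t \<in> set ts" for t
      using B.wf_con B.src_con B.con_mono KC l that by simp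
    then have "map src (map B.contract ts) = ts" by (auto intro!: map_idI)
    then show ?thesis using KC c by (simp add: bt_KC graft_cor)
  qed
qed simp

lemma ep_props:
  "wf_tree LO t \<Longrightarrow> bimod_typed kind t \<Longrightarrow> wf_tree LM (spread t) \<and> tgt (spread t) = t \<and> bimod_typed kind (spread t)"
proof (induction t)
  case (Node l ts)
  have l: "l \<in> LO" "\<forall>t \<in> set ts. wf_tree LO t" using Node.prems by auto
  from Node.prems(2) l(1) show ?case
  proof (cases rule: bimod_cases)
    case A
    have IH: "wf_tree LM (spread t) \<and> tgt (spread t) = t \<and> bimod_typed kind (spread t)" if "t \<in> set ts" for t
      using Node.IH[OF that] A l that by simp
    then have "map tgt (map spread ts) = ts" by (auto intro!: map_idI)
    then show ?thesis using A IH l by (simp add: ep_A LO_facts)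
  next
    case XC
    have "map tgt (map idt ts) = ts" using l by (auto intro!: map_idI tgt_idt)
    then show ?thesis
      using XC l mono_typed_idt wf_idt
      by (auto simp: ep_XC tree_set_iff sum_list_replicate)
  next
    case KC
    then show ?thesis
      using wf_idt[OF Node.prems(1)] tgt_idt[OF Node.prems(1)] bimod_typed_idt[OF Node.prems(1)] Node.prems(2)
      by (simp only: ep_KC)
  qed
qed simp

abbreviation bar :: "tree \<Rightarrow> tree" where "bar t \<equiv> tgt (absorb t)"

lemma bar_props: "wf_tree LO t \<Longrightarrow> bimod_typed kind t \<Longrightarrow> wf_tree LO (bar t) \<and> bimod_typed kind (bar t)"
  using bt_props[of t] wf_tgt[of "absorb t"] bimod_typed_tgt[of "absorb t"] by simp

text \<open>Both maps are identities on \<open>A\<close>-vertices and so pass through a whole tree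
  of them, such as the source inserted at an \<open>A\<close>-vertex of an arrow.\<close>

lemma bt_ep_graft_A:
  "length us = leaves d \<Longrightarrow> wf_tree LO d \<Longrightarrow> mono_typed ColA kind d \<Longrightarrow>
     absorb (graft d us) = graft (idt d) (map absorb us) \<and> spread (graft d us) = graft (idt d) (map spread us)"
  "length us = sum_list (map leaves ds) \<Longrightarrow> \<forall>d \<in> set ds. wf_tree LO d \<and> mono_typed ColA kind d \<Longrightarrow>
     map absorb (graft_list ds us) = graft_list (map idt ds) (map absorb us) \<and>
     map spread (graft_list ds us) = graft_list (map idt ds) (map spread us)"
proof (induction d us and ds us rule: graft_graft_list.induct)
  case (1 us) then show ?case by (cases us) auto
next
  case (2 l ds us) then show ?case by (simp add: bt_A ep_A)
next
  case (4 d ds us) then show ?case by (simp add: take_map drop_map)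
qed simp

text \<open>What remains of an all-\<open>X\<close> tree of colour \<open>C\<close> once its
  \<open>B\<close>-vertices are absorbed: \<open>A\<close>-vertices above \<open>C\<close>-vertices
  with bare inputs. An \<open>A\<close>-vertex without inputs is included.\<close>

fun flat :: "tree \<Rightarrow> bool" where
  "flat Leaf \<longleftrightarrow> False"
| "flat (Node l ts) \<longleftrightarrow> l = Xl (ColA (length ts)) \<and> (\<forall>t \<in> set ts. flat t) \<or>
     l = Xl (ColC (length ts)) \<and> ts = replicate (length ts) Leaf"

lemma flat_props: "flat t \<Longrightarrow> wf_tree LX t \<and> bimod_typed kind t"
proof (induction t)
  case (Node l ts)
  show ?case
  proof (cases "l = Xl (ColA (length ts))")
    case True
    then show ?thesis using Node by auto
  next
    case False
    then have "l = Xl (ColC (length ts))" "ts = replicate (length ts) Leaf" using Node by auto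
    moreover from this(2) have "\<forall>t \<in> set ts. t = Leaf" by (metis in_set_replicate)
    ultimately have "l = Xl (ColC (length ts))" "\<forall>t \<in> set ts. t = Leaf" by blast+
    then show ?thesis by auto
  qed
qed simp

lemma map_eq_nth: "map f xs = map g ys \<Longrightarrow> length xs = length ys \<and> (\<forall>i<length ys. f (xs ! i) = g (ys ! i))"
  by (auto simp: list_eq_iff_nth_eq)

lemma choose_list:
  assumes "\<And>x. x \<in> set xs \<Longrightarrow> \<exists>y. P x y"
  obtains ys where "list_all2 P xs ys"
proof -
  from assms obtain f where "\<And>x. x \<in> set xs \<Longrightarrow> P x (f x)" by metis
  then have "list_all2 P xs (map f xs)" by (simp add: list_all2_conv_all_nth)
  then show ?thesis by (rule that)
qed

text \<open>What hangs on a flat tree lies below its \<open>C\<close>-vertices, where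
  \<open>spread\<close> inserts identities.\<close>

lemma flat_ep_graft:
  "flat q \<Longrightarrow> length ws = leaves q \<Longrightarrow> spread (graft q ws) = graft (spread q) (map idt ws)"
proof (induction q arbitrary: ws)
  case (Node l qs)
  show ?case
  proof (cases "l = Xl (ColA (length qs))")
    case True
    then have fl: "\<forall>q \<in> set qs. flat q" using Node.prems by auto
    obtain wss where ws: "ws = concat wss" "map length wss = map leaves qs"
      using split_list_lengths[of ws "map leaves qs"] Node.prems by auto
    have len: "length wss = length qs" "\<And>i. i < length qs \<Longrightarrow> length (wss ! i) = leaves (qs ! i)"
      using map_eq_nth[OF ws(2)] by auto
    have "leaves (spread q) = leaves q" if "q \<in> set qs" for q
      using fl that flat_props[of q] ep_props[of q] wf_mono[OF _ LX_LO] leaves_tgt(1)[of "spread q"] by auto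
    then have l: "map length (map (map idt) wss) = map leaves (map spread qs)" using ws(2) by (simp add: comp_def cong: map_cong)
    have "map spread (map2 graft qs wss) = map2 graft (map spread qs) (map (map idt) wss)"
      using Node.IH fl len by (auto intro!: nth_equalityI)
    then have "map spread (graft_list qs ws) = graft_list (map spread qs) (map idt ws)"
      unfolding ws(1) map_concat using graft_list_concat[OF ws(2)] graft_list_concat[OF l] by simp
    then show ?thesis using True by (simp add: ep_A)
  next
    case False
    then have l: "l = Xl (ColC (length qs))" and qs: "qs = replicate (length qs) Leaf" using Node.prems by auto
    define n where "n = length qs"
    have "qs = replicate n Leaf" "l = Xl (ColC n)" using l qs n_def by simp_all
    moreover have "length ws = n" using Node.prems(2) calculation by (simp add: sum_list_replicate)
    ultimately show ?thesis by (simp add: graft_list_replicate_Leaf ep_XC)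
  qed
qed simp

text \<open>The purpose of \<open>spread\<close>: the \<open>A\<close>-vertices of \<open>q\<close>
  and those replacing its \<open>C\<close>-vertices form a single tree \<open>r\<close> with a copy
  of \<open>XC1\<close> on every leaf. A vertex \<open>XC(0)\<close> becomes \<open>XA(0)\<close>
  and adds no leaf.\<close>

lemma flat_src_ep:
  "flat q \<Longrightarrow> \<exists>r. wf_tree LX r \<and> mono_typed ColA kind r \<and> leaves r = leaves q \<and>
     src (spread q) = graft r (replicate (leaves q) XC1)"
proof (induction q)
  case (Node l qs)
  show ?case
  proof (cases "l = Xl (ColA (length qs))")
    case True
    then have fl: "\<forall>q \<in> set qs. flat q" using Node.prems by auto
    let ?P = "\<lambda>q r. wf_tree LX r \<and> mono_typed ColA kind r \<and> leaves r = leaves q \<and>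
       src (spread q) = graft r (replicate (leaves q) XC1)"
    have "\<exists>r. ?P q r" if "q \<in> set qs" for q using Node.IH[OF that] fl that by blast
    then obtain rs where "list_all2 ?P qs rs" using choose_list[of qs ?P] by blast
    then have rs: "length rs = length qs" "\<forall>i < length qs. wf_tree LX (rs ! i) \<and> mono_typed ColA kind (rs ! i) \<and>
       leaves (rs ! i) = leaves (qs ! i) \<and> src (spread (qs ! i)) = graft (rs ! i) (replicate (leaves (qs ! i)) XC1)"
      by (auto simp: list_all2_conv_all_nth)
    let ?wss = "map (\<lambda>q. replicate (leaves q) XC1) qs"
    have lr: "map leaves rs = map leaves qs" using rs by (auto intro!: nth_equalityI)
    have "concat ?wss = replicate (sum_list (map leaves qs)) XC1"
      by (induction qs) (auto simp: replicate_add)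
    moreover have "graft_list rs (concat ?wss) = map src (map spread qs)"
      using rs lr by (subst graft_list_concat) (auto intro!: nth_equalityI)
    moreover have "src (spread (Node l qs)) = Node l (map src (map spread qs))"
      using True by (simp add: ep_A graft_cor)
    ultimately have "src (spread (Node l qs)) = graft (Node l rs) (replicate (leaves (Node l qs)) XC1)" by simp
    moreover have "\<forall>r \<in> set rs. wf_tree LX r \<and> mono_typed ColA kind r" using rs by (auto simp: in_set_conv_nth)
    ultimately show ?thesis using True rs lr by (intro exI[of _ "Node l rs"]) auto
  next
    case False
    then have l: "l = Xl (ColC (length qs))" and qs: "qs = replicate (length qs) Leaf" using Node.prems by auto
    define n where "n = length qs"
    have q: "qs = replicate n Leaf" "l = Xl (ColC n)" using l qs n_def by simp_all
    have "src (spread (Node l qs)) = graft (Node (Xl (ColA n)) (replicate n XC1)) (replicate n Leaf)"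
      using q by (simp add: ep_XC)
    also have "\<dots> = Node (Xl (ColA n)) (replicate n XC1)"
      by (rule graft_Leaves(1)) (auto simp: sum_list_replicate)
    also have "\<dots> = graft (cor (Xl (ColA n))) (replicate n XC1)" by (simp add: graft_cor)
    finally show ?thesis
      using q by (intro exI[of _ "cor (Xl (ColA n))"]) (auto simp: cor_def sum_list_replicate)
  qed
qed simp

text \<open>The \<open>B\<close>-vertices of \<open>q\<close> join the \<open>B\<close>-clusters of
  the branches, so the items of the result are those of \<open>us\<close> alone, and
  \<open>Q\<close> collects what absorption does above them.\<close>

lemma bt_graft_C:
  "wf_tree LX q \<Longrightarrow> bimod_typed kind q \<Longrightarrow> length us = leaves q \<Longrightarrow> \<forall>u \<in> set us. wf_tree LO u \<Longrightarrow>
    \<exists>Q. absorb (graft q us) = graft Q (concat (map B.items us)) \<and> leaves Q = length (concat (map B.items us)) \<and>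
      wf_tree LM Q \<and> src Q = graft q (map B.cluster us) \<and> flat (tgt Q)"
proof (induction q arbitrary: us)
  case (Node l qs)
  have l: "l \<in> LX" "\<forall>q \<in> set qs. wf_tree LX q" using Node.prems by auto
  obtain uss where us: "us = concat uss" "map length uss = map leaves qs"
    using split_list_lengths[of us "map leaves qs"] Node.prems by auto
  have len: "length uss = length qs" "\<And>i. i < length qs \<Longrightarrow> length (uss ! i) = leaves (qs ! i)"
    using map_eq_nth[OF us(2)] by auto
  from Node.prems(2) subsetD[OF LX_LO l(1)] show ?case
  proof (cases rule: bimod_cases)
    case A
    have lX: "l = Xl (ColA (length qs))" using A(1) l(1) by (auto simp: LX_def)
    let ?P = "\<lambda>(q, us) Q. absorb (graft q us) = graft Q (concat (map B.items us)) \<and> leaves Q = length (concat (map B.items us)) \<and>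
      wf_tree LM Q \<and> src Q = graft q (map B.cluster us) \<and> flat (tgt Q)"
    have "\<exists>Q. ?P x Q" if x: "x \<in> set (zip qs uss)" for x
    proof -
      obtain i where i: "i < length qs" "x = (qs ! i, uss ! i)" using x len by (auto simp: in_set_zip)
      have "uss ! i \<in> set uss" using i len by simp
      then have "\<forall>u \<in> set (uss ! i). wf_tree LO u" using Node.prems(4) us(1) by auto
      then show ?thesis using Node.IH[of "qs ! i" "uss ! i"] i l A(2) len by auto
    qed
    then obtain Qs where "list_all2 ?P (zip qs uss) Qs" using choose_list[of "zip qs uss" ?P] by blast
    then have Qs: "length Qs = length qs" "\<And>i. i < length qs \<Longrightarrow> ?P (qs ! i, uss ! i) (Qs ! i)"
      using len by (auto simp: list_all2_conv_all_nth)
    let ?iss = "map (\<lambda>us. concat (map B.items us)) uss"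
    have li: "map length ?iss = map leaves Qs" using Qs len by (auto intro!: nth_equalityI)
    have ci: "concat (map B.items us) = concat ?iss" unfolding us(1) by (induction uss) auto
    have "map absorb (graft_list qs us) = graft_list Qs (concat (map B.items us))"
      unfolding ci graft_list_concat[OF li] unfolding us(1) graft_list_concat[OF us(2)]
      using Qs len by (auto intro!: nth_equalityI)
    then have 1: "absorb (graft (Node l qs) us) = graft (Node (ig l) Qs) (concat (map B.items us))"
      using A by (simp add: bt_A)
    have lc: "map length (map (map B.cluster) uss) = map leaves qs" using us(2) by (simp add: comp_def)
    have "map src Qs = graft_list qs (map B.cluster us)"
      unfolding us(1) map_concat graft_list_concat[OF lc] using Qs len by (auto intro!: nth_equalityI)
    then have 2: "src (Node (ig l) Qs) = graft (Node l qs) (map B.cluster us)"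
      using lX Qs(1) by (simp add: graft_cor)
    have "\<forall>Q \<in> set Qs. wf_tree LM Q \<and> flat (tgt Q)" using Qs by (auto simp: in_set_conv_nth)
    moreover have "sum_list (map leaves Qs) = length (concat (map B.items us))"
      unfolding ci li[symmetric] by (simp add: length_concat)
    ultimately show ?thesis
      using 1 2 Qs(1) lX by (intro exI[of _ "Node (ig l) Qs"]) auto
  next
    case XC
    let ?k = "length (concat (map B.items us))"
    have g: "map B.cluster (graft_list qs us) = graft_list qs (map B.cluster us)"
      "concat (map B.items (graft_list qs us)) = concat (map B.items us)"
      using B.con_graft(2)[of us qs] l(2) XC Node.prems(3) by auto
    let ?T = "Node l (graft_list qs (map B.cluster us))"
    \<comment> \<open>The generator that \<open>absorb\<close> puts at the root, with bare inputs
      onto which the items are grafted.\<close>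
    let ?Q = "Node (Ml (ColC ?k) ?T) (replicate ?k Leaf)"
    have w: "\<forall>u \<in> set (graft_list qs us). wf_tree LO u"
      using Node.prems(3,4) l(2) wf_mono[OF _ LX_LO] by (subst wf_graft(2)) auto
    have "\<forall>t \<in> set (map B.cluster (graft_list qs us)). mono_typed ColB kind t \<and> wf_tree LX t"
      using B.con_props[OF bspec[OF w]] by simp
    then have "\<forall>t \<in> set (graft_list qs (map B.cluster us)). mono_typed ColB kind t \<and> wf_tree LX t" unfolding g(1) .
    moreover have "leaves ?T = ?k"
      using B.ctops_citems(2)[OF w, of l] unfolding g by simp
    ultimately have T: "?T \<in> tree_set LX (ColC ?k)"
      using XC by (simp add: tree_set_iff)
    have "absorb (graft (Node l qs) us) = Node (Ml (ColC ?k) ?T) (concat (map B.items us))"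
      using XC bt_XC[of "length qs" "graft_list qs us"] unfolding g by simp
    also have "\<dots> = graft ?Q (concat (map B.items us))" by (simp add: graft_list_replicate_Leaf)
    finally have 1: "absorb (graft (Node l qs) us) = graft ?Q (concat (map B.items us))" .
    have 2: "src ?Q = graft (Node l qs) (map B.cluster us)"
    proof -
      have "src ?Q = graft ?T (replicate ?k Leaf)" by simp
      also have "\<dots> = ?T" using \<open>leaves ?T = ?k\<close> by (intro graft_Leaves(1)) auto
      finally show ?thesis by simp
    qed
    show ?thesis
      using 1 2 T by (intro exI[of _ ?Q]) (auto simp: sum_list_replicate)
  next
    case KC
    then show ?thesis using l(1) by simp
  qed
qed simp

text \<open>The arrow \<open>f\<close> induces arrows between the middle terms of the zigzags
  \<open>t \<rightarrow> bar t \<leftarrow> u \<rightarrow> N\<close> at its source and target.\<close>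

definition lifts :: "tree \<Rightarrow> tree \<Rightarrow> tree \<Rightarrow> bool" where
  "lifts f fb fh \<longleftrightarrow> wf_tree LM fb \<and> bimod_typed kind fb \<and> wf_tree LM fh \<and> bimod_typed kind fh \<and> A.pure fh \<and>
    src fb = bar (src f) \<and> tgt fb = bar (tgt f) \<and>
    src fh = src (spread (bar (src f))) \<and> tgt fh = src (spread (bar (tgt f))) \<and>
    cmp fb (absorb (src f)) = cmp (absorb (tgt f)) f \<and> cmp fb (spread (bar (src f))) = cmp (spread (bar (tgt f))) fh"

lemma A_pure_idt: "wf_tree LO (Node l ts) \<Longrightarrow> kind l \<notin> range ColA \<Longrightarrow> A.pure (idt (Node l ts))"
proof -
  assume t: "wf_tree LO (Node l ts)" "kind l \<notin> range ColA"
  then have "kind (ig l) \<notin> range ColA" by (simp add: LO_facts)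
  moreover have "\<exists>t. wf_tree LO t \<and> Node (ig l) (map idt ts) = idt t" using t(1) by (intro exI[of _ "Node l ts"]) simp
  ultimately show ?thesis unfolding idt_simps A.pure.simps by (simp only: if_False)
qed

text \<open>\<open>A\<close>-vertices take no part in absorption and spreading, so the lifts of the
  branches are put back under the same label \<open>l\<close>.\<close>

lemma lifts_A:
  assumes l: "l \<in> LM" "kind l = ColA (length fs)" and fs: "\<forall>f \<in> set fs. wf_tree LM f \<and> bimod_typed kind f"
    and IH: "\<And>f. f \<in> set fs \<Longrightarrow> \<exists>fb fh. lifts f fb fh"
  shows "\<exists>fb fh. lifts (Node l fs) fb fh"
proof -
  obtain fb fh where lf: "\<And>f. f \<in> set fs \<Longrightarrow> lifts f (fb f) (fh f)" using IH by metis
  let ?fb = "Node l (map fb fs)" and ?fh = "Node l (map fh fs)"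
  have d: "wf_tree LO (dg l)" "mono_typed ColA kind (dg l)" "leaves (dg l) = length fs"
    using wf_dg[OF l(1)] LM_facts(1,6)[OF l(1)] l(2) by (auto simp: tree_set_def)
  have w: "wf_tree LO (src f)" "wf_tree LO (tgt f)" "bimod_typed kind (src f)" "bimod_typed kind (tgt f)" if "f \<in> set fs" for f
    using fs that wf_src wf_tgt bimod_typed_src bimod_typed_tgt by auto
  have cg: "cg l \<in> LO" "kind (cg l) = ColA (length fs)" using LM_facts[OF l(1)] l(2) by auto
  have ig: "cg (ig (cg l)) = cg l" "kind (ig (cg l)) = ColA (length fs)" "dg (ig (cg l)) = cor (cg l)"
    using LO_facts[OF cg(1)] cg(2) by simp_all
  have bs: "absorb (src (Node l fs)) = graft (idt (dg l)) (map (\<lambda>f. absorb (src f)) fs)"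
    using bt_ep_graft_A(1)[of "map src fs" "dg l"] d by (simp add: comp_def)
  have bars: "bar (src (Node l fs)) = graft (dg l) (map (\<lambda>f. bar (src f)) fs)"
    unfolding bs using d by (simp add: tgt_graft tgt_idt comp_def)
  have es: "spread (bar (src (Node l fs))) = graft (idt (dg l)) (map (\<lambda>f. spread (bar (src f))) fs)"
    unfolding bars using bt_ep_graft_A(1)[of "map (\<lambda>f. bar (src f)) fs" "dg l"] d by (simp add: comp_def)
  have bT: "absorb (tgt (Node l fs)) = Node (ig (cg l)) (map (\<lambda>f. absorb (tgt f)) fs)"
    using cg by (simp add: bt_A comp_def)
  have barT: "bar (tgt (Node l fs)) = Node (cg l) (map (\<lambda>f. bar (tgt f)) fs)"
    unfolding bT using ig by (simp add: comp_def)
  have eT: "spread (bar (tgt (Node l fs))) = Node (ig (cg l)) (map (\<lambda>f. spread (bar (tgt f))) fs)"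
    unfolding barT using cg by (simp add: ep_A comp_def)
  have "src ?fb = bar (src (Node l fs))" "tgt ?fb = bar (tgt (Node l fs))"
    unfolding bars barT using lf by (simp_all add: lifts_def comp_def cong: map_cong)
  moreover have "src ?fh = src (spread (bar (src (Node l fs))))"
  proof -
    have "src (spread (bar (src (Node l fs)))) = graft (dg l) (map (\<lambda>f. src (spread (bar (src f)))) fs)"
      unfolding es using d by (simp add: src_graft wf_idt src_idt comp_def)
    then show ?thesis using lf by (simp add: lifts_def comp_def cong: map_cong)
  qed
  moreover have "tgt ?fh = src (spread (bar (tgt (Node l fs))))"
    unfolding eT using lf ig cg by (simp add: lifts_def graft_cor comp_def cong: map_cong)
  moreover have "cmp ?fb (absorb (src (Node l fs))) = cmp (absorb (tgt (Node l fs))) (Node l fs)"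
  proof -
    have "cmps (map fb fs) (map (\<lambda>f. absorb (src f)) fs) = cmps (map (\<lambda>f. absorb (tgt f)) fs) fs"
      using lf by (auto simp: cmps_map2 lifts_def intro!: nth_equalityI)
    then show ?thesis
      unfolding bs bT using l cmp_idt_dg[of l "map (\<lambda>f. absorb (src f)) fs" "map fb fs"]
        cmp_ig[of l fs "map (\<lambda>f. absorb (tgt f)) fs"] by simp
  qed
  moreover have "cmp ?fb (spread (bar (src (Node l fs)))) = cmp (spread (bar (tgt (Node l fs)))) ?fh"
  proof -
    have "cmps (map fb fs) (map (\<lambda>f. spread (bar (src f))) fs) = cmps (map (\<lambda>f. spread (bar (tgt f))) fs) (map fh fs)"
      using lf by (auto simp: cmps_map2 lifts_def intro!: nth_equalityI)
    then show ?thesis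
      unfolding es eT using l cmp_idt_dg[of l "map (\<lambda>f. spread (bar (src f))) fs" "map fb fs"]
        cmp_ig[of l "map fh fs" "map (\<lambda>f. spread (bar (tgt f))) fs"] by simp
  qed
  moreover have "wf_tree LM ?fb" "bimod_typed kind ?fb" "wf_tree LM ?fh" "bimod_typed kind ?fh" "A.pure ?fh"
    using l lf by (auto simp: lifts_def)
  ultimately show ?thesis unfolding lifts_def by blast
qed

text \<open>Below \<open>KC\<close> only \<open>B\<close>-contractions occur, and by
  \<open>B.con_natural\<close> their targets agree at both ends of the arrow. Hence both ends have
  the same \<open>bar\<close>, and an identity serves for both lifts.\<close>

lemma lifts_KC:
  assumes fs: "\<forall>f \<in> set fs. wf_tree LM f \<and> mono_typed ColB kind f" and n: "n = length fs"
  shows "\<exists>fb fh. lifts (Node (Kl (ColC n)) fs) fb fh"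
proof -
  let ?l = "Kl (ColC n)"
  let ?s = "Node ?l (map (\<lambda>f. tgt (B.contract (src f))) fs)"
  have contract: "cmp (B.contract (tgt f)) f = B.contract (src f)" if "f \<in> set fs" for f
    using fs that by (intro B.con_natural) (auto intro: B.mono_typed_pure)
  have w: "wf_tree LM (B.contract (src f)) \<and> wf_tree LM (B.contract (tgt f)) \<and> src (B.contract (tgt f)) = tgt f" if "f \<in> set fs" for f
    using fs that by (auto intro: B.wf_con B.src_con wf_src wf_tgt)
  have src: "src (Node ?l fs) = Node ?l (map src fs)" using n by (simp add: graft_cor)
  have bs: "absorb (src (Node ?l fs)) = Node ?l (map (\<lambda>f. B.contract (src f)) fs)" unfolding src by (simp add: bt_KC comp_def)
  have bT: "absorb (tgt (Node ?l fs)) = Node ?l (map (\<lambda>f. B.contract (tgt f)) fs)" by (simp add: bt_KC comp_def)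
  have tc: "tgt (B.contract (src f)) = tgt (B.contract (tgt f))" if "f \<in> set fs" for f
    using contract[OF that] cmp_props[of "B.contract (tgt f)" f] w[OF that] fs that by auto
  have bars: "bar (src (Node ?l fs)) = ?s" unfolding bs by (simp add: comp_def)
  have barT: "bar (tgt (Node ?l fs)) = ?s" unfolding bT using tc by (simp add: comp_def cong: map_cong)
  have f: "wf_tree LM (Node ?l fs)" "bimod_typed kind (Node ?l fs)" using fs n by auto
  have S: "wf_tree LO (src (Node ?l fs))" "bimod_typed kind (src (Node ?l fs))"
    using wf_src[OF f(1)] bimod_typed_src[OF f] by blast+
  have s: "wf_tree LO ?s" "bimod_typed kind ?s"
    using bar_props[OF S] unfolding bars by auto
  have eps: "spread ?s = idt ?s" by (rule ep_KC)
  have i: "src (idt ?s) = ?s" "tgt (idt ?s) = ?s" "wf_tree LM (idt ?s)" "bimod_typed kind (idt ?s)"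
    using src_idt[OF s(1)] tgt_idt[OF s(1)] wf_idt[OF s(1)] bimod_typed_idt[OF s(1)] s(2) by blast+
  have "cmps (map (\<lambda>f. B.contract (tgt f)) fs) fs = map (\<lambda>f. B.contract (src f)) fs"
    using contract by (auto simp: cmps_map2 intro!: nth_equalityI)
  then have "cmp (absorb (tgt (Node ?l fs))) (Node ?l fs) = absorb (src (Node ?l fs))"
    unfolding bT bs using cmp_ig[of ?l fs "map (\<lambda>f. B.contract (tgt f)) fs"] n by simp
  moreover have "cmp (idt ?s) (absorb (src (Node ?l fs))) = absorb (src (Node ?l fs))"
    using cmp_idt_left[of "absorb (src (Node ?l fs))"] bt_props[OF S] unfolding bars by blast
  moreover have "A.pure (idt ?s)" using s(1) by (intro A_pure_idt) simp_all
  moreover have "src (idt ?s) = src (spread ?s)" "tgt (idt ?s) = src (spread ?s)" unfolding eps i by (rule refl)+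
  ultimately have "lifts (Node ?l fs) (idt ?s) (idt ?s)"
    using i unfolding lifts_def bars barT by (simp only: eps)
  then show ?thesis by blast
qed

text \<open>The case in which \<open>C\<close>-vertices are merged. At the target \<open>bar\<close>
  is one vertex \<open>XC(k)\<close>, at the source a flat tree, both with the same trees
  \<open>w\<close> below; \<open>fb\<close> is the generator between them. After spreading there are
  an \<open>A\<close>-tree \<open>r\<close> at the source and \<open>XA(k)\<close> at the target,
  above the same copies of \<open>XC1\<close>, and \<open>fh\<close> is the generator given by
  \<open>r\<close>.\<close>

lemma lifts_XC:
  assumes fs: "\<forall>f \<in> set fs. wf_tree LM f \<and> mono_typed ColB kind f" and n: "n = length fs"
    and q: "q \<in> tree_set LX (ColC n)"
  shows "\<exists>fb fh. lifts (Node (Ml (ColC n) q) fs) fb fh"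
proof -
  let ?l = "Ml (ColC n) q" and ?XC = "\<lambda>n. Xl (ColC n)"
  let ?f = "Node ?l fs"
  let ?its = "concat (map B.items (map src fs))" and ?its' = "concat (map B.items (map tgt fs))"
  let ?k = "length ?its"
  let ?w = "map tgt ?its"
  have qp: "wf_tree LX q" "bimod_typed kind q" "leaves q = length fs"
    using q n tree_set_wf[OF q] by (auto simp: tree_set_def)
  have S: "\<forall>u \<in> set (map src fs). wf_tree LO u" and T: "\<forall>u \<in> set (map tgt fs). wf_tree LO u"
    using fs by (auto intro: wf_src wf_tgt)
  have "\<exists>Q F. B.con_split f Q F" if "f \<in> set fs" for f
    using fs that by (intro B.con_split) (auto intro: B.mono_typed_pure)
  then obtain Q F where QF0: "\<And>f. f \<in> set fs \<Longrightarrow> B.con_split f (Q f) (F f)" by metis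
  have QF: "f = graft (Q f) (F f)" "length (F f) = leaves (Q f)" "wf_tree LM (Q f)" "\<forall>g \<in> set (F f). wf_tree LM g"
    "tgt (Q f) = B.cluster (tgt f)" "src (Q f) = B.cluster (src f)" "cmps (B.items (tgt f)) (F f) = B.items (src f)"
    if "f \<in> set fs" for f
    using QF0[OF that] unfolding B.con_split_def by blast+
  have lenF: "length (B.items (tgt f)) = length (F f)" if "f \<in> set fs" for f
    using arg_cong[OF QF(5)[OF that], of leaves] QF(2)[OF that] B.con_props[of "tgt f"] T that by simp
  have its: "cmps ?its' (concat (map F fs)) = ?its"
  proof -
    have "map2 cmps (map B.items (map tgt fs)) (map F fs) = map B.items (map src fs)"
      using QF(7) by (auto intro!: nth_equalityI)
    then show ?thesis using lenF by (subst cmps_concat) auto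
  qed
  then have k': "length ?its' = ?k" by (metis length_cmps)
  have wits: "\<forall>i \<in> set ?its. wf_tree LM i" "\<forall>i \<in> set ?its'. wf_tree LM i"
    using B.con_props S T by auto
  \<comment> \<open>The items at the source are those at the target composed with \<open>F\<close>,
    so their targets coincide.\<close>
  have tgt_its: "map tgt ?its' = ?w"
  proof -
    have a: "tgt (cmp i g) = tgt i" if "i \<in> set (B.items (tgt f))" "g \<in> set (F f)" "f \<in> set fs" "src i = tgt g" for i g f
      using cmp_props[of i g] that QF(4) B.con_props[of "tgt f"] T by auto
    have b: "src (B.items (tgt f) ! i) = tgt (F f ! i)" if "f \<in> set fs" "i < length (F f)" for f i
    proof -
      have "graft (B.cluster (tgt f)) (map src (B.items (tgt f))) = tgt f"
        using B.con_props[of "tgt f"] T that(1) by simp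
      also have "tgt f = graft (tgt (Q f)) (map tgt (F f))"
        using tgt_graft[of "F f" "Q f"] QF(1,2)[OF that(1)] by simp
      finally have "graft (B.cluster (tgt f)) (map src (B.items (tgt f))) = graft (B.cluster (tgt f)) (map tgt (F f))"
        unfolding QF(5)[OF that(1)] .
      then have "map src (B.items (tgt f)) = map tgt (F f)"
        using top_graft[of id "B.cluster (tgt f)" id "B.cluster (tgt f)"] lenF[OF that(1)] B.con_props[of "tgt f"] T that(1)
        by (metis length_map imageI list.set_map)
      then show ?thesis using that lenF by (metis nth_map)
    qed
    have "map tgt (cmps (B.items (tgt f)) (F f)) = map tgt (B.items (tgt f))" if f: "f \<in> set fs" for f
    proof -
      have "tgt (cmp (B.items (tgt f) ! i) (F f ! i)) = tgt (B.items (tgt f) ! i)" if "i < length (F f)" for i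
        using that lenF[OF f] by (intro a[OF _ _ f b[OF f that]]) simp_all
      then show ?thesis using lenF[OF f] by (auto simp: cmps_map2 intro!: nth_equalityI)
    qed
    then have "map tgt (B.items (src f)) = map tgt (B.items (tgt f))" if "f \<in> set fs" for f
      using QF(7) that by simp
    then have "map (\<lambda>f. map tgt (B.items (src f))) fs = map (\<lambda>f. map tgt (B.items (tgt f))) fs" by (rule map_cong[OF refl])
    from arg_cong[OF this, of concat] show ?thesis by (simp add: map_concat comp_def)
  qed
  have bT: "absorb (tgt ?f) = Node (Ml (ColC ?k) (Node (?XC n) (map B.cluster (map tgt fs)))) ?its'"
    using k' by (simp add: bt_XC)
  have barT: "bar (tgt ?f) = Node (?XC ?k) ?w" unfolding bT using tgt_its by simp
  let ?ps = "map B.cluster (map src fs)"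
  \<comment> \<open>The new source at the root is \<open>q\<close> with the
    \<open>B\<close>-clusters of the branches grafted on. It is also the source of
    \<open>Qb\<close>, so the first square commutes.\<close>
  have cT: "cmp (absorb (tgt ?f)) ?f = Node (Ml (ColC ?k) (graft q ?ps)) ?its"
  proof -
    have "map length (map F fs) = map leaves (map Q fs)" using QF(2) by simp
    from graft_list_concat[OF this]
    have "graft_list (map Q fs) (concat (map F fs)) = fs" using QF(1) by (auto intro!: nth_equalityI)
    then have f: "?f = graft (Node ?l (map Q fs)) (concat (map F fs))" by simp
    have "map src (map Q fs) = ?ps" using QF(6) by simp
    then have sQ: "src (Node ?l (map Q fs)) = graft q ?ps" by (simp del: map_map)
    have "tgt (Node ?l (map Q fs)) = Node (?XC n) (map B.cluster (map tgt fs))" using QF(5) by simp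
    moreover have "length (concat (map F fs)) = leaves (Node (?XC n) (map B.cluster (map tgt fs)))"
      using arg_cong[OF its, of length] B.ctops_citems(2)[OF T, of "?XC n"] k' lenF
      by (simp add: length_concat comp_def cong: map_cong)
    ultimately have "cmp (absorb (tgt ?f)) (graft (Node ?l (map Q fs)) (concat (map F fs))) =
        Node (cl (Ml (ColC ?k) (Node (?XC n) (map B.cluster (map tgt fs)))) (src (Node ?l (map Q fs)))) (cmps ?its' (concat (map F fs)))"
      unfolding bT by (intro cmp_Node) (simp_all only: label_simps)
    then show ?thesis unfolding sQ its f[symmetric] label_simps .
  qed
  obtain Qb where Qb: "absorb (graft q (map src fs)) = graft Qb ?its" "leaves Qb = ?k" "wf_tree LM Qb"
    "src Qb = graft q ?ps" "flat (tgt Qb)"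
    using bt_graft_C[OF qp(1,2), of "map src fs"] qp(3) S by auto
  let ?q = "tgt Qb"
  have fq: "wf_tree LX ?q" "bimod_typed kind ?q" "leaves ?q = ?k" using flat_props[OF Qb(5)] Qb(2) by auto
  then have qk: "?q \<in> tree_set LX (ColC ?k)" by (simp add: tree_set_iff)
  have bs: "absorb (src ?f) = graft Qb ?its" using Qb(1) by simp
  have bars: "bar (src ?f) = graft ?q ?w" unfolding bs using Qb(2) by (simp add: tgt_graft)
  have ww: "\<forall>x \<in> set ?w. wf_tree LO x" using wits(1) by (auto intro: wf_tgt)
  have mw: "\<forall>x \<in> set ?w. mono_typed ColB kind x"
  proof -
    have "mono_typed ColB kind (tgt i)" if "wf_tree LM i" "mono_typed ColB kind i" for i
      unfolding tgt_def mono_typed_relabel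
      using that by (subst mono_typed_cong[where k' = kind]) (auto simp: wf_tree_def LM_facts)
    moreover have "mono_typed ColB kind (src f)" if "f \<in> set fs" for f
      using src_obj[of f "ColB (leaves f)"] fs that by (simp add: tree_set_iff)
    ultimately show ?thesis using wits(1) B.citems_mono S by fastforce
  qed
  define w where "w = ?w"
  define k where "k = ?k"
  note bars = bars[folded w_def] and barT = barT[folded w_def k_def] and ww = ww[folded w_def] and mw = mw[folded w_def]
    and qk = qk[folded k_def] and fq = fq[folded k_def] and cT = cT[folded k_def]
  have lw: "length w = k" by (simp add: w_def k_def)
  let ?fb = "Node (Ml (ColC k) ?q) (map idt w)"
  have fb: "src ?fb = bar (src ?f)" "tgt ?fb = bar (tgt ?f)" "wf_tree LM ?fb" "bimod_typed kind ?fb"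
  proof -
    have "map src (map idt w) = w" "map tgt (map idt w) = w"
      using ww by (auto intro!: map_idI simp: src_idt tgt_idt)
    then show "src ?fb = bar (src ?f)" "tgt ?fb = bar (tgt ?f)"
      unfolding bars barT by (simp_all del: map_map)
    show "wf_tree LM ?fb" using qk ww by (auto simp: wf_idt lw)
    show "bimod_typed kind ?fb" using ww mw lw by (auto simp: mono_typed_idt)
  qed
  have cb: "cmp ?fb (absorb (src ?f)) = cmp (absorb (tgt ?f)) ?f"
  proof -
    have "cmp ?fb (graft Qb ?its) = Node (cl (Ml (ColC k) ?q) (src Qb)) (cmps (map idt w) ?its)"
      using fq(3) lw by (intro cmp_Node) (simp_all add: k_def)
    then show ?thesis unfolding cT bs using cmps_idt_left[OF wits(1), folded w_def] Qb(4) by simp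
  qed
  obtain r where r: "wf_tree LX r" "mono_typed ColA kind r" "leaves r = k" "src (spread ?q) = graft r (replicate k XC1)"
    using flat_src_ep[OF Qb(5)] fq(3) by auto
  let ?x = "\<lambda>t. Node (?XC (Suc 0)) [t]"
  \<comment> \<open>Each copy of \<open>XC1\<close> keeps its branch and carries an identity; only
    the \<open>A\<close>-part changes, which makes \<open>?fh\<close> pure.\<close>
  let ?fh = "Node (Ml (ColA k) r) (map (\<lambda>t. idt (?x t)) w)"
  have rk: "r \<in> tree_set LX (ColA k)" using r by (simp add: tree_set_iff)
  have gx: "graft_list (replicate (length us) XC1) us = map ?x us" for us
    by (induction us) auto
  have es: "spread (bar (src ?f)) = graft (spread ?q) (map idt w)"
    unfolding bars using flat_ep_graft[OF Qb(5)] fq(3) lw by simp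
  have epq: "wf_tree LM (spread ?q)" "tgt (spread ?q) = ?q" using ep_props[OF wf_mono[OF fq(1) LX_LO] fq(2)] by auto
  then have lep: "leaves (spread ?q) = k" using fq(3) by (metis leaves_tgt(1))
  have eT: "spread (bar (tgt ?f)) = Node (Ml (ColC k) (Node (Xl (ColA k)) (replicate k XC1))) (map idt w)"
    unfolding barT using lw by (simp add: ep_XC)
  have idw: "map src (map idt w) = w" using ww by (auto intro!: map_idI simp: src_idt)
  have wx: "wf_tree LO (?x t) \<and> src (idt (?x t)) = ?x t \<and> tgt (idt (?x t)) = ?x t" if "t \<in> set w" for t
  proof -
    have "wf_tree LO (?x t)" using bspec[OF ww that] by simp
    then show ?thesis using src_idt tgt_idt by blast
  qed
  have mx: "map src (map (\<lambda>t. idt (?x t)) w) = map ?x w" "map tgt (map (\<lambda>t. idt (?x t)) w) = map ?x w"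
    using wx by (simp_all del: idt_simps src_simps tgt_simps)
  have sT: "src (spread (bar (tgt ?f))) = Node (Xl (ColA k)) (map ?x w)"
    unfolding eT using idw gx[of w, unfolded lw] by (simp del: map_map)
  have fh: "src ?fh = src (spread (bar (src ?f)))" "tgt ?fh = src (spread (bar (tgt ?f)))"
  proof -
    have "src (spread (bar (src ?f))) = graft (graft r (replicate k XC1)) w"
      unfolding es using epq lep lw idw r(4) by (simp add: src_graft del: map_map)
    also have "\<dots> = graft r (map ?x w)"
      using gx[of w, unfolded lw] r(3) lw by (subst graft_graft(1)) (simp_all add: sum_list_replicate del: map_map)
    finally show "src ?fh = src (spread (bar (src ?f)))" using mx by (simp del: map_map idt_simps)
    show "tgt ?fh = src (spread (bar (tgt ?f)))" unfolding sT using mx by (simp del: map_map idt_simps)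
  qed
  have fh': "wf_tree LM ?fh" "bimod_typed kind ?fh" "A.pure ?fh"
  proof -
    show "wf_tree LM ?fh" using rk wx lw by (auto simp: wf_idt simp del: idt_simps)
    have "bimod_typed kind (idt (?x t))" if "t \<in> set w" for t
      using bimod_typed_idt[of "?x t"] wx[OF that] bspec[OF mw that] by (simp del: idt_simps)
    then show "bimod_typed kind ?fh" using lw by (simp del: idt_simps)
    have "A.pure (idt (?x t))" if "t \<in> set w" for t
      using wx[OF that] by (intro A_pure_idt) simp_all
    then show "A.pure ?fh" by (simp del: idt_simps)
  qed
  have ce: "cmp ?fb (spread (bar (src ?f))) = cmp (spread (bar (tgt ?f))) ?fh"
  proof -
    have ii: "cmps (map idt w) (map idt w) = map idt w"
      using ww idt_idem by (auto simp: cmps_map2 intro!: nth_equalityI)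
    have 1: "cmp ?fb (graft (spread ?q) (map idt w)) = Node (Ml (ColC k) (src (spread ?q))) (map idt w)"
      using cmp_Node[of "spread ?q" "Ml (ColC k) ?q" "map idt w" "map idt w"] epq fq(3) lw ii by (simp del: map_map)
    \<comment> \<open>\<open>?fh\<close> cut off just below its copies of \<open>XC1\<close>: the
      part lying over the root label of \<open>spread (bar (tgt ?f))\<close>.\<close>
    let ?R = "Node (Ml (ColA k) r) (replicate k (idt XC1))"
    have gi: "graft_list (replicate (length us) (idt XC1)) (map idt us) = map (\<lambda>t. idt (?x t)) us" for us
      by (induction us) auto
    have "?fh = graft ?R (map idt w)" using gi[of w, unfolded lw] by (simp del: map_map idt_simps)
    moreover have tR: "tgt ?R = Node (Xl (ColA k)) (replicate k XC1)"
      using tgt_idt[of XC1] by (simp del: idt_simps)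
    moreover have sR: "src ?R = src (spread ?q)"
      using src_idt[of XC1] r(4) by (simp del: idt_simps)
    ultimately have "cmp (spread (bar (tgt ?f))) ?fh = Node (Ml (ColC k) (src (spread ?q))) (map idt w)"
      unfolding eT
      using cmp_Node[of ?R "Ml (ColC k) (Node (Xl (ColA k)) (replicate k XC1))" "map idt w" "map idt w"] ii lw
      by (simp add: sum_list_replicate del: map_map idt_simps src_simps tgt_simps)
    then show ?thesis using 1 es by (simp only:)
  qed
  show ?thesis
    unfolding lifts_def by (intro exI[of _ ?fb] exI[of _ ?fh] conjI fb fh fh' cb ce)
qed

text \<open>Contracting \<open>A\<close>-clusters leaves the \<open>C\<close>-vertices and all below
  them in place, so the last leg of the zigzag stays in colour \<open>C\<close>.\<close>

lemma A_citems_bimod: "wf_tree LO t \<Longrightarrow> bimod_typed kind t \<Longrightarrow> \<forall>i \<in> set (A.items t). bimod_typed kind i"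
proof (induction t)
  case (Node l ts)
  have l: "l \<in> LO" "\<forall>t \<in> set ts. wf_tree LO t" using Node.prems by auto
  show ?case
  proof (cases "kind l \<in> range ColA")
    case True
    then have a: "kind l = ColA (length ts)" "\<forall>t \<in> set ts. bimod_typed kind t" using Node.prems(2) by auto
    have IH: "\<forall>i \<in> set (A.items t). bimod_typed kind i" if "t \<in> set ts" for t using Node.IH[OF that] a l that by simp
    then have "bimod_typed kind (A.contract t)" if "t \<in> set ts" for t using that by (simp add: A.contract_def)
    with True a IH show ?thesis by (cases "l \<in> LX") (simp_all add: A.citems_X A.citems_K)
  next
    case False
    then show ?thesis using bimod_typed_idt[OF Node.prems(1)] Node.prems(2) by (simp add: A.citems_other del: idt_simps)
  qed
qed simp

lemma lifts_exist: "wf_tree LM f \<Longrightarrow> bimod_typed kind f \<Longrightarrow> \<exists>fb fh. lifts f fb fh"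
proof (induction f)
  case (Node l fs)
  show ?case
  proof (cases "kind l = ColA (length fs)")
    case True
    then show ?thesis using Node by (intro lifts_A) auto
  next
    case False
    then have c: "kind l = ColC (length fs)" "\<forall>f \<in> set fs. wf_tree LM f \<and> mono_typed ColB kind f" "l \<in> LM"
      using Node.prems by auto
    from c(3) show ?thesis
    proof (cases rule: LM_cases)
      case (K d)
      then show ?thesis using c lifts_KC[OF c(2) refl] by simp
    next
      case (M d p)
      then show ?thesis using c lifts_XC[OF c(2) refl] by simp
    qed
  qed
qed simp

section \<open>Thin fundamental groupoids\<close>

lemma zigzag_ends: "zigzag C x w y \<Longrightarrow> category C \<Longrightarrow> x \<in> Obj C \<and> y \<in> Obj C"
  by (induction rule: zigzag.induct) (auto simp: category.Dom_closed category.Cod_closed)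

lemma zigzag_append: "zigzag C x v y \<Longrightarrow> zigzag C y w z \<Longrightarrow> zigzag C x (v @ w) z"
  by (induction rule: zigzag.induct) (auto intro: zigzag.intros)

fun flip :: "'m step \<Rightarrow> 'm step" where
  "flip (Fwd f) = Bwd f" | "flip (Bwd f) = Fwd f"

context category
begin

lemma zigzag_Fwd: "f \<in> Arr C \<Longrightarrow> zigzag C (Dom C f) [Fwd f] (Cod C f)"
  by (intro zz_fwd zz_nil Cod_closed)

lemma zigzag_Bwd: "f \<in> Arr C \<Longrightarrow> zigzag C (Cod C f) [Bwd f] (Dom C f)"
  by (intro zz_bwd zz_nil Dom_closed)

lemma zigzag_eq_zigzag: "zigzag_eq C x v w y \<Longrightarrow> zigzag C x v y \<and> zigzag C x w y"
proof (induction rule: zigzag_eq.induct)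
  case (ze_comp f g)
  then show ?case
    using zigzag_append[OF zigzag_Fwd[of f], of "[Fwd g]"] zigzag_Fwd[of g] zigzag_Fwd[of "Comp C g f"]
    by (simp add: Comp_closed Dom_Comp Cod_Comp)
next
  case (ze_inv1 f)
  then show ?case
    using zigzag_append[OF zigzag_Fwd[of f] zigzag_Bwd[of f]] by (simp add: zz_nil Dom_closed)
next
  case (ze_inv2 f)
  then show ?case
    using zigzag_append[OF zigzag_Bwd[of f] zigzag_Fwd[of f]] by (simp add: zz_nil Cod_closed)
next
  case (ze_id x)
  then show ?case using zigzag_Fwd[of "Id C x"] by (simp add: zz_nil Id_closed Dom_Id Cod_Id)
qed (auto intro: zigzag_append)

lemma zigzag_eq_context:
  "zigzag_eq C y v w z \<Longrightarrow> zigzag C x p y \<Longrightarrow> zigzag C z q u \<Longrightarrow> zigzag_eq C x (p @ v @ q) (p @ w @ q) u"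
  by (intro ze_append ze_refl)

lemma zigzag_flip: "zigzag C x w y \<Longrightarrow> zigzag C y (rev (map flip w)) x \<and> zigzag_eq C x (w @ rev (map flip w)) [] x"
proof (induction rule: zigzag.induct)
  case (zz_nil x)
  then show ?case by (auto intro: zigzag.zz_nil ze_refl)
next
  case (zz_fwd f w y)
  then have "zigzag C y (rev (map flip w) @ [Bwd f]) (Dom C f)"
    by (intro zigzag_append[OF _ zigzag_Bwd]) auto
  moreover have "zigzag_eq C (Dom C f) ([Fwd f] @ (w @ rev (map flip w)) @ [Bwd f]) ([Fwd f] @ [] @ [Bwd f]) (Dom C f)"
    using zz_fwd by (intro zigzag_eq_context) (auto intro: zigzag_Fwd zigzag_Bwd)
  ultimately show ?case using ze_trans[OF _ ze_inv1[OF zz_fwd(1)]] by simp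
next
  case (zz_bwd f w y)
  then have "zigzag C y (rev (map flip w) @ [Fwd f]) (Cod C f)"
    by (intro zigzag_append[OF _ zigzag_Fwd]) auto
  moreover have "zigzag_eq C (Cod C f) ([Bwd f] @ (w @ rev (map flip w)) @ [Fwd f]) ([Bwd f] @ [] @ [Fwd f]) (Cod C f)"
    using zz_bwd by (intro zigzag_eq_context) (auto intro: zigzag_Fwd zigzag_Bwd)
  ultimately show ?case using ze_trans[OF _ ze_inv2[OF zz_bwd(1)]] by simp
qed

text \<open>Two squares and a triangle pasted along the zigzag. The trivial detour
  \<open>Bwd e\<close>, \<open>Fwd e\<close> is inserted before \<open>fb\<close>, so that the
  second square can replace \<open>e\<close>, \<open>fb\<close> by \<open>fh\<close>,
  \<open>e'\<close>; then \<open>e'\<close> cancels and the triangle applies.\<close>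

lemma span_natural:
  assumes ar: "f \<in> Arr C" "b \<in> Arr C" "e \<in> Arr C" "n \<in> Arr C" "b' \<in> Arr C" "e' \<in> Arr C" "n' \<in> Arr C"
      "fb \<in> Arr C" "fh \<in> Arr C"
    and d: "Dom C f = Dom C b" "Cod C f = Dom C b'" "Cod C b = Cod C e" "Dom C e = Dom C n"
      "Cod C b' = Cod C e'" "Dom C e' = Dom C n'"
      "Dom C fb = Cod C b" "Cod C fb = Cod C b'" "Dom C fh = Dom C e" "Cod C fh = Dom C e'"
    and c: "Comp C fb b = Comp C b' f" "Comp C fb e = Comp C e' fh" "Comp C n' fh = n"
  shows "zigzag_eq C (Dom C f) [Fwd f, Fwd b', Bwd e', Fwd n'] [Fwd b, Bwd e, Fwd n] (Cod C n)"
proof -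
  have cn: "Cod C n' = Cod C n" using Cod_Comp[of fh n'] ar d c by simp
  have F: "zigzag C (Dom C g) [Fwd g] (Cod C g)" "zigzag C (Cod C g) [Bwd g] (Dom C g)" if "g \<in> Arr C" for g
    using zigzag_Fwd zigzag_Bwd that by auto
  have q: "zigzag C (Cod C b') [Bwd e', Fwd n'] (Cod C n)"
    using zigzag_append[OF F(2)[OF ar(6)], of "[Fwd n']"] F(1)[OF ar(7)] d cn by simp
  have be: "zigzag C (Dom C f) [Fwd b, Bwd e] (Dom C e)"
    using zigzag_append[OF F(1)[OF ar(2)], of "[Bwd e]"] F(2)[OF ar(3)] d by simp
  have id: "zigzag C (Dom C f) [] (Dom C f)" by (rule zz_nil[OF Dom_closed[OF ar(1)]])
  have "zigzag_eq C (Dom C f) [Fwd f, Fwd b'] [Fwd (Comp C b' f)] (Cod C b')"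
    using ze_comp[OF ar(1,5) d(2)] .
  from zigzag_eq_context[OF this id q]
  have 1: "zigzag_eq C (Dom C f) [Fwd f, Fwd b', Bwd e', Fwd n'] [Fwd (Comp C b' f), Bwd e', Fwd n'] (Cod C n)" by simp
  have "zigzag_eq C (Dom C f) [Fwd (Comp C b' f)] [Fwd b, Fwd fb] (Cod C b')"
    using ze_sym[OF ze_comp[OF ar(2,8)]] d c by simp
  from zigzag_eq_context[OF this id q]
  have 2: "zigzag_eq C (Dom C f) [Fwd (Comp C b' f), Bwd e', Fwd n'] [Fwd b, Fwd fb, Bwd e', Fwd n'] (Cod C n)" by simp
  have q2: "zigzag C (Cod C b) [Fwd fb, Bwd e', Fwd n'] (Cod C n)"
    using zigzag_append[OF F(1)[OF ar(8)]] q d by simp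
  have "zigzag_eq C (Cod C b) [] [Bwd e, Fwd e] (Cod C b)" using ze_sym[OF ze_inv2[OF ar(3)]] d by simp
  moreover have "zigzag C (Dom C f) [Fwd b] (Cod C b)" using F(1)[OF ar(2)] d by simp
  ultimately have 3: "zigzag_eq C (Dom C f) [Fwd b, Fwd fb, Bwd e', Fwd n']
      [Fwd b, Bwd e, Fwd e, Fwd fb, Bwd e', Fwd n'] (Cod C n)"
    using zigzag_eq_context[OF _ _ q2] by fastforce
  have "zigzag_eq C (Dom C e) [Fwd e, Fwd fb] [Fwd (Comp C fb e)] (Cod C b')"
    using ze_comp[OF ar(3,8)] d by simp
  from zigzag_eq_context[OF this be q]
  have 4: "zigzag_eq C (Dom C f) [Fwd b, Bwd e, Fwd e, Fwd fb, Bwd e', Fwd n']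
      [Fwd b, Bwd e, Fwd (Comp C fb e), Bwd e', Fwd n'] (Cod C n)" by simp
  have "zigzag_eq C (Dom C e) [Fwd (Comp C fb e)] [Fwd fh, Fwd e'] (Cod C b')"
    using ze_sym[OF ze_comp[OF ar(9,6)]] d c by simp
  from zigzag_eq_context[OF this be q]
  have 5: "zigzag_eq C (Dom C f) [Fwd b, Bwd e, Fwd (Comp C fb e), Bwd e', Fwd n']
     [Fwd b, Bwd e, Fwd fh, Fwd e', Bwd e', Fwd n'] (Cod C n)" by simp
  have "zigzag C (Dom C f) [Fwd b, Bwd e, Fwd fh] (Dom C e')"
    using zigzag_append[OF be, of "[Fwd fh]"] F(1)[OF ar(9)] d by simp
  moreover have "zigzag C (Dom C e') [Fwd n'] (Cod C n)" using F(1)[OF ar(7)] d cn by simp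
  ultimately have 6: "zigzag_eq C (Dom C f) [Fwd b, Bwd e, Fwd fh, Fwd e', Bwd e', Fwd n']
     [Fwd b, Bwd e, Fwd fh, Fwd n'] (Cod C n)"
    using zigzag_eq_context[OF ze_inv1[OF ar(6)]] by fastforce
  have "zigzag_eq C (Dom C e) [Fwd fh, Fwd n'] [Fwd n] (Cod C n)"
    using ze_comp[OF ar(9,7)] d c cn by simp
  from ze_append[OF ze_refl[OF be] this]
  have 7: "zigzag_eq C (Dom C f) [Fwd b, Bwd e, Fwd fh, Fwd n'] [Fwd b, Bwd e, Fwd n] (Cod C n)" by simp
  show ?thesis
    by (rule ze_trans[OF 1 ze_trans[OF 2 ze_trans[OF 3 ze_trans[OF 4 ze_trans[OF 5 ze_trans[OF 6 7]]]]]])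
qed

text \<open>A path from every object to a chosen representative of its component, natural in the object,
  makes all parallel zigzags equal.\<close>

lemma fundamental_groupoid_discrete:
  assumes z: "\<And>x. x \<in> Obj C \<Longrightarrow> zigzag C x (z x) (N x)"
    and nat: "\<And>f. f \<in> Arr C \<Longrightarrow> N (Dom C f) = N (Cod C f) \<and>
      zigzag_eq C (Dom C f) (Fwd f # z (Cod C f)) (z (Dom C f)) (N (Dom C f))"
  shows "equivalent_categories (fundamental_groupoid C) (discrete_cat (N ` Obj C))"
proof -
  have cat: "category C" by (rule category_axioms)
  \<comment> \<open>Naturality passes from arrows to zigzags by induction; for a backward step the
    square is used in reverse and the step then cancels.\<close>
  have abs: "N x = N y \<and> zigzag_eq C x (w @ z y) (z x) (N x)" if "zigzag C x w y" for x w y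
    using that
  proof (induction rule: zigzag.induct)
    case (zz_nil x)
    then show ?case using z by (auto intro: ze_refl)
  next
    case (zz_fwd f w y)
    have "zigzag_eq C (Dom C f) ([Fwd f] @ (w @ z y)) ([Fwd f] @ z (Cod C f)) (N (Cod C f))"
      using zz_fwd by (intro ze_append[OF ze_refl[OF zigzag_Fwd]]) auto
    then have "zigzag_eq C (Dom C f) ((Fwd f # w) @ z y) (Fwd f # z (Cod C f)) (N (Dom C f))"
      using nat[OF zz_fwd(1)] by simp
    from ze_trans[OF this conjunct2[OF nat[OF zz_fwd(1)]]] show ?case
      using nat[OF zz_fwd(1)] zz_fwd by simp
  next
    case (zz_bwd f w y)
    have N: "N (Dom C f) = N (Cod C f)" using nat[OF zz_bwd(1)] by simp
    have "zigzag_eq C (Cod C f) ([Bwd f] @ (w @ z y)) ([Bwd f] @ z (Dom C f)) (N (Cod C f))"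
      using zz_bwd N by (intro ze_append[OF ze_refl[OF zigzag_Bwd]]) auto
    moreover have "zigzag_eq C (Cod C f) ([Bwd f] @ z (Dom C f)) ([Bwd f] @ (Fwd f # z (Cod C f))) (N (Cod C f))"
      using ze_sym[OF conjunct2[OF nat[OF zz_bwd(1)]]] N
      by (intro ze_append[OF ze_refl[OF zigzag_Bwd[OF zz_bwd(1)]]]) simp
    moreover have "zigzag_eq C (Cod C f) ([Bwd f, Fwd f] @ z (Cod C f)) ([] @ z (Cod C f)) (N (Cod C f))"
      by (rule ze_append[OF ze_inv2[OF zz_bwd(1)] ze_refl[OF z[OF Cod_closed[OF zz_bwd(1)]]]])
    ultimately have "zigzag_eq C (Cod C f) ([Bwd f] @ (w @ z y)) (z (Cod C f)) (N (Cod C f))"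
      using ze_trans[OF ze_trans, of C "Cod C f" "[Bwd f] @ (w @ z y)" "[Bwd f] @ z (Dom C f)"
        "N (Cod C f)" "[Bwd f] @ (Fwd f # z (Cod C f))" "z (Cod C f)"] by simp
    then show ?case using zz_bwd N by simp
  qed
  \<comment> \<open>Every zigzag from \<open>x\<close> to \<open>y\<close> equals \<open>z x\<close>
    followed by the inverse of \<open>z y\<close>, which depends only on the ends.\<close>
  have thin: "zigzag_eq C x v w y" if v: "zigzag C x v y" and w: "zigzag C x w y" for x v w y
  proof -
    have y: "y \<in> Obj C" using zigzag_ends[OF v cat] by simp
    let ?i = "rev (map flip (z y))"
    have i: "zigzag C (N y) ?i y" "zigzag_eq C y (z y @ ?i) [] y" using zigzag_flip[OF z[OF y]] by auto
    have *: "zigzag_eq C x u (z x @ ?i) y" if u: "zigzag C x u y" for u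
    proof -
      have "zigzag_eq C x (u @ []) (u @ (z y @ ?i)) y" by (rule ze_append[OF ze_refl[OF u] ze_sym[OF i(2)]])
      moreover have "zigzag_eq C x ((u @ z y) @ ?i) (z x @ ?i) y"
        using abs[OF u] i(1) by (intro ze_append[where y = "N x"]) (auto intro: ze_refl)
      ultimately show ?thesis
        using ze_trans[of C x u "u @ z y @ ?i" y "z x @ ?i"] by simp
    qed
    show ?thesis by (rule ze_trans[OF *[OF v] ze_sym[OF *[OF w]]])
  qed
  \<comment> \<open>By thinness the class of a zigzag consists of all zigzags with the same ends, so
    \<open>H x y\<close> is the only possible arrow from \<open>x\<close> to
    \<open>y\<close>.\<close>
  define H where "H x y = (x, {v. zigzag C x v y}, y)" for x y
  let ?G = "fundamental_groupoid C"
  have cls: "{v. zigzag_eq C x w v y} = {v. zigzag C x v y}" if "zigzag C x w y" for x w y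
    using thin[OF that] zigzag_eq_zigzag by blast
  have Arr: "Arr ?G = {H x y | x y. \<exists>w. zigzag C x w y}"
  proof (rule set_eqI)
    have e: "(x, {v. zigzag_eq C x w v y}, y) = H x y" if "zigzag C x w y" for x w y
      unfolding H_def cls[OF that] ..
    show "a \<in> Arr ?G \<longleftrightarrow> a \<in> {H x y | x y. \<exists>w. zigzag C x w y}" for a
      unfolding fundamental_groupoid_def cat.select_convs mem_Collect_eq by (metis e)
  qed
  have Id: "Id ?G x = H x x" if "x \<in> Obj C" for x
    using cls[OF zz_nil[OF that]] by (simp add: fundamental_groupoid_def H_def)
  have Comp: "Comp ?G (H y w) (H x y) = H x w" if "zigzag C x u y" "zigzag C y v w" for x y w u v
  proof -
    have "{t. \<exists>a\<in>{v. zigzag C x v y}. \<exists>b\<in>{v. zigzag C y v w}. zigzag_eq C x (a @ b) t w} = {t. zigzag C x t w}"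
      using that thin[OF zigzag_append[OF that]] zigzag_eq_zigzag by blast
    then show ?thesis by (simp add: fundamental_groupoid_def H_def)
  qed
  have DC: "Dom ?G (H x y) = x" "Cod ?G (H x y) = y" "Obj ?G = Obj C" for x y
    by (simp_all add: fundamental_groupoid_def H_def)
  \<comment> \<open>\<open>z x\<close> is itself a zigzag from \<open>x\<close> to
    \<open>N x\<close>, so \<open>abs\<close> shows that \<open>N\<close> is idempotent.\<close>
  have Nobj: "N x \<in> Obj C" "N (N x) = N x" if "x \<in> Obj C" for x
    using zigzag_ends[OF z[OF that] cat] abs[OF z[OF that]] by auto
  have nil: "zigzag C x [] x" if "x \<in> Obj C" for x using that by (rule zz_nil)
  have ends: "x \<in> Obj C" "y \<in> Obj C" "N x = N y" if "zigzag C x w y" for x w y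
    using zigzag_ends[OF that cat] abs[OF that] by auto
  have Harr: "arrow ?G (H x y) x y" if "zigzag C x w y" for x w y
    using that by (auto simp: arrow_def Arr DC)
  let ?D = "discrete_cat (N ` Obj C)"
  let ?FM = "\<lambda>(x, _, _). N x" and ?GM = "\<lambda>d. H d d"
  have FH: "?FM (H x y) = N x" for x y by (simp add: H_def)
  have "is_functor ?G ?D N ?FM"
    unfolding is_functor_def
  proof (intro conjI ballI impI)
    show "N x \<in> Obj ?D" "?FM (Id ?G x) = Id ?D (N x)" if "x \<in> Obj ?G" for x
      using that unfolding DC by (simp_all add: Id FH discrete_cat_def)
    fix f assume "f \<in> Arr ?G"
    then obtain x y w where f: "f = H x y" "zigzag C x w y" by (auto simp: Arr)
    show "arrow ?D (?FM f) (N (Dom ?G f)) (N (Cod ?G f))"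
      unfolding f(1) FH DC using ends[OF f(2)] by (simp add: arrow_def discrete_cat_def)
    fix g assume "g \<in> Arr ?G" "Cod ?G f = Dom ?G g"
    then obtain u v where g: "g = H y u" "zigzag C y v u" by (auto simp: Arr f DC)
    show "?FM (Comp ?G g f) = Comp ?D (?FM g) (?FM f)"
      unfolding f(1) g(1) Comp[OF f(2) g(2)] FH by (simp add: discrete_cat_def)
  qed
  moreover have "is_functor ?D ?G (\<lambda>d. d) ?GM"
    unfolding is_functor_def using Nobj Harr[OF nil]
    by (auto simp: DC Id Comp[OF nil nil] discrete_cat_def)
  moreover have "is_nat_trans ?G ?G (\<lambda>x. x) (\<lambda>f. f) ((\<lambda>d. d) \<circ> N) (?GM \<circ> ?FM) (\<lambda>x. H x (N x))"
    unfolding is_nat_trans_def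
  proof (intro conjI ballI)
    show "arrow ?G (H x (N x)) x (((\<lambda>d. d) \<circ> N) x)" if "x \<in> Obj ?G" for x
      using Harr[OF z] that by (simp add: DC)
    fix f assume "f \<in> Arr ?G"
    then obtain x y w where f: "f = H x y" "zigzag C x w y" by (auto simp: Arr)
    have "Comp ?G (H y (N y)) (H x y) = H x (N y)" by (rule Comp[OF f(2) z[OF ends(2)[OF f(2)]]])
    moreover have "Comp ?G (H (N x) (N x)) (H x (N x)) = H x (N x)"
      using ends[OF f(2)] Nobj by (intro Comp[OF z nil]) auto
    ultimately show "Comp ?G (H (Cod ?G f) (N (Cod ?G f))) f = Comp ?G ((?GM \<circ> ?FM) f) (H (Dom ?G f) (N (Dom ?G f)))"
      using f ends(3)[OF f(2)] by (simp add: DC FH)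
  qed
  moreover have "is_iso ?G (H x (N x))" if x: "x \<in> Obj ?G" for x
  proof -
    have x: "x \<in> Obj C" using x by (simp add: DC)
    note zx = z[OF x] and fz = conjunct1[OF zigzag_flip[OF z[OF x]]]
    show ?thesis
      unfolding is_iso_def using Harr[OF zx] Harr[OF fz] Comp[OF zx fz] Comp[OF fz zx] x Nobj[OF x]
      by (intro conjI exI[of _ "H (N x) x"]) (auto simp: arrow_def Id)
  qed
  moreover have "is_nat_trans ?D ?D (N \<circ> (\<lambda>d. d)) (?FM \<circ> ?GM) (\<lambda>y. y) (\<lambda>g. g) (\<lambda>d. d)"
    unfolding is_nat_trans_def using Nobj by (auto simp: arrow_def FH discrete_cat_def)
  moreover have "is_iso ?D d" if "d \<in> Obj ?D" for d
    using that by (auto simp: is_iso_def arrow_def discrete_cat_def)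
  ultimately show ?thesis unfolding equivalent_categories_def by blast
qed

end

section \<open>The natural zigzags in the classifier\<close>

lemma C_arrows:
  assumes "t \<in> obj (ColC n)"
  shows "absorb t \<in> arr (ColC n)" "src (absorb t) = t"
    "spread (bar t) \<in> arr (ColC n)" "tgt (spread (bar t)) = bar t"
    "A.contract (src (spread (bar t))) \<in> arr (ColC n)" "src (A.contract (src (spread (bar t)))) = src (spread (bar t))"
proof -
  have t: "wf_tree LO t" "bimod_typed kind t" "leaves t = n" using assms by (auto simp: tree_set_iff)
  note b = bt_props[OF t(1,2)]
  have lb: "leaves (absorb t) = n" using leaves_src[of "absorb t"] b t(3) by simp
  have s: "wf_tree LO (bar t)" "bimod_typed kind (bar t)" using bar_props[OF t(1,2)] by auto
  note e = ep_props[OF s]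
  have le: "leaves (spread (bar t)) = n" using leaves_tgt(1)[of "spread (bar t)"] e lb by simp
  let ?u = "src (spread (bar t))"
  have u: "wf_tree LO ?u" "bimod_typed kind ?u" "leaves ?u = n"
    using e le wf_src[of "spread (bar t)"] bimod_typed_src[of "spread (bar t)"] by auto
  have c: "wf_tree LM (A.contract ?u)" "src (A.contract ?u) = ?u" using A.wf_con[OF u(1)] A.src_con[OF u(1)] by auto
  have lc: "leaves (A.contract ?u) = n" using leaves_src[OF c(1)] c(2) u(3) by simp
  have "\<forall>i \<in> set (A.items ?u). bimod_typed kind i" using A_citems_bimod[OF u(1,2)] .
  then have "bimod_typed kind (A.contract ?u)" by (simp add: A.contract_def)
  then show "absorb t \<in> arr (ColC n)" "src (absorb t) = t"
    "spread (bar t) \<in> arr (ColC n)" "tgt (spread (bar t)) = bar t"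
    "A.contract (src (spread (bar t))) \<in> arr (ColC n)" "src (A.contract (src (spread (bar t)))) = src (spread (bar t))"
    using b lb e le c lc by (auto simp: tree_set_iff)
qed

context tree_encoding
begin

abbreviation T :: "(colour \<times> 'v, colour \<times> 'v) cat" where "T \<equiv> total_cat triple_operad W"

lemma T_simps:
  "Obj T = (SIGMA a:UNIV. enc ` obj a)" "Arr T = (SIGMA a:UNIV. enc ` arr a)"
  "Dom T (a, enc f) = (a, enc (src f))" "Cod T (a, enc f) = (a, enc (tgt f))"
  "Comp T (a, enc g) (b, enc f) = (b, enc (cmp g f))"
  by (auto simp: total_cat_def triple_simps(1))

lemma T_arr: "f \<in> arr a \<Longrightarrow> (a, enc f) \<in> Arr T"
  by (simp add: T_simps)

fun path :: "colour \<times> 'v \<Rightarrow> (colour \<times> 'v) step list" where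
  "path (ColA n, x) = [Fwd (ColA n, enc (A.contract (dec x)))]"
| "path (ColB n, x) = [Fwd (ColB n, enc (B.contract (dec x)))]"
| "path (ColC n, x) = [Fwd (ColC n, enc (absorb (dec x))), Bwd (ColC n, enc (spread (bar (dec x)))),
     Fwd (ColC n, enc (A.contract (src (spread (bar (dec x))))))]"

fun nf :: "colour \<times> 'v \<Rightarrow> colour \<times> 'v" where
  "nf (ColA n, x) = (ColA n, enc (tgt (A.contract (dec x))))"
| "nf (ColB n, x) = (ColB n, enc (tgt (B.contract (dec x))))"
| "nf (ColC n, x) = (ColC n, enc (tgt (A.contract (src (spread (bar (dec x)))))))"

lemma path_zigzag:
  assumes "x \<in> Obj T" shows "zigzag T x (path x) (nf x)"
proof -
  interpret T: category T by (rule total_cat_W)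
  obtain a t where x: "x = (a, enc t)" "t \<in> obj a" using assms by (auto simp: T_simps)
  show ?thesis
  proof (cases a)
    case (ColA n)
    then show ?thesis
      using T.zigzag_Fwd[OF T_arr[OF A.con_arr]] x A.src_con[OF tree_set_wf] by (simp add: T_simps)
  next
    case (ColB n)
    then show ?thesis
      using T.zigzag_Fwd[OF T_arr[OF B.con_arr]] x B.src_con[OF tree_set_wf] by (simp add: T_simps)
  next
    case (ColC n)
    note c = C_arrows[OF x(2)[unfolded ColC]]
    have "zigzag T x [Fwd (a, enc (absorb t))] (a, enc (bar t))"
      using T.zigzag_Fwd[OF T_arr[OF c(1)]] c(2) x ColC by (simp add: T_simps)
    moreover have "zigzag T (a, enc (bar t)) [Bwd (a, enc (spread (bar t)))] (a, enc (src (spread (bar t))))"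
      using T.zigzag_Bwd[OF T_arr[OF c(3)]] c(4) ColC by (simp add: T_simps)
    moreover have "zigzag T (a, enc (src (spread (bar t)))) [Fwd (a, enc (A.contract (src (spread (bar t)))))] (nf x)"
      using T.zigzag_Fwd[OF T_arr[OF c(5)]] c(6) ColC x by (simp add: T_simps)
    ultimately have "zigzag T x ([Fwd (a, enc (absorb t))] @ [Bwd (a, enc (spread (bar t)))] @ [Fwd (a, enc (A.contract (src (spread (bar t)))))]) (nf x)"
      by (blast intro: zigzag_append)
    then show ?thesis using ColC x by simp
  qed
qed

lemma path_natural:
  assumes "f \<in> Arr T"
  shows "nf (Dom T f) = nf (Cod T f) \<and> zigzag_eq T (Dom T f) (Fwd f # path (Cod T f)) (path (Dom T f)) (nf (Dom T f))"
proof -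
  interpret T: category T by (rule total_cat_W)
  obtain a g where f: "f = (a, enc g)" "g \<in> arr a" using assms by (auto simp: T_simps)
  have w: "wf_tree LM g" by (rule tree_set_wf[OF f(2)])
  have st: "src g \<in> obj a" "tgt g \<in> obj a" using src_obj tgt_obj f(2) by auto
  \<comment> \<open>Shared by the colours \<open>A\<close> and \<open>B\<close>, where the zigzag is
    a single contraction.\<close>
  have one: ?thesis
    if contract: "\<And>t. t \<in> obj a \<Longrightarrow> contract t \<in> arr a" "\<And>t. t \<in> obj a \<Longrightarrow> src (contract t) = t" "cmp (contract (tgt g)) g = contract (src g)"
      and p: "\<And>x. path (a, x) = [Fwd (a, enc (contract (dec x)))]" "\<And>x. nf (a, x) = (a, enc (tgt (contract (dec x))))" for contract
  proof -
    have "tgt (contract (src g)) = tgt (contract (tgt g))"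
      using cmp_arr(3)[OF contract(1)[OF st(2)] f(2)] contract(2)[OF st(2)] contract(3) by simp
    moreover have "zigzag_eq T (Dom T f) [Fwd f, Fwd (a, enc (contract (tgt g)))] [Fwd (Comp T (a, enc (contract (tgt g))) f)]
        (Cod T (a, enc (contract (tgt g))))"
      using contract st f by (intro ze_comp) (simp_all add: T_simps)
    ultimately show ?thesis
      using contract(3) p f by (simp add: T_simps)
  qed
  show ?thesis
  proof (cases a)
    case (ColA n)
    have "A.pure g" using f(2) ColA by (intro A.mono_typed_pure) (simp add: tree_set_def)
    then show ?thesis
      by (intro one[of A.contract]) (use A.con_arr A.src_con[OF tree_set_wf] A.con_natural[OF w] ColA in simp_all)
  next
    case (ColB n)
    have "B.pure g" using f(2) ColB by (intro B.mono_typed_pure) (simp add: tree_set_def)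
    then show ?thesis
      by (intro one[of B.contract]) (use B.con_arr B.src_con[OF tree_set_wf] B.con_natural[OF w] ColB in simp_all)
  next
    case (ColC n)
    have "bimod_typed kind g" using f(2) ColC by (simp add: tree_set_def)
    then obtain fb fh where l: "lifts g fb fh" using lifts_exist[OF w] by blast
    note c = C_arrows[OF st(1)[unfolded ColC]] and d = C_arrows[OF st(2)[unfolded ColC]]
    have s: "src fb = bar (src g)" "tgt fb = bar (tgt g)" "src fh = src (spread (bar (src g)))"
      "tgt fh = src (spread (bar (tgt g)))" "cmp fb (absorb (src g)) = cmp (absorb (tgt g)) g"
      "cmp fb (spread (bar (src g))) = cmp (spread (bar (tgt g))) fh" "wf_tree LM fb" "wf_tree LM fh" "A.pure fh"
      using l unfolding lifts_def by blast+
    have fb: "fb \<in> arr a" "fh \<in> arr a"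
    proof -
      show "fb \<in> arr a"
        using arr_of_tgt[OF s(7), of a] s(2) tgt_obj[OF d(1)] ColC by simp
      show "fh \<in> arr a"
        using arr_of_tgt[OF s(8), of a] s(4) src_obj[OF d(3)] ColC by simp
    qed
    let ?n = "A.contract (src (spread (bar (src g))))" and ?n' = "A.contract (src (spread (bar (tgt g))))"
    \<comment> \<open>The triangle at the last leg: \<open>fh\<close> is pure, so the contraction of
      \<open>A\<close>-clusters is natural along it.\<close>
    have n: "cmp ?n' fh = ?n" using A.con_natural[OF s(8,9)] s(3,4) by simp
    have nf: "tgt ?n' = tgt ?n" using cmp_arr(3)[of ?n' a fh] d(5,6) fb(2) s(4) n ColC by simp
    have "zigzag_eq T (Dom T f) [Fwd f, Fwd (a, enc (absorb (tgt g))), Bwd (a, enc (spread (bar (tgt g)))), Fwd (a, enc ?n')]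
        [Fwd (a, enc (absorb (src g))), Bwd (a, enc (spread (bar (src g)))), Fwd (a, enc ?n)] (Cod T (a, enc ?n))"
      by (rule T.span_natural[where fb = "(a, enc fb)" and fh = "(a, enc fh)"])
        (use c d s fb f n ColC in \<open>simp_all add: T_simps\<close>)
    then show ?thesis using nf ColC f by (simp add: T_simps)
  qed
qed

lemma discrete_W:
  "equivalent_categories (fundamental_groupoid T) (discrete_cat (nf ` Obj T))"
  by (rule category.fundamental_groupoid_discrete[OF total_cat_W path_zigzag path_natural])

end

theorem proposition4p25:
  assumes "infinite (UNIV :: 'v set)"
  shows "quasi_tame TYPE('v) triple_substitude"
proof -
  \<comment> \<open>Trees form a countable type and \<open>nat\<close> embeds into every infinite
    type, so they can be encoded in \<open>'v\<close>.\<close>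
  obtain f :: "nat \<Rightarrow> 'v" where "inj f" using infinite_countable_subset[OF assms] by blast
  then have "inj (f \<circ> to_nat :: tree \<Rightarrow> 'v)" by (intro inj_compose inj_to_nat)
  then interpret tree_encoding "f \<circ> to_nat" by unfold_locales
  show ?thesis
    unfolding quasi_tame_def triple_substitude_simps using is_classifier_W discrete_W by blast
qed

end
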